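(* Let $H<\mathrm{GL}(d,\mathbb{R})$ be an admissible dilation group with open dual orbit $\mathcal{O}$ and $G=\mathbb{R}^d\rtimes H$. Let $1\le p\le\infty$, $1\le q<\infty$, $s\ge0$. Let $v$ be a weight on $G$ satisfying $v(x,h)\le(1+|x|)^sw(h)$ for all $(x,h)\in G$, for a suitable weight $w$ on $H$. Assume that $\mathcal{O}$ is $(s,q,w)$-temperately embedded with index $\ell\in\mathbb{N}$. Let $t\in\mathbb{N}$ with $t>\ell+s+1+d/p$ (where $d/\infty=0$). Then there exists a constant $C_{p,q}>0$ such that for all $f,\psi\in L^1(\mathbb{R}^d)$ having vanishing moments in $\mathcal{O}^c$ of order $t$, $$\|\mathcal{W}_\psi f\|_{L^{p,q}_v}\le C_{p,q}\,|\widehat f|_{t,t}\,|\widehat\psi|_{t,t}.$$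
   Context: Let $d>1$ and let $H$ be a closed subgroup of $\mathrm{GL}(d,\mathbb{R})$. $G=\mathbb{R}^d\rtimes H$ has product $(x,h)(y,g)=(x+hy,hg)$ and left Haar measure $|\det h|^{-1}\,dx\,dh$, with $dh$ left Haar measure on $H$. The quasi-regular representation is $[\pi(x,h)f](y)=|\det h|^{-1/2}f(h^{-1}(y-x))$ on $L^2(\mathbb{R}^d)$. $H$ is called an admissible dilation group if $\pi$ is irreducible and square-integrable (there is a nonzero $\psi$ with $(x,h)\mapsto\langle\psi,\pi(x,h)\psi\rangle$ in $L^2(G)$). It is known that this holds iff the dual action $(\xi,h)\mapsto h^T\xi$ has a single open orbit $\mathcal{O}=\{h^T\xi_0:h\in H\}$ of full measure, with compact stabilizers; $\mathcal{O}$ is called the open dual orbit and $\mathcal{O}^c=\mathbb{R}^d\setminus\mathcal{O}$. $\mathcal{W}_\psi f(x,h)=\langle f,\pi(x,h)\psi\rangle=|\det h|^{-1/2}\int f(y)\overline{\psi(h^{-1}(y-x))}\,dy$. Fourier transform: $\widehat f(\xi)=\int f(x)e^{-2\pi i\langle x,\xi\rangle}dx$. A weight on a locally compact group is a continuous positive submultiplicative function. $L^{p,q}_v(G)$ is the space of measurable $F$ on $G$ with finite norm $\left(\int_H\left(\int_{\mathbb{R}^d}|F(x,h)|^pv(x,h)^pdx\right)^{q/p}\frac{dh}{|\det h|}\right)^{1/q}$, integrals being replaced by essential suprema for infinite exponents. For $r,m>0$: $|g|_{r,m}=\sup_{x\in\mathbb{R}^d,|\alpha|\le r}(1+|x|)^m|\partial^\alpha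 g(x)|$, where $|\alpha|=\sum_i\alpha_i$ for multiindices and $|x|$ is the euclidean norm for vectors. Auxiliary function: $A(\xi)=\min\left(\frac{\mathrm{dist}(\xi,\mathcal{O}^c)}{1+\sqrt{|\xi|^2-\mathrm{dist}(\xi,\mathcal{O}^c)^2}},\frac1{1+|\xi|}\right)$ for $\xi\in\mathcal{O}$, with $\mathrm{dist}$ the euclidean distance. For a weight $w$ on $H$, $s\ge0$, $1\le q<\infty$, the orbit $\mathcal{O}$ is $(s,q,w)$-temperately embedded with index $\ell\in\mathbb{N}$ if for a fixed $\xi_0\in\mathcal{O}$ (the choice is immaterial): (i) $h\mapsto|\det h|^{1/2-1/q}(1+\|h\|)^{s+d+1}w(h)A(h^T\xi_0)^\ell$ is in $L^q(H)$, and (ii) $h\mapsto|\det h|^{-1/2-1/q}(1+\|h\|)^{s+d+1}w(h)A(h^{-T}\xi_0)^\ell$ is in $L^1(H)$; here $\|\cdot\|$ is any matrix norm, $h^{-T}$ is the transpose inverse, and $L^q(H)$ is with respect to left Haar measure. For $r\in\mathbb{N}$, $f\in L^1(\mathbb{R}^d)$ has vanishing moments in $\mathcal{O}^c$ of order $r$ if all distributional derivatives $\partial^\alpha\widehat f$ with $|\alpha|\le r$ are continuous functions, and all those with $|\alpha|<r$ vanish identically on $\mathcal{O}^c$. *)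

theory Defs
  imports "HOL-Analysis.Analysis" "HOL-Probability.Essential_Supremum"
begin

section \<open>Lebesgue norms\<close>

text \<open>The library has no real powers on \<^typ>\<open>ennreal\<close>; the exponent \<open>a\<close> is positive
  in all uses below.\<close>

definition ennreal_powr :: "ennreal \<Rightarrow> real \<Rightarrow> ennreal" where
  "ennreal_powr x a = (if x = \<infinity> then \<infinity> else ennreal (enn2real x powr a))"

definition Lp_norm :: "'a measure \<Rightarrow> ennreal \<Rightarrow> ('a \<Rightarrow> ennreal) \<Rightarrow> ennreal" where
  "Lp_norm M p F =
     (if p = \<infinity> then esssup M F
      else ennreal_powr (\<integral>\<^sup>+ x. ennreal_powr (F x) (enn2real p) \<partial>M) (1 / enn2real p))"

definition Lp_space :: "'a measure \<Rightarrow> ennreal \<Rightarrow> ('a \<Rightarrow> 'b::real_normed_vector) set" where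
  "Lp_space M p = {F \<in> borel_measurable M. Lp_norm M p (\<lambda>x. ennreal (norm (F x))) < \<infinity>}"

abbreviation L2_space :: "((real ^ 'n) \<Rightarrow> complex) set" where
  "L2_space \<equiv> Lp_space lborel 2"

definition inner_L2 :: "((real ^ 'n) \<Rightarrow> complex) \<Rightarrow> ((real ^ 'n) \<Rightarrow> complex) \<Rightarrow> complex" where
  "inner_L2 f g = (LINT y|lborel. f y * cnj (g y))"

section \<open>The groups \<open>H\<close> and \<open>G\<close>\<close>

definition closed_subgroup_GL :: "(real ^ 'n ^ 'n) set \<Rightarrow> bool" where
  "closed_subgroup_GL H \<longleftrightarrow>
     H \<subseteq> {h. invertible h} \<and> mat 1 \<in> H \<and>
     (\<forall>g\<in>H. \<forall>h\<in>H. g ** h \<in> H) \<and> (\<forall>h\<in>H. matrix_inv h \<in> H) \<and>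
     closedin (top_of_set {h. invertible h}) H"

text \<open>\<open>H\<close> is locally compact and second countable, so a Borel measure on it that is finite on
  compact sets is automatically a Radon measure.\<close>

definition left_haar_measure :: "(real ^ 'n ^ 'n) set \<Rightarrow> (real ^ 'n ^ 'n) measure \<Rightarrow> bool" where
  "left_haar_measure H \<mu> \<longleftrightarrow>
     sets \<mu> = sets (restrict_space borel H) \<and>
     (\<forall>K. compact K \<and> K \<subseteq> H \<longrightarrow> emeasure \<mu> K < \<infinity>) \<and>
     emeasure \<mu> H \<noteq> 0 \<and>
     (\<forall>g\<in>H. \<forall>B\<in>sets \<mu>. emeasure \<mu> ((\<lambda>h. g ** h) ` B) = emeasure \<mu> B)"

definition semidirect_carrier :: "(real ^ 'n ^ 'n) set \<Rightarrow> ((real ^ 'n) \<times> (real ^ 'n ^ 'n)) set" where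
  "semidirect_carrier H = UNIV \<times> H"

definition semidirect_mult ::
  "(real ^ 'n) \<times> (real ^ 'n ^ 'n) \<Rightarrow> (real ^ 'n) \<times> (real ^ 'n ^ 'n) \<Rightarrow> (real ^ 'n) \<times> (real ^ 'n ^ 'n)"
where
  "semidirect_mult = (\<lambda>(x, h) (y, g). (x + h *v y, h ** g))"

definition semidirect_haar ::
  "(real ^ 'n ^ 'n) measure \<Rightarrow> ((real ^ 'n) \<times> (real ^ 'n ^ 'n)) measure" where
  "semidirect_haar \<mu> = density (lborel \<Otimes>\<^sub>M \<mu>) (\<lambda>(x, h). ennreal (1 / \<bar>det h\<bar>))"

definition weight_on :: "'g::topological_space set \<Rightarrow> ('g \<Rightarrow> 'g \<Rightarrow> 'g) \<Rightarrow> ('g \<Rightarrow> real) \<Rightarrow> bool" where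
  "weight_on S m v \<longleftrightarrow>
     continuous_on S v \<and> (\<forall>a\<in>S. 0 < v a) \<and> (\<forall>a\<in>S. \<forall>b\<in>S. v (m a b) \<le> v a * v b)"

section \<open>Quasi-regular representation and wavelet transform\<close>

definition quasi_regular ::
  "(real ^ 'n) \<Rightarrow> (real ^ 'n ^ 'n) \<Rightarrow> ((real ^ 'n) \<Rightarrow> complex) \<Rightarrow> (real ^ 'n) \<Rightarrow> complex" where
  "quasi_regular x h f y =
     complex_of_real (\<bar>det h\<bar> powr (- 1 / 2)) * f (matrix_inv h *v (y - x))"

definition wavelet_transform ::
  "((real ^ 'n) \<Rightarrow> complex) \<Rightarrow> ((real ^ 'n) \<Rightarrow> complex) \<Rightarrow> (real ^ 'n) \<times> (real ^ 'n ^ 'n) \<Rightarrow> complex"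
where
  "wavelet_transform \<psi> f = (\<lambda>(x, h). inner_L2 f (quasi_regular x h \<psi>))"

text \<open>The elements of \<^const>\<open>L2_space\<close> are functions rather than classes of functions. A subset that
  is closed for the seminorm is saturated with respect to equality almost everywhere, so the sets
  below are exactly the closed subspaces of the Hilbert space.\<close>

definition closed_subspace_L2 :: "((real ^ 'n) \<Rightarrow> complex) set \<Rightarrow> bool" where
  "closed_subspace_L2 V \<longleftrightarrow>
     V \<subseteq> L2_space \<and> (\<lambda>x. 0) \<in> V \<and>
     (\<forall>f\<in>V. \<forall>g\<in>V. (\<lambda>x. f x + g x) \<in> V) \<and>
     (\<forall>c. \<forall>f\<in>V. (\<lambda>x. c * f x) \<in> V) \<and>
     (\<forall>f\<in>L2_space.
        (\<forall>\<epsilon>>0. \<exists>g\<in>V. Lp_norm lborel 2 (\<lambda>x. ennreal (norm (f x - g x))) < \<epsilon>) \<longrightarrow> f \<in> V)"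

definition quasi_regular_irreducible :: "(real ^ 'n ^ 'n) set \<Rightarrow> bool" where
  "quasi_regular_irreducible H \<longleftrightarrow>
     (\<forall>V. closed_subspace_L2 V \<and> (\<forall>x. \<forall>h\<in>H. \<forall>f\<in>V. quasi_regular x h f \<in> V) \<longrightarrow>
        V = {f \<in> L2_space. AE x in lborel. f x = 0} \<or> V = L2_space)"

definition quasi_regular_square_integrable :: "(real ^ 'n ^ 'n) measure \<Rightarrow> bool" where
  "quasi_regular_square_integrable \<mu> \<longleftrightarrow>
     (\<exists>\<psi>\<in>L2_space. \<not> (AE x in lborel. \<psi> x = 0) \<and>
        wavelet_transform \<psi> \<psi> \<in> Lp_space (semidirect_haar \<mu>) 2)"

text \<open>Since left Haar measure is unique up to a factor, admissibility does not depend on the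
  choice of \<open>\<mu>\<close>.\<close>

definition admissible_dilation_group ::
  "(real ^ 'n ^ 'n) set \<Rightarrow> (real ^ 'n ^ 'n) measure \<Rightarrow> bool" where
  "admissible_dilation_group H \<mu> \<longleftrightarrow>
     closed_subgroup_GL H \<and> left_haar_measure H \<mu> \<and>
     quasi_regular_irreducible H \<and> quasi_regular_square_integrable \<mu>"

section \<open>The open dual orbit\<close>

definition dual_orbit :: "(real ^ 'n ^ 'n) set \<Rightarrow> real ^ 'n \<Rightarrow> (real ^ 'n) set" where
  "dual_orbit H \<xi>0 = (\<lambda>h. transpose h *v \<xi>0) ` H"

text \<open>For an admissible dilation group there is exactly one open orbit, and it has full measure and
  compact stabilizers. These are consequences of admissibility, so they are not assumed here;
  openness determines the orbit.\<close>

definition open_dual_orbit :: "(real ^ 'n ^ 'n) set \<Rightarrow> (real ^ 'n) set \<Rightarrow> bool" where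
  "open_dual_orbit H Orb \<longleftrightarrow> (\<exists>\<xi>0. Orb = dual_orbit H \<xi>0) \<and> open Orb"

definition aux_A :: "(real ^ 'n) set \<Rightarrow> real ^ 'n \<Rightarrow> real" where
  "aux_A Orb \<xi> =
     min (infdist \<xi> (- Orb) / (1 + sqrt ((norm \<xi>)\<^sup>2 - (infdist \<xi> (- Orb))\<^sup>2)))
         (1 / (1 + norm \<xi>))"

definition temperately_embedded ::
  "(real ^ 'n::finite ^ 'n) set \<Rightarrow> (real ^ 'n ^ 'n) measure \<Rightarrow> (real ^ 'n) set \<Rightarrow>
   real \<Rightarrow> real \<Rightarrow> ((real ^ 'n ^ 'n) \<Rightarrow> real) \<Rightarrow> nat \<Rightarrow> bool" where
  "temperately_embedded H \<mu> Orb s q w l \<longleftrightarrow>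
     (\<exists>\<xi>0\<in>Orb.
        (\<lambda>h. \<bar>det h\<bar> powr (1 / 2 - 1 / q) * (1 + norm h) powr (s + real CARD('n) + 1) * w h *
              aux_A Orb (transpose h *v \<xi>0) ^ l) \<in> Lp_space \<mu> (ennreal q) \<and>
        (\<lambda>h. \<bar>det h\<bar> powr (- 1 / 2 - 1 / q) * (1 + norm h) powr (s + real CARD('n) + 1) * w h *
              aux_A Orb (transpose (matrix_inv h) *v \<xi>0) ^ l) \<in> Lp_space \<mu> 1)"

section \<open>Weighted mixed norm\<close>

definition mixed_norm ::
  "(real ^ 'n ^ 'n) measure \<Rightarrow> ennreal \<Rightarrow> ennreal \<Rightarrow> ((real ^ 'n) \<times> (real ^ 'n ^ 'n) \<Rightarrow> real) \<Rightarrow>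
   ((real ^ 'n) \<times> (real ^ 'n ^ 'n) \<Rightarrow> complex) \<Rightarrow> ennreal" where
  "mixed_norm \<mu> p q v F =
     Lp_norm (density \<mu> (\<lambda>h. ennreal (1 / \<bar>det h\<bar>))) q
       (\<lambda>h. Lp_norm lborel p (\<lambda>x. ennreal (norm (F (x, h)) * v (x, h))))"

section \<open>Fourier transform, derivatives, vanishing moments\<close>

definition fourier :: "((real ^ 'n) \<Rightarrow> complex) \<Rightarrow> (real ^ 'n) \<Rightarrow> complex" where
  "fourier f \<xi> = (LINT x|lborel. f x * exp (- 2 * of_real pi * \<i> * of_real (x \<bullet> \<xi>)))"

definition partial :: "'n \<Rightarrow> ((real ^ 'n) \<Rightarrow> complex) \<Rightarrow> (real ^ 'n) \<Rightarrow> complex" where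
  "partial i f x = vector_derivative (\<lambda>u. f (x + u *\<^sub>R axis i 1)) (at 0)"

definition partials :: "'n list \<Rightarrow> ((real ^ 'n) \<Rightarrow> complex) \<Rightarrow> (real ^ 'n) \<Rightarrow> complex" where
  "partials is f = foldr partial is f"

definition multi_order :: "('n::finite \<Rightarrow> nat) \<Rightarrow> nat" where
  "multi_order \<alpha> = (\<Sum>i\<in>UNIV. \<alpha> i)"

text \<open>The index type carries no order, so some order of differentiation is chosen. It is
  irrelevant here: the operator is applied only to functions with continuous partial
  derivatives up to the order in question.\<close>

definition multi_deriv :: "('n::finite \<Rightarrow> nat) \<Rightarrow> ((real ^ 'n) \<Rightarrow> complex) \<Rightarrow> (real ^ 'n) \<Rightarrow> complex" where
  "multi_deriv \<alpha> f = partials (SOME is. \<forall>i. count_list is i = \<alpha> i) f"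

definition test_function :: "((real ^ 'n) \<Rightarrow> complex) \<Rightarrow> bool" where
  "test_function \<phi> \<longleftrightarrow>
     (\<forall>is. partials is \<phi> differentiable_on UNIV) \<and> compact (closure {x. \<phi> x \<noteq> 0})"

definition distributional_deriv ::
  "('n::finite \<Rightarrow> nat) \<Rightarrow> ((real ^ 'n) \<Rightarrow> complex) \<Rightarrow> ((real ^ 'n) \<Rightarrow> complex) \<Rightarrow> bool" where
  "distributional_deriv \<alpha> u g \<longleftrightarrow>
     (\<forall>\<phi>. test_function \<phi> \<longrightarrow>
        (LINT x|lborel. g x * \<phi> x) =
        (- 1) ^ multi_order \<alpha> * (LINT x|lborel. u x * multi_deriv \<alpha> \<phi> x))"

definition vanishing_moments :: "(real ^ 'n) set \<Rightarrow> nat \<Rightarrow> ((real ^ 'n) \<Rightarrow> complex) \<Rightarrow> bool" where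
  "vanishing_moments Z r f \<longleftrightarrow>
     (\<forall>\<alpha>. multi_order \<alpha> \<le> r \<longrightarrow>
        (\<exists>g. continuous_on UNIV g \<and> distributional_deriv \<alpha> (fourier f) g \<and>
             (multi_order \<alpha> < r \<longrightarrow> (\<forall>\<xi>\<in>Z. g \<xi> = 0))))"

text \<open>The value \<open>\<infinity>\<close> is allowed.\<close>

definition schwartz_norm :: "real \<Rightarrow> real \<Rightarrow> ((real ^ 'n) \<Rightarrow> complex) \<Rightarrow> ennreal" where
  "schwartz_norm r m g =
     (SUP x. SUP \<alpha>\<in>{\<alpha>. real (multi_order \<alpha>) \<le> r}.
        ennreal ((1 + norm x) powr m * norm (multi_deriv \<alpha> g x)))"

end

theory Submission
  imports Defs "HOL-Probability.Characteristic_Functions"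
begin

text \<open>
  The Fourier transform of \<open>W\<^sub>\<psi> f(-, h)\<close> is \<open>|det h| powr (1/2) * u(\<xi>)\<close> with
  \<open>u(\<xi>) = f^(\<xi>) * cnj(\<psi>^(h\<^sup>T \<xi>))\<close> (\<open>fourier_wavelet_transform\<close>). Decay of the wavelet
  transform in \<open>x\<close> therefore comes from integrability of derivatives of \<open>u\<close>, and its
  behaviour in \<open>h\<close> from the size of these integrals.

  Vanishing moments control the derivatives of \<open>f^\<close> and \<open>\<psi>^\<close>. All derivatives of order less
  than \<open>t\<close> vanish on the closed set \<open>O\<^sup>c\<close>, so integrating back from the nearest point of
  \<open>O\<^sup>c\<close>, one order at a time, bounds a derivative of order \<open>k\<close> at \<open>\<xi>\<close> by a constant times
  \<open>min(1, dist(\<xi>, O\<^sup>c)) ^ (t - k) / (1 + |\<xi>|) ^ t\<close> (\<open>partials_decay\<close>). Since \<open>A(\<xi>)\<close> is at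
  least \<open>min(1, dist(\<xi>, O\<^sup>c)) / (1 + |\<xi>|)\<close>, this is at most a constant times \<open>A(\<xi>) ^ l\<close> as
  soon as \<open>k + l < t\<close> (\<open>partials_le_aux_A\<close>). By the product rule, every derivative of \<open>u\<close>
  of order at most \<open>r\<close> along a coordinate axis is bounded by a constant times
  \<open>(1 + |h|) ^ r * A(\<xi>) ^ l * A(h\<^sup>T \<xi>) ^ l\<close>, so its \<open>L\<^sup>1\<close> norm is controlled by
  \<open>(1 + |h|) ^ r * I(h)\<close>, where \<open>I(h)\<close> is the integral of \<open>A(\<xi>) ^ l * A(h\<^sup>T \<xi>) ^ l\<close> over
  \<open>O\<close> (\<open>cross_integral\<close>).

  Fourier inversion and \<open>fourier_integral_decay\<close> turn this into the bound
  \<open>|W\<^sub>\<psi> f(x, h)| \<le> C * |det h| powr (1/2) * (1 + |h|) ^ r * I(h) / (1 + |x|) ^ r\<close> for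
  almost every \<open>x\<close> (\<open>wavelet_transform_pointwise\<close>). The choice \<open>r = \<lfloor>s + d/p\<rfloor> + 1\<close> makes
  \<open>(1 + |x|) powr (s - r)\<close> a function in \<open>L\<^sup>p\<close>, keeps \<open>r + l < t\<close>, and satisfies
  \<open>r \<le> s + d + 1\<close>, the exponent in the definition of a temperately embedded orbit. What is
  left is to show that
  \<open>|det h| powr (1/2 - 1/q) * (1 + |h|) powr (s + d + 1) * w(h) * I(h)\<close> lies in \<open>L\<^sup>q(H)\<close>.

  For this, the integral over the orbit is moved to the group: up to a constant, the
  integral of a nonnegative \<open>F\<close> over \<open>O\<close> is at most the integral of
  \<open>F(k\<^sup>-\<^sup>T \<xi>\<^sub>0) / |det k|\<close> over \<open>k\<close> in \<open>H\<close> (\<open>orbit_integral_le\<close>). Applied to \<open>I(h)\<close> the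
  integrand becomes \<open>A(k\<^sup>-\<^sup>T \<xi>\<^sub>0) ^ l * A((k\<^sup>-\<^sup>1 h)\<^sup>T \<xi>\<^sub>0) ^ l\<close>, and since the weights are
  submultiplicative along \<open>h = k (k\<^sup>-\<^sup>1 h)\<close> the result is dominated by the convolution on
  \<open>H\<close> of the two functions in the definition of a temperately embedded orbit. The first is
  in \<open>L\<^sup>q(H)\<close>, the second in \<open>L\<^sup>1(H)\<close>, and Young's inequality applies
  (\<open>temperate_cross_integral_finite\<close>).

  Two ingredients need separate care. The vanishing moment condition speaks of
  distributional derivatives, the Schwartz norm of pointwise ones;
  \<open>distributional_imp_classical\<close> identifies them by mollification with product bump
  functions. And \<open>orbit_integral_le\<close> is an estimate at the single point \<open>\<xi>\<^sub>0\<close>, while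
  Fubini gives identities almost everywhere on the orbit; an average over translates in
  \<open>H\<close> bridges the gap.
\<close>

section \<open>Matrices and linear changes of variables\<close>

lemma matrix_inv_mult:
  fixes A :: "real ^ 'n ^ 'n"
  assumes "invertible A"
  shows "A ** matrix_inv A = mat 1" "matrix_inv A ** A = mat 1"
proof -
  have "A ** matrix_inv A = mat 1 \<and> matrix_inv A ** A = mat 1"
    unfolding matrix_inv_def by (rule someI_ex) (use assms in \<open>simp add: invertible_def\<close>)
  then show "A ** matrix_inv A = mat 1" "matrix_inv A ** A = mat 1" by auto
qed

lemma matrix_inv_vector_mult:
  fixes A :: "real ^ 'n ^ 'n"
  assumes "invertible A"
  shows "A *v (matrix_inv A *v x) = x" "matrix_inv A *v (A *v x) = x"
  using matrix_inv_mult[OF assms] by (simp_all add: matrix_vector_mul_assoc)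

lemma matrix_inv_unique_right:
  fixes A :: "real ^ 'n ^ 'n"
  assumes "A ** B = mat 1"
  shows "matrix_inv A = B"
proof -
  have "B ** A = mat 1" using assms matrix_left_right_inverse by blast
  then have "invertible A" using assms by (auto simp: invertible_def)
  then have "matrix_inv A ** A = mat 1" by (rule matrix_inv_mult)
  then show ?thesis using assms
    by (metis matrix_mul_assoc matrix_mul_lid matrix_mul_rid)
qed

lemma matrix_inv_prod:
  fixes A B :: "real ^ 'n ^ 'n"
  assumes "invertible A" "invertible B"
  shows "matrix_inv (A ** B) = matrix_inv B ** matrix_inv A"
proof (rule matrix_inv_unique_right)
  have "(A ** B) ** (matrix_inv B ** matrix_inv A) = A ** (B ** matrix_inv B) ** matrix_inv A"
    by (simp add: matrix_mul_assoc)
  then show "(A ** B) ** (matrix_inv B ** matrix_inv A) = mat 1"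
    using assms by (simp add: matrix_inv_mult)
qed

lemma matrix_inv_involutive:
  fixes A :: "real ^ 'n ^ 'n"
  assumes "invertible A"
  shows "matrix_inv (matrix_inv A) = A"
  by (rule matrix_inv_unique_right) (rule matrix_inv_mult(2)[OF assms])

lemma norm_matrix_vector_mult_le:
  fixes A :: "real ^ 'n ^ 'm"
  shows "norm (A *v x) \<le> norm A * norm x"
proof -
  have "norm (A *v x) = L2_set (\<lambda>i. \<bar>A $ i \<bullet> x\<bar>) UNIV"
    by (simp add: norm_vec_def matrix_vector_mul_component)
  also have "\<dots> \<le> L2_set (\<lambda>i. norm (A $ i) * norm x) UNIV"
    by (rule L2_set_mono) (auto simp: Cauchy_Schwarz_ineq2)
  also have "\<dots> = norm A * norm x"
    by (simp add: norm_vec_def[of A] L2_set_left_distrib)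
  finally show ?thesis .
qed

lemma norm_transpose:
  fixes A :: "real ^ 'n ^ 'm"
  shows "norm (transpose A) = norm A"
proof -
  have "(norm B)\<^sup>2 = (\<Sum>i\<in>UNIV. \<Sum>j\<in>UNIV. (B $ i $ j)\<^sup>2)" for B :: "real ^ 'a ^ 'b"
    by (simp add: norm_vec_def L2_set_def sum_nonneg)
  from this[of A] this[of "transpose A"] have "(norm (transpose A))\<^sup>2 = (norm A)\<^sup>2"
    by (simp add: transpose_def) (rule sum.swap)
  then show ?thesis by simp
qed

lemma norm_matrix_mult_le:
  fixes A B :: "real ^ 'n ^ 'n"
  shows "norm (A ** B) \<le> norm A * norm B"
proof -
  have row: "(A ** B) $ i = transpose B *v (A $ i)" for i
    by (simp add: vec_eq_iff matrix_matrix_mult_def matrix_vector_mult_def transpose_def mult.commute)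
  have "norm (A ** B) = L2_set (\<lambda>i. norm (transpose B *v (A $ i))) UNIV"
    by (simp add: norm_vec_def[of "A ** B"] row)
  also have "\<dots> \<le> L2_set (\<lambda>i. norm B * norm (A $ i)) UNIV"
    by (rule L2_set_mono) (use norm_matrix_vector_mult_le[of "transpose B"] in \<open>auto simp: norm_transpose\<close>)
  also have "\<dots> = norm A * norm B"
    by (simp add: norm_vec_def[of A] L2_set_right_distrib mult.commute)
  finally show ?thesis .
qed

lemma continuous_on_det:
  fixes f :: "'a::topological_space \<Rightarrow> real ^ 'n ^ 'n"
  assumes "continuous_on S f"
  shows "continuous_on S (\<lambda>x. det (f x))"
  unfolding det_def by (intro continuous_intros continuous_on_component assms)

lemma continuous_on_matrix_mult:
  fixes f g :: "'a::topological_space \<Rightarrow> real ^ 'n ^ 'n"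
  assumes "continuous_on S f" "continuous_on S g"
  shows "continuous_on S (\<lambda>x. f x ** g x)"
  unfolding matrix_matrix_mult_def by (intro continuous_intros continuous_on_component assms)

lemma continuous_on_matrix_vector_mult:
  fixes f :: "'a::topological_space \<Rightarrow> real ^ 'n ^ 'm"
  assumes "continuous_on S f" "continuous_on S g"
  shows "continuous_on S (\<lambda>x. f x *v g x)"
  unfolding matrix_vector_mult_def by (intro continuous_intros continuous_on_component assms)

lemma continuous_on_transpose:
  fixes f :: "'a::topological_space \<Rightarrow> real ^ 'n ^ 'm"
  assumes "continuous_on S f"
  shows "continuous_on S (\<lambda>x. transpose (f x))"
  unfolding transpose_def by (intro continuous_intros continuous_on_component assms)

text \<open>By Cramer's rule the entries of the inverse are quotients of determinants.\<close>

lemma continuous_on_matrix_inv: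
  fixes f :: "'a::topological_space \<Rightarrow> real ^ 'n ^ 'n"
  assumes f: "continuous_on S f" and inv: "\<And>x. x \<in> S \<Longrightarrow> invertible (f x)"
  shows "continuous_on S (\<lambda>x. matrix_inv (f x))"
proof -
  have entry: "matrix_inv A =
      (\<chi> k l. det (\<chi> i j. if j = k then axis l 1 $ i else A $ i $ j) / det A)"
    if "invertible A" for A :: "real ^ 'n ^ 'n"
  proof -
    have d: "det A \<noteq> 0" using that by (simp add: invertible_det_nz)
    have "(matrix_inv A *v axis l 1) = (\<chi> k. det (\<chi> i j. if j = k then axis l 1 $ i else A $ i $ j) / det A)" for l
      using cramer[OF d, of "matrix_inv A *v axis l 1" "axis l 1"] matrix_inv_vector_mult[OF that]
      by simp
    then have "matrix_inv A $ k $ l = det (\<chi> i j. if j = k then axis l 1 $ i else A $ i $ j) / det A" for k l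
      by (metis (no_types, lifting) column_def vec_lambda_beta matrix_vector_mult_basis)
    then show ?thesis by (simp add: vec_eq_iff)
  qed
  have "continuous_on S (\<lambda>x. (\<chi> k l. det (\<chi> i j. if j = k then axis l 1 $ i else f x $ i $ j) / det (f x)) :: real ^ 'n ^ 'n)"
  proof (intro continuous_intros continuous_on_det f ballI)
    show "continuous_on S (\<lambda>x. if j = k then axis l 1 $ i else f x $ i $ j)" for i j k l
      by (cases "j = k") (auto intro!: continuous_intros continuous_on_component f)
    show "det (f x) \<noteq> 0" if "x \<in> S" for x
      using inv[OF that] by (simp add: invertible_det_nz)
  qed
  then show ?thesis
    by (rule continuous_on_eq) (simp add: entry inv)
qed

lemma prod_Basis_vec:
  fixes g :: "real ^ 'n \<Rightarrow> 'b::comm_monoid_mult"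
  shows "(\<Prod>b\<in>Basis. g b) = (\<Prod>i\<in>UNIV. g (axis i 1))"
proof -
  have "bij_betw (\<lambda>i::'n. axis i (1::real)) UNIV Basis"
    by (auto simp: bij_betw_def inj_on_def axis_eq_axis Basis_vec_def)
  then show ?thesis by (metis (no_types) prod.reindex_bij_betw)
qed

lemma nn_integral_lborel_diagonal:
  fixes A :: "real ^ 'n ^ 'n"
  assumes diag: "\<And>i j. i \<noteq> j \<Longrightarrow> A $ i $ j = 0" and det: "det A \<noteq> 0"
    and [measurable]: "G \<in> borel_measurable borel"
  shows "(\<integral>\<^sup>+x. G x \<partial>lborel) = ennreal \<bar>det A\<bar> * (\<integral>\<^sup>+x. G (A *v x) \<partial>lborel)"
proof -
  let ?c = "\<lambda>b :: real ^ 'n. A $ axis_index b $ axis_index b"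
  have d: "det A = (\<Prod>i\<in>UNIV. A $ i $ i)" using diag by (rule det_diagonal)
  then have nz: "?c b \<noteq> 0" if "b \<in> Basis" for b using det by auto
  have prod: "(\<Prod>b\<in>Basis. \<bar>?c b\<bar>) = \<bar>det A\<bar>"
    by (simp add: prod_Basis_vec d abs_prod)
  have lin: "(\<Sum>j\<in>Basis. (?c j * (x \<bullet> j)) *\<^sub>R j) = A *v x" for x :: "real ^ 'n"
  proof (rule vec_eq_iff[THEN iffD2], rule allI)
    fix i
    have "(A *v x) $ i = (\<Sum>j\<in>UNIV. A $ i $ j * x $ j)"
      by (simp add: matrix_vector_mult_def)
    also have "\<dots> = (\<Sum>j\<in>UNIV. if j = i then A $ i $ i * x $ i else 0)"
      by (rule sum.cong) (use diag[of i] in auto)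
    also have "\<dots> = A $ i $ i * x $ i" by simp
    finally have "(A *v x) $ i = A $ i $ i * x $ i" .
    moreover have "(\<Sum>j\<in>Basis. (?c j * (x \<bullet> j)) *\<^sub>R j) $ i = A $ i $ i * x $ i"
      using inner_sum_left_Basis[of "axis i 1" "\<lambda>j. ?c j * (x \<bullet> j)"] by (simp add: inner_axis)
    ultimately show "(\<Sum>j\<in>Basis. (?c j * (x \<bullet> j)) *\<^sub>R j) $ i = (A *v x) $ i" by simp
  qed
  have m[measurable]: "(*v) A \<in> borel_measurable borel"
    by (intro borel_measurable_continuous_onI continuous_on_matrix_vector_mult continuous_intros)
  have eq: "lborel = density (distr lborel borel ((*v) A)) (\<lambda>_. ennreal \<bar>det A\<bar>)"
    using lborel_affine_euclidean[of ?c 0] nz by (simp add: lin prod)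
  have "(\<integral>\<^sup>+x. G x \<partial>density (distr lborel borel ((*v) A)) (\<lambda>_. ennreal \<bar>det A\<bar>)) = ennreal \<bar>det A\<bar> * (\<integral>\<^sup>+x. G (A *v x) \<partial>lborel)"
    by (simp add: nn_integral_density nn_integral_distr nn_integral_cmult)
  then show ?thesis by (simp only: eq[symmetric])
qed

lemma nn_integral_lborel_permute:
  fixes \<sigma> :: "'n::finite \<Rightarrow> 'n" and G :: "real ^ 'n \<Rightarrow> ennreal"
  assumes p: "bij \<sigma>" and [measurable]: "G \<in> borel_measurable borel"
  shows "(\<integral>\<^sup>+x. G x \<partial>lborel) = (\<integral>\<^sup>+x. G (\<chi> i. x $ \<sigma> i) \<partial>lborel)"
proof -
  have m[measurable]: "(\<lambda>x :: real ^ 'n. \<chi> i. x $ \<sigma> i) \<in> borel_measurable borel"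
    by (intro borel_measurable_continuous_onI continuous_intros continuous_on_component)
  have eq: "lborel = distr lborel borel (\<lambda>x :: real ^ 'n. \<chi> i. x $ \<sigma> i)"
  proof (rule lborel_eqI)
    fix l u :: "real ^ 'n"
    assume le: "\<And>b. b \<in> Basis \<Longrightarrow> l \<bullet> b \<le> u \<bullet> b"
    let ?s = "\<lambda>x :: real ^ 'n. \<chi> i. x $ (inv \<sigma>) i"
    have si: "\<sigma> (inv \<sigma> i) = i" "inv \<sigma> (\<sigma> i) = i" for i
      using p by (simp_all add: bij_is_surj surj_f_inv_f bij_is_inj)
    have im: "(\<lambda>x :: real ^ 'n. \<chi> i. x $ \<sigma> i) -` box l u = box (?s l) (?s u)"
      by (auto simp: mem_box_cart) (metis si)+
    have le': "l $ i \<le> u $ i" for i using le[of "axis i 1"] by (simp add: inner_axis)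
    have "(\<Prod>b\<in>Basis. (?s u - ?s l) \<bullet> b) = (\<Prod>i\<in>UNIV. u $ (inv \<sigma> i) - l $ (inv \<sigma> i))"
      by (simp add: prod_Basis_vec inner_axis)
    also have "\<dots> = (\<Prod>i\<in>UNIV. u $ i - l $ i)"
      by (rule prod.reindex_bij_betw[where h="inv \<sigma>" and g="\<lambda>i. u $ i - l $ i"]) (use p bij_imp_bij_inv in auto)
    also have "\<dots> = (\<Prod>b\<in>Basis. (u - l) \<bullet> b)"
      by (simp add: prod_Basis_vec inner_axis)
    finally have pr: "(\<Prod>b\<in>Basis. (?s u - ?s l) \<bullet> b) = (\<Prod>b\<in>Basis. (u - l) \<bullet> b)" .
    have "emeasure lborel (box (?s l) (?s u)) = ennreal (\<Prod>b\<in>Basis. (?s u - ?s l) \<bullet> b)"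
      by (rule emeasure_lborel_box) (use le' in \<open>auto simp: Basis_vec_def inner_axis\<close>)
    then show "emeasure (distr lborel borel (\<lambda>x :: real ^ 'n. \<chi> i. x $ \<sigma> i)) (box l u) = ennreal (\<Prod>b\<in>Basis. (u - l) \<bullet> b)"
      by (simp add: emeasure_distr im pr)
  qed simp
  have "(\<integral>\<^sup>+x. G x \<partial>distr lborel borel (\<lambda>x. \<chi> i. x $ \<sigma> i)) = (\<integral>\<^sup>+x. G (\<chi> i. x $ \<sigma> i) \<partial>lborel)"
    by (rule nn_integral_distr) measurable
  then show ?thesis by (subst (1) eq)
qed

text \<open>Fubini in the coordinate \<open>m\<close>: for fixed values of the other coordinates, in particular
  of coordinate \<open>n\<close>, the shear is a translation.\<close>

lemma nn_integral_lborel_shear: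
  fixes m n :: "'n::finite"
  assumes mn: "m \<noteq> n" and [measurable]: "G \<in> borel_measurable borel"
  shows "(\<integral>\<^sup>+x. G (x + (c * x $ n) *\<^sub>R axis m 1) \<partial>lborel) = (\<integral>\<^sup>+x. G x \<partial>(lborel :: (real ^ 'n) measure))"
proof -
  interpret product_sigma_finite "\<lambda>b :: real ^ 'n. lborel :: real measure" ..
  let ?m = "axis m 1 :: real ^ 'n" and ?n = "axis n 1 :: real ^ 'n"
  let ?B = "Basis - {?m} :: (real ^ 'n) set"
  let ?v = "\<lambda>z :: real ^ 'n \<Rightarrow> real. \<Sum>b\<in>Basis. z b *\<^sub>R b"
  have B: "Basis = insert ?m ?B" by (auto simp: Basis_vec_def)
  have fin: "finite ?B" "?m \<notin> ?B" by auto
  have nth: "?v z $ i = z (axis i 1)" for z :: "real ^ 'n \<Rightarrow> real" and i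
    using inner_sum_left_Basis[of "axis i 1" z] by (simp add: inner_axis)
  have upd: "?v (z(?m := y)) = ?v z + (y - z ?m) *\<^sub>R ?m" for z :: "real ^ 'n \<Rightarrow> real" and y
  proof (rule vec_eq_iff[THEN iffD2], rule allI)
    fix i
    have ax: "axis m (1::real) $ i = (if i = m then 1 else 0)" by (simp add: axis_def)
    show "?v (z(?m := y)) $ i = (?v z + (y - z ?m) *\<^sub>R ?m) $ i"
      unfolding vector_add_component vector_scaleR_component nth ax
      by (simp add: axis_eq_axis)
  qed
  have split: "(\<integral>\<^sup>+x. F x \<partial>lborel) = (\<integral>\<^sup>+z. \<integral>\<^sup>+y. F (?v (z(?m := y))) \<partial>lborel \<partial>(\<Pi>\<^sub>M b\<in>?B. lborel))"
    if [measurable]: "F \<in> borel_measurable borel" for F :: "real ^ 'n \<Rightarrow> ennreal"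
  proof -
    have "(\<integral>\<^sup>+x. F x \<partial>lborel) = (\<integral>\<^sup>+z. F (?v z) \<partial>(\<Pi>\<^sub>M b\<in>Basis. lborel))"
      by (subst lborel_eq, subst nn_integral_distr) simp_all
    also have "\<dots> = (\<integral>\<^sup>+z. F (?v z) \<partial>(\<Pi>\<^sub>M b\<in>insert ?m ?B. lborel))" using B by simp
    also have "\<dots> = (\<integral>\<^sup>+z. \<integral>\<^sup>+y. F (?v (z(?m := y))) \<partial>lborel \<partial>(\<Pi>\<^sub>M b\<in>?B. lborel))"
    proof (rule product_nn_integral_insert[OF fin])
      have "(\<lambda>z. F (?v z)) \<in> borel_measurable (\<Pi>\<^sub>M b\<in>Basis. lborel)" by measurable
      then show "(\<lambda>z. F (?v z)) \<in> borel_measurable (\<Pi>\<^sub>M b\<in>insert ?m ?B. lborel)" using B by simp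
    qed
    finally show ?thesis .
  qed
  have [measurable]: "(\<lambda>x :: real ^ 'n. G (x + (c * x $ n) *\<^sub>R ?m)) \<in> borel_measurable borel" by measurable
  have "(\<integral>\<^sup>+y. G (?v (z(?m := y)) + (c * ?v (z(?m := y)) $ n) *\<^sub>R ?m) \<partial>lborel) = (\<integral>\<^sup>+y. G (?v (z(?m := y))) \<partial>lborel)"
    for z :: "real ^ 'n \<Rightarrow> real"
  proof -
    have [measurable]: "(\<lambda>y. G (?v (z(?m := y)))) \<in> borel_measurable borel"
      unfolding upd by measurable
    have ne: "?n \<noteq> ?m" using mn by (simp add: axis_eq_axis)
    have arith: "a + (y - w) *\<^sub>R e + k *\<^sub>R e = a + (k + 1 * y - w) *\<^sub>R e" for a e :: "real ^ 'n" and y w k :: real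
      by (simp add: algebra_simps)
    have "?v (z(?m := y)) + (c * ?v (z(?m := y)) $ n) *\<^sub>R ?m = ?v (z(?m := c * z ?n + 1 * y))" for y
      unfolding nth fun_upd_other[OF ne] unfolding upd by (rule arith)
    then have "(\<integral>\<^sup>+y. G (?v (z(?m := y)) + (c * ?v (z(?m := y)) $ n) *\<^sub>R ?m) \<partial>lborel) = (\<integral>\<^sup>+y. G (?v (z(?m := c * z ?n + 1 * y))) \<partial>lborel)"
      by (simp only:)
    also have "\<dots> = (\<integral>\<^sup>+y. G (?v (z(?m := y))) \<partial>lborel)"
      using nn_integral_real_affine[of "\<lambda>y. G (?v (z(?m := y)))" 1 "c * z ?n"] by simp
    finally show ?thesis .
  qed
  then show ?thesis by (simp add: split)
qed

text \<open>An invertible matrix is a product of elementary ones, and the formula is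
  multiplicative in the matrix; this reduces it to diagonal matrices, transpositions of two
  coordinates, and shears.\<close>

theorem nn_integral_lborel_linear:
  fixes A :: "real ^ 'n ^ 'n"
  assumes A: "invertible A" and G: "G \<in> borel_measurable borel"
  shows "(\<integral>\<^sup>+x. G x \<partial>lborel) = ennreal \<bar>det A\<bar> * (\<integral>\<^sup>+x. G (A *v x) \<partial>lborel)"
proof -
  have meas: "(\<lambda>x. G (B *v x)) \<in> borel_measurable borel" if "G \<in> borel_measurable borel" for B and G :: "real ^ 'n \<Rightarrow> ennreal"
    using that by (rule measurable_compose[rotated]) (intro borel_measurable_continuous_onI continuous_on_matrix_vector_mult continuous_intros)
  define P where "P A \<longleftrightarrow> (\<forall>G\<in>borel_measurable borel. (\<integral>\<^sup>+x. G x \<partial>lborel) = ennreal \<bar>det A\<bar> * (\<integral>\<^sup>+x. G (A *v x) \<partial>lborel))"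
    for A :: "real ^ 'n ^ 'n"
  have "det A \<noteq> 0 \<longrightarrow> P A"
  proof (induction A rule: induct_matrix_elementary)
    fix B C :: "real ^ 'n ^ 'n"
    assume B: "det B \<noteq> 0 \<longrightarrow> P B"
      and C: "det C \<noteq> 0 \<longrightarrow> P C"
    show "det (B ** C) \<noteq> 0 \<longrightarrow> P (B ** C)"
      unfolding P_def
    proof (intro impI ballI)
      fix G :: "real ^ 'n \<Rightarrow> ennreal" assume d: "det (B ** C) \<noteq> 0" and G: "G \<in> borel_measurable borel"
      then have "(\<integral>\<^sup>+x. G x \<partial>lborel) = ennreal \<bar>det B\<bar> * (\<integral>\<^sup>+x. G (B *v x) \<partial>lborel)"
        using B by (simp add: P_def det_mul)
      also have "(\<integral>\<^sup>+x. G (B *v x) \<partial>lborel) = ennreal \<bar>det C\<bar> * (\<integral>\<^sup>+x. G (B *v (C *v x)) \<partial>lborel)"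
        using C d meas[OF G, of B] by (simp add: P_def det_mul)
      finally show "(\<integral>\<^sup>+x. G x \<partial>lborel) = ennreal \<bar>det (B ** C)\<bar> * (\<integral>\<^sup>+x. G ((B ** C) *v x) \<partial>lborel)"
        by (simp add: det_mul abs_mult ennreal_mult matrix_vector_mul_assoc mult.assoc)
    qed
  next
    fix B :: "real ^ 'n ^ 'n" and i
    assume "row i B = 0"
    then show "det B \<noteq> 0 \<longrightarrow> P B"
      using det_zero_row by blast
  next
    fix B :: "real ^ 'n ^ 'n"
    assume "\<And>i j. i \<noteq> j \<Longrightarrow> B $ i $ j = 0"
    then show "det B \<noteq> 0 \<longrightarrow> P B"
      unfolding P_def using nn_integral_lborel_diagonal by blast
  next
    fix m n :: 'n assume mn: "m \<noteq> n"
    let ?S = "(\<chi> i j. mat 1 $ i $ Transposition.transpose m n j) :: real ^ 'n ^ 'n"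
    have "\<bar>det ?S\<bar> = 1"
      by (simp add: det_permute_columns permutes_swap_id sign_swap_id abs_mult mn)
    moreover have "?S *v x = (\<chi> i. x $ Transposition.transpose m n i)" for x :: "real ^ 'n"
    proof -
      have swap: "(i = Transposition.transpose m n j) = (j = Transposition.transpose m n i)" for i j :: 'n
        by (metis transpose_involutory)
      have "(?S *v x) $ i = (\<Sum>j\<in>UNIV. if j = Transposition.transpose m n i then x $ j else 0)" for i
        unfolding matrix_vector_mult_def mat_def vec_lambda_beta
        by (rule sum.cong) (auto simp: swap[of i])
      then show ?thesis by (simp add: vec_eq_iff)
    qed
    ultimately show "det ?S \<noteq> 0 \<longrightarrow> P ?S"
      unfolding P_def using nn_integral_lborel_permute[of "Transposition.transpose m n"] by auto
  next
    fix m n :: 'n and c :: real assume mn: "m \<noteq> n"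
    let ?S = "(\<chi> i j. if i = m \<and> j = n then c else of_bool (i = j)) :: real ^ 'n ^ 'n"
    have "?S = (\<chi> k. if k = m then row m (mat 1) + c *s row n (mat 1) else row k (mat 1))"
      using mn by (auto simp: vec_eq_iff row_def mat_def)
    then have "det ?S = 1"
      using det_row_operation[OF mn, of "mat 1" c] by simp
    moreover have "?S *v x = x + (c * x $ n) *\<^sub>R axis m 1" for x :: "real ^ 'n"
    proof (rule vec_eq_iff[THEN iffD2], rule allI)
      fix i
      have "(?S *v x) $ i = (\<Sum>j\<in>UNIV. (if j = i then x $ i else 0) + (if j = n then if i = m then c * x $ n else 0 else 0))"
        unfolding matrix_vector_mult_def using mn by (auto intro!: sum.cong)
      then show "(?S *v x) $ i = (x + (c * x $ n) *\<^sub>R axis m 1) $ i"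
        by (simp add: sum.distrib axis_def)
    qed
    ultimately show "det ?S \<noteq> 0 \<longrightarrow> P ?S"
      unfolding P_def using nn_integral_lborel_shear[OF mn] by simp
  qed
  then show ?thesis using A G by (simp add: P_def invertible_det_nz)
qed

lemma lborel_eq_density_linear:
  fixes A :: "real ^ 'n ^ 'n"
  assumes "invertible A"
  shows "lborel = density (distr lborel borel ((*v) A)) (\<lambda>_. ennreal \<bar>det A\<bar>)"
proof (rule measure_eqI)
  have m[measurable]: "(*v) A \<in> borel_measurable borel"
    by (intro borel_measurable_continuous_onI continuous_on_matrix_vector_mult continuous_intros)
  fix X :: "(real ^ 'n) set" assume "X \<in> sets lborel"
  then have [measurable]: "X \<in> sets borel" by simp
  have "emeasure (density (distr lborel borel ((*v) A)) (\<lambda>_. ennreal \<bar>det A\<bar>)) X = ennreal \<bar>det A\<bar> * (\<integral>\<^sup>+x. indicator X (A *v x) \<partial>lborel)"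
    by (simp add: emeasure_density nn_integral_cmult nn_integral_distr del: nn_integral_indicator)
  also have "\<dots> = (\<integral>\<^sup>+x. indicator X x \<partial>lborel)"
    by (rule nn_integral_lborel_linear[OF assms, symmetric]) simp
  finally show "emeasure lborel X = emeasure (density (distr lborel borel ((*v) A)) (\<lambda>_. ennreal \<bar>det A\<bar>)) X"
    by simp
qed simp

lemma lebesgue_integral_lborel_linear:
  fixes A :: "real ^ 'n ^ 'n" and G :: "real ^ 'n \<Rightarrow> complex"
  assumes A: "invertible A" and [measurable]: "G \<in> borel_measurable borel"
  shows "(LINT x|lborel. G x) = \<bar>det A\<bar> * (LINT x|lborel. G (A *v x))"
proof -
  have [measurable]: "(*v) A \<in> borel_measurable borel"
    by (intro borel_measurable_continuous_onI continuous_on_matrix_vector_mult continuous_intros)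
  show ?thesis
    by (subst lborel_eq_density_linear[OF A])
       (simp add: integral_density integral_distr scaleR_conv_of_real)
qed

section \<open>Product integrals and polynomial weights\<close>

lemma nn_integral_lborel_vec_prod:
  fixes f :: "'n::finite \<Rightarrow> real \<Rightarrow> ennreal"
  assumes "\<And>i. f i \<in> borel_measurable borel"
  shows "(\<integral>\<^sup>+x. (\<Prod>i\<in>UNIV. f i (x $ i)) \<partial>(lborel :: (real ^ 'n) measure)) = (\<Prod>i\<in>UNIV. \<integral>\<^sup>+y. f i y \<partial>lborel)"
proof -
  define g where "g b = f (axis_index b)" for b :: "real ^ 'n"
  have "(\<integral>\<^sup>+x. (\<Prod>b\<in>Basis. g b (x \<bullet> b)) \<partial>(lborel :: (real ^ 'n) measure)) = (\<Prod>b\<in>Basis. (\<integral>\<^sup>+y. g b y \<partial>lborel))"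
    by (rule nn_integral_lborel_prod) (auto simp: g_def assms)
  then show ?thesis by (simp add: prod_Basis_vec g_def inner_axis)
qed

lemma lebesgue_integral_lborel_vec_prod:
  fixes f :: "'n::finite \<Rightarrow> real \<Rightarrow> complex"
  assumes int: "\<And>i. integrable lborel (f i)"
  shows "(LINT x|(lborel :: (real ^ 'n) measure). (\<Prod>i\<in>UNIV. f i (x $ i))) = (\<Prod>i\<in>UNIV. LINT y|lborel. f i y)"
    and "integrable (lborel :: (real ^ 'n) measure) (\<lambda>x. \<Prod>i\<in>UNIV. f i (x $ i))"
proof -
  interpret product_sigma_finite "\<lambda>b :: real ^ 'n. lborel :: real measure" ..
  have fm[measurable]: "f i \<in> borel_measurable borel" for i using int[of i] by (simp add: integrable_iff_bounded)
  have nth: "(\<Sum>b\<in>Basis. z b *\<^sub>R b) $ i = z (axis i 1)" for z :: "real ^ 'n \<Rightarrow> real" and i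
    using inner_sum_left_Basis[of "axis i 1" z] by (simp add: inner_axis)
  have pm: "(\<lambda>x :: real ^ 'n. \<Prod>i\<in>UNIV. f i (x $ i)) \<in> borel_measurable borel" by measurable
  define g where "g b = f (axis_index b)" for b :: "real ^ 'n"
  have gi: "integrable lborel (g b)" for b by (simp add: g_def int)
  have eq: "(\<Prod>i\<in>UNIV. f i ((\<Sum>b\<in>Basis. z b *\<^sub>R b) $ i)) = (\<Prod>b\<in>Basis. g b (z b))" for z :: "real ^ 'n \<Rightarrow> real"
    by (simp only: nth prod_Basis_vec) (simp add: g_def)
  have "(LINT x|(lborel :: (real ^ 'n) measure). (\<Prod>i\<in>UNIV. f i (x $ i)))
      = (LINT z|(\<Pi>\<^sub>M b\<in>Basis. lborel). (\<Prod>b\<in>Basis. g b (z b)))"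
    by (subst lborel_eq, subst integral_distr) (use pm in \<open>simp_all only: eq, simp_all\<close>)
  also have "\<dots> = (\<Prod>b\<in>Basis. LINT y|lborel. g b y)"
    by (rule product_integral_prod) (auto simp: gi)
  finally show "(LINT x|(lborel :: (real ^ 'n) measure). (\<Prod>i\<in>UNIV. f i (x $ i))) = (\<Prod>i\<in>UNIV. LINT y|lborel. f i y)"
    by (simp add: prod_Basis_vec g_def)
  have "integrable (\<Pi>\<^sub>M b\<in>(Basis :: (real ^ 'n) set). lborel) (\<lambda>z. (\<Prod>b\<in>Basis. g b (z b)))"
    by (rule product_integrable_prod) (auto simp: gi)
  then show "integrable (lborel :: (real ^ 'n) measure) (\<lambda>x. \<Prod>i\<in>UNIV. f i (x $ i))"
    by (subst lborel_eq, subst integrable_distr_eq) (use pm in \<open>simp_all only: eq, simp_all\<close>)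
qed

lemma nn_integral_weight_line_finite:
  fixes c :: real
  assumes "1 < c"
  shows "(\<integral>\<^sup>+y. ennreal ((1 + \<bar>y\<bar>) powr (- c)) \<partial>lborel) < \<infinity>"
proof -
  let ?f = "\<lambda>y::real. (1 + y) powr (- c)"
  have half: "(\<integral>\<^sup>+y. ennreal (?f y) * indicator {0..} y \<partial>lborel) = ennreal (0 - (1 + 0) powr (1 - c) / (1 - c))"
  proof (rule nn_integral_FTC_atLeast)
    show "((\<lambda>y. (1 + y) powr (1 - c) / (1 - c)) has_real_derivative ?f x) (at x)" if "0 \<le> x" for x
    proof -
      have "((\<lambda>y. (1 + y) powr (1 - c) / (1 - c)) has_real_derivative (1 - c) * (1 + x) powr (1 - c - 1) * (0 + 1) / (1 - c)) (at x)"
        using that assms by (intro derivative_eq_intros refl) auto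
      then show ?thesis using assms by simp
    qed
    show "((\<lambda>y. (1 + y) powr (1 - c) / (1 - c)) \<longlongrightarrow> 0) at_top"
    proof -
      have "((\<lambda>y::real. (1 + y) powr (1 - c)) \<longlongrightarrow> 0) at_top"
        using assms
        by (intro tendsto_neg_powr filterlim_tendsto_add_at_top[OF tendsto_const] filterlim_ident) auto
      then show ?thesis by (rule tendsto_divide_zero)
    qed
  qed auto
  have "(\<integral>\<^sup>+y. ennreal ((1 + \<bar>y\<bar>) powr (- c)) \<partial>lborel)
      \<le> (\<integral>\<^sup>+y. ennreal (?f y) * indicator {0..} y + ennreal (?f (- y)) * indicator {0..} (- y) \<partial>lborel)"
    by (intro nn_integral_mono) (auto simp: indicator_def)
  also have "\<dots> = (\<integral>\<^sup>+y. ennreal (?f y) * indicator {0..} y \<partial>lborel) + (\<integral>\<^sup>+y. ennreal (?f (- y)) * indicator {0..} (- y) \<partial>lborel)"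
    by (rule nn_integral_add) auto
  also have "(\<integral>\<^sup>+y. ennreal (?f (- y)) * indicator {0..} (- y) \<partial>lborel) = (\<integral>\<^sup>+y. ennreal (?f y) * indicator {0..} y \<partial>lborel)"
    by (subst (2) lborel_distr_uminus[symmetric], subst nn_integral_distr) auto
  finally show ?thesis unfolding half by (rule le_less_trans) (simp add: less_top[symmetric])
qed

text \<open>Since \<open>1 + |x|\<close> dominates each \<open>1 + |x\<^sub>i|\<close>, the weight is at most the product of the
  one-dimensional weights with exponent \<open>c / d > 1\<close>.\<close>

lemma nn_integral_weight_finite:
  fixes c :: real
  assumes "real CARD('n::finite) < c"
  shows "(\<integral>\<^sup>+x. ennreal ((1 + norm x) powr (- c)) \<partial>(lborel :: (real ^ 'n) measure)) < \<infinity>"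
proof -
  let ?d = "real CARD('n)"
  have d: "?d > 0" by simp
  have pt: "(1 + norm x) powr (- c) \<le> (\<Prod>i\<in>UNIV. (1 + \<bar>x $ i\<bar>) powr (- (c / ?d)))" for x :: "real ^ 'n"
  proof -
    have "(1 + norm x) powr (- c) = (\<Prod>i\<in>(UNIV::'n set). (1 + norm x) powr (- (c / ?d)))"
    proof -
      have "1 + norm x > 0" by (simp add: add_pos_nonneg)
      then show ?thesis by (simp add: powr_realpow[symmetric] powr_powr)
    qed
    also have "\<dots> \<le> (\<Prod>i\<in>UNIV. (1 + \<bar>x $ i\<bar>) powr (- (c / ?d)))"
      using assms d component_le_norm_cart[of x]
      by (intro prod_mono) (auto intro!: powr_mono2')
    finally show ?thesis .
  qed
  have "(\<integral>\<^sup>+x. ennreal ((1 + norm x) powr (- c)) \<partial>(lborel :: (real ^ 'n) measure))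
      \<le> (\<integral>\<^sup>+x. (\<Prod>i\<in>UNIV. ennreal ((1 + \<bar>x $ i\<bar>) powr (- (c / ?d)))) \<partial>(lborel :: (real ^ 'n) measure))"
    using pt by (intro nn_integral_mono) (simp add: prod_ennreal prod_nonneg)
  also have "\<dots> = (\<Prod>i\<in>(UNIV::'n set). \<integral>\<^sup>+y. ennreal ((1 + \<bar>y\<bar>) powr (- (c / ?d))) \<partial>lborel)"
    by (rule nn_integral_lborel_vec_prod) measurable
  also have "\<dots> < \<infinity>"
    using nn_integral_weight_line_finite[of "c / ?d"] assms d
    by (simp add: less_top[symmetric] power_eq_top_ennreal)
  finally show ?thesis .
qed

text \<open>The dual action is written with transposes throughout; the simplifier would turn
  \<open>transpose A *v x\<close> into a product of a row vector with a matrix.\<close>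

declare transpose_matrix_vector [simp del]

section \<open>Haar integration and the orbit map\<close>

locale haar_matrix_group =
  fixes H :: "(real ^ 'n::finite ^ 'n) set" and \<mu> :: "(real ^ 'n ^ 'n) measure"
  assumes closed_subgroup: "closed_subgroup_GL H" and haar: "left_haar_measure H \<mu>"
begin

lemma invertible_H: "h \<in> H \<Longrightarrow> invertible h"
  and mult_H: "g \<in> H \<Longrightarrow> h \<in> H \<Longrightarrow> g ** h \<in> H"
  and inv_H: "h \<in> H \<Longrightarrow> matrix_inv h \<in> H"
  using closed_subgroup unfolding closed_subgroup_GL_def by auto

lemma haar_compact: "compact K \<Longrightarrow> K \<subseteq> H \<Longrightarrow> emeasure \<mu> K < \<infinity>"
  and haar_translate: "g \<in> H \<Longrightarrow> B \<in> sets \<mu> \<Longrightarrow> emeasure \<mu> ((\<lambda>h. g ** h) ` B) = emeasure \<mu> B"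
  and emeasure_H_pos: "emeasure \<mu> H \<noteq> 0"
  using haar unfolding left_haar_measure_def by simp_all

lemma sets_mu: "sets \<mu> = sets (restrict_space borel H)"
  using haar unfolding left_haar_measure_def by simp

lemma space_mu[simp]: "space \<mu> = H"
  using sets_eq_imp_space_eq[OF sets_mu] by (simp add: space_restrict_space)

lemma borel_measurable_mu: "continuous_on H f \<Longrightarrow> f \<in> borel_measurable \<mu>"
  for f :: "_ \<Rightarrow> 'b::topological_space"
  using borel_measurable_continuous_on_restrict[of H f] measurable_cong_sets[OF sets_mu refl] by blast

lemma measurable_into_mu:
  assumes "f \<in> borel_measurable M" "\<And>x. x \<in> space M \<Longrightarrow> f x \<in> H"
  shows "f \<in> measurable M \<mu>"
  using assms measurable_cong_sets[OF refl sets_mu] by (auto intro!: measurable_restrict_space2)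

lemma measurable_mu_borel: "f \<in> measurable M \<mu> \<Longrightarrow> f \<in> borel_measurable M"
  by (rule measurable_compose[OF _ borel_measurable_mu]) (auto intro: continuous_intros)

lemma measurable_mu_mult[measurable (raw)]:
  assumes "f \<in> measurable M \<mu>" "g \<in> measurable M \<mu>"
  shows "(\<lambda>x. f x ** g x) \<in> measurable M \<mu>"
proof (rule measurable_into_mu)
  show "(\<lambda>x. f x ** g x) \<in> borel_measurable M"
    by (rule borel_measurable_continuous_Pair[where H="(**)"])
       (intro measurable_mu_borel assms continuous_on_matrix_mult continuous_intros)+
qed (use assms[THEN measurable_space] mult_H in auto)

lemma measurable_mu_inv[measurable (raw)]:
  assumes "f \<in> measurable M \<mu>"
  shows "(\<lambda>x. matrix_inv (f x)) \<in> measurable M \<mu>"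
proof (rule measurable_into_mu)
  show "(\<lambda>x. matrix_inv (f x)) \<in> borel_measurable M"
    by (rule measurable_compose[OF assms borel_measurable_mu])
       (intro continuous_on_matrix_inv continuous_intros invertible_H)
qed (use assms[THEN measurable_space] inv_H in auto)

lemma borel_measurable_mu_det[measurable (raw)]:
  assumes "f \<in> measurable M \<mu>"
  shows "(\<lambda>x. det (f x)) \<in> borel_measurable M"
  by (rule measurable_compose[OF assms borel_measurable_mu]) (intro continuous_on_det continuous_intros)

lemma borel_measurable_mu_norm[measurable (raw)]:
  assumes "f \<in> measurable M \<mu>"
  shows "(\<lambda>x. norm (f x)) \<in> borel_measurable M"
  by (rule measurable_compose[OF assms borel_measurable_mu]) (intro continuous_intros)

lemma borel_measurable_mu_transpose_vector[measurable (raw)]: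
  assumes "f \<in> measurable M \<mu>" "g \<in> borel_measurable M"
  shows "(\<lambda>x. transpose (f x) *v g x) \<in> borel_measurable M"
  by (rule borel_measurable_continuous_Pair[where H="\<lambda>A x. transpose A *v x"])
     (intro measurable_mu_borel assms continuous_on_matrix_vector_mult continuous_on_transpose continuous_intros)+

lemma distr_left_translation:
  assumes g: "g \<in> H"
  shows "distr \<mu> \<mu> (\<lambda>h. g ** h) = \<mu>"
proof (rule measure_eqI)
  have gm[measurable]: "g \<in> space \<mu>" using g by simp
  have m: "(\<lambda>h. g ** h) \<in> measurable \<mu> \<mu>" by measurable
  fix B assume "B \<in> sets (distr \<mu> \<mu> ((**) g))"
  then have B: "B \<in> sets \<mu>" by simp
  then have BH: "B \<subseteq> H" using sets.sets_into_space by force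
  have 1: "g ** (matrix_inv g ** h) = h" "matrix_inv g ** (g ** h) = h" for h :: "real ^ 'n ^ 'n"
    using matrix_inv_mult[OF invertible_H[OF g]] by (simp_all add: matrix_mul_assoc)
  have "(\<lambda>h. g ** h) -` B \<inter> space \<mu> = (\<lambda>h. matrix_inv g ** h) ` B"
  proof (intro set_eqI iffI)
    fix x assume "x \<in> (\<lambda>h. g ** h) -` B \<inter> space \<mu>"
    then show "x \<in> (\<lambda>h. matrix_inv g ** h) ` B" by (intro image_eqI[of _ _ "g ** x"]) (simp_all add: 1)
  qed (use BH 1 mult_H[OF inv_H[OF g]] in auto)
  then have "emeasure (distr \<mu> \<mu> (\<lambda>h. g ** h)) B = emeasure \<mu> ((\<lambda>h. matrix_inv g ** h) ` B)"
    using m B by (simp add: emeasure_distr)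
  also have "\<dots> = emeasure \<mu> B"
    by (rule haar_translate[OF inv_H[OF g] B])
  finally show "emeasure (distr \<mu> \<mu> (\<lambda>h. g ** h)) B = emeasure \<mu> B" .
qed simp

lemma nn_integral_left_translation:
  assumes g: "g \<in> H" and f: "f \<in> borel_measurable \<mu>"
  shows "(\<integral>\<^sup>+h. f (g ** h) \<partial>\<mu>) = (\<integral>\<^sup>+h. f h \<partial>\<mu>)"
proof -
  have gm[measurable]: "g \<in> space \<mu>" using g by simp
  have m: "(\<lambda>h. g ** h) \<in> measurable \<mu> \<mu>" by measurable
  have "(\<integral>\<^sup>+h. f h \<partial>distr \<mu> \<mu> (\<lambda>h. g ** h)) = (\<integral>\<^sup>+h. f (g ** h) \<partial>\<mu>)"
    by (rule nn_integral_distr[OF m]) (use f in simp)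
  then show ?thesis by (simp add: distr_left_translation[OF g])
qed

text \<open>The sets of all \<open>h\<close> in \<open>H\<close> with \<open>|h| \<le> n\<close> and \<open>|det h| \<ge> 1 / (n + 1)\<close> are compact and
  exhaust \<open>H\<close>.\<close>

lemma sigma_finite_mu: "sigma_finite_measure \<mu>"
proof -
  obtain C where C: "closed C" "H = {h. invertible h} \<inter> C"
    using closed_subgroup unfolding closed_subgroup_GL_def by (auto simp: closedin_closed)
  define K where "K n = H \<inter> cball 0 (real n) \<inter> {h. 1 / real (Suc n) \<le> \<bar>det h\<bar>}" for n
  have K_alt: "K n = cball 0 (real n) \<inter> (C \<inter> {h. 1 / real (Suc n) \<le> \<bar>det h\<bar>})" for n
    unfolding K_def using C(2) by (auto simp: invertible_det_nz)
  have comp: "compact (K n)" for n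
    unfolding K_alt
    by (intro compact_Int_closed closed_Int C(1) compact_cball closed_Collect_le continuous_intros continuous_on_det)
  have KH: "K n \<subseteq> H" for n unfolding K_def by auto
  have "K n \<in> sets (restrict_space borel H)" for n
    unfolding sets_restrict_space using comp[of n] KH[of n]
    by (auto intro!: image_eqI[where x="K n"] borel_compact)
  then have Ks: "K n \<in> sets \<mu>" for n by (simp add: sets_mu)
  have fin: "emeasure \<mu> (K n) < \<infinity>" for n
    by (rule haar_compact[OF comp KH])
  have "H \<subseteq> (\<Union>n. K n)"
  proof
    fix h assume h: "h \<in> H"
    then have d: "\<bar>det h\<bar> > 0" using invertible_H by (simp add: invertible_det_nz)
    obtain n1 where n1: "norm h \<le> real n1" using real_arch_simple by blast
    obtain n2 where n2: "1 / \<bar>det h\<bar> \<le> real n2" using real_arch_simple by blast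
    have "1 / real (Suc (max n1 n2)) \<le> \<bar>det h\<bar>"
    proof -
      have "1 / \<bar>det h\<bar> \<le> real (Suc (max n1 n2))" using n2 by simp
      then show ?thesis using d by (simp add: field_simps)
    qed
    then have "h \<in> K (max n1 n2)" using h n1 by (auto simp: K_def)
    then show "h \<in> (\<Union>n. K n)" by blast
  qed
  then have un: "(\<Union>n. K n) = H" using KH by blast
  show ?thesis
  proof
    show "\<exists>A. countable A \<and> A \<subseteq> sets \<mu> \<and> \<Union>A = space \<mu> \<and> (\<forall>a\<in>A. emeasure \<mu> a \<noteq> \<infinity>)"
      using Ks fin un by (intro exI[of _ "range K"]) (auto simp: less_top)
  qed
qed

sublocale mu: sigma_finite_measure \<mu> by (rule sigma_finite_mu)
sublocale mumu: pair_sigma_finite \<mu> \<mu> ..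
sublocale mulb: pair_sigma_finite \<mu> "lborel :: (real ^ 'n) measure" ..

text \<open>Haar measure is only left invariant, so the inner integral on the left depends on \<open>x\<close>
  through the modular function. Two left translations and two applications of Fubini
  nevertheless separate the variables, without reference to that function.\<close>

lemma nn_integral_right_translation_average:
  assumes [measurable]: "f \<in> borel_measurable \<mu>" "g \<in> borel_measurable \<mu>"
  shows "(\<integral>\<^sup>+x. g x * (\<integral>\<^sup>+y. f (y ** x) \<partial>\<mu>) \<partial>\<mu>) = (\<integral>\<^sup>+x. f x \<partial>\<mu>) * (\<integral>\<^sup>+y. g (matrix_inv y) \<partial>\<mu>)"
proof -
  have inv_cancel: "matrix_inv y ** (y ** x) = x" if "y \<in> H" for x y :: "real ^ 'n ^ 'n"
    using matrix_inv_mult[OF invertible_H[OF that]] by (simp add: matrix_mul_assoc)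
  have "(\<integral>\<^sup>+x. g x * (\<integral>\<^sup>+y. f (y ** x) \<partial>\<mu>) \<partial>\<mu>) = (\<integral>\<^sup>+x. \<integral>\<^sup>+y. g x * f (y ** x) \<partial>\<mu> \<partial>\<mu>)"
    by (intro nn_integral_cong nn_integral_cmult[symmetric]) measurable
  also have "\<dots> = (\<integral>\<^sup>+y. \<integral>\<^sup>+x. g x * f (y ** x) \<partial>\<mu> \<partial>\<mu>)"
    by (rule mumu.Fubini') measurable
  also have "\<dots> = (\<integral>\<^sup>+y. \<integral>\<^sup>+x. g (matrix_inv y ** x) * f x \<partial>\<mu> \<partial>\<mu>)"
  proof (rule nn_integral_cong)
    fix y assume "y \<in> space \<mu>"
    then have y: "y \<in> H" by simp
    have ym[measurable]: "y \<in> space \<mu>" using y by simp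
    have "(\<integral>\<^sup>+x. g x * f (y ** x) \<partial>\<mu>) = (\<integral>\<^sup>+x. g (matrix_inv y ** (y ** x)) * f (y ** x) \<partial>\<mu>)"
      by (simp add: inv_cancel[OF y])
    also have "\<dots> = (\<integral>\<^sup>+x. g (matrix_inv y ** x) * f x \<partial>\<mu>)"
      by (rule nn_integral_left_translation[OF y, of "\<lambda>x. g (matrix_inv y ** x) * f x"]) measurable
    finally show "(\<integral>\<^sup>+x. g x * f (y ** x) \<partial>\<mu>) = (\<integral>\<^sup>+x. g (matrix_inv y ** x) * f x \<partial>\<mu>)" .
  qed
  also have "\<dots> = (\<integral>\<^sup>+x. \<integral>\<^sup>+y. g (matrix_inv y ** x) * f x \<partial>\<mu> \<partial>\<mu>)"
    by (rule mumu.Fubini') measurable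
  also have "\<dots> = (\<integral>\<^sup>+x. (\<integral>\<^sup>+y. g (matrix_inv y) \<partial>\<mu>) * f x \<partial>\<mu>)"
  proof (rule nn_integral_cong)
    fix x assume "x \<in> space \<mu>"
    then have x: "x \<in> H" by simp
    have xm[measurable]: "x \<in> space \<mu>" using x by simp
    have *: "matrix_inv (matrix_inv x ** y) = matrix_inv y ** x" if "y \<in> H" for y
      using that x by (simp add: matrix_inv_prod invertible_H inv_H matrix_inv_involutive)
    have "(\<integral>\<^sup>+y. g (matrix_inv y ** x) * f x \<partial>\<mu>) = (\<integral>\<^sup>+y. g (matrix_inv (matrix_inv x ** y)) \<partial>\<mu>) * f x"
      by (subst nn_integral_multc[symmetric]) (auto intro!: nn_integral_cong simp: * )
    also have "(\<integral>\<^sup>+y. g (matrix_inv (matrix_inv x ** y)) \<partial>\<mu>) = (\<integral>\<^sup>+y. g (matrix_inv y) \<partial>\<mu>)"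
      by (rule nn_integral_left_translation[OF inv_H[OF x], of "\<lambda>y. g (matrix_inv y)"]) measurable
    finally show "(\<integral>\<^sup>+y. g (matrix_inv y ** x) * f x \<partial>\<mu>) = (\<integral>\<^sup>+y. g (matrix_inv y) \<partial>\<mu>) * f x" .
  qed
  also have "\<dots> = (\<integral>\<^sup>+x. f x \<partial>\<mu>) * (\<integral>\<^sup>+y. g (matrix_inv y) \<partial>\<mu>)"
    by (subst nn_integral_cmult) (auto simp: mult.commute)
  finally show ?thesis .
qed

text \<open>Inversion maps null sets to null sets: take \<open>f = 1\<close> and \<open>g\<close> the indicator of the
  exceptional set in the averaging formula.\<close>

lemma AE_matrix_inv:
  assumes P[measurable]: "Measurable.pred \<mu> P" and AE: "AE h in \<mu>. P h"
  shows "AE h in \<mu>. P (matrix_inv h)"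
proof -
  let ?g = "indicator {h \<in> space \<mu>. \<not> P h} :: _ \<Rightarrow> ennreal"
  have gm[measurable]: "?g \<in> borel_measurable \<mu>" by measurable
  have "AE x in \<mu>. ?g x * (\<integral>\<^sup>+y. 1 \<partial>\<mu>) = 0"
    using AE by eventually_elim (simp add: indicator_def)
  then have "(\<integral>\<^sup>+x. ?g x * (\<integral>\<^sup>+y. 1 \<partial>\<mu>) \<partial>\<mu>) = 0"
    by (subst nn_integral_0_iff_AE) measurable
  then have "(\<integral>\<^sup>+x. 1 \<partial>\<mu>) * (\<integral>\<^sup>+y. ?g (matrix_inv y) \<partial>\<mu>) = 0"
    using nn_integral_right_translation_average[of "\<lambda>_. 1" ?g] gm by simp
  then have "(\<integral>\<^sup>+y. ?g (matrix_inv y) \<partial>\<mu>) = 0"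
    using emeasure_H_pos by simp
  then have "AE y in \<mu>. ?g (matrix_inv y) = 0"
    by (subst (asm) nn_integral_0_iff_AE) measurable
  with AE_space show ?thesis
    by eventually_elim (auto simp: indicator_def inv_H split: if_splits)
qed

end

lemma transpose_mult_vector: "transpose (A ** B) *v x = transpose B *v (transpose A *v x)"
  for A B :: "real ^ 'n ^ 'n"
  by (simp add: matrix_transpose_mul matrix_vector_mul_assoc)

locale open_orbit = haar_matrix_group H \<mu>
  for H :: "(real ^ 'n::finite ^ 'n) set" and \<mu> :: "(real ^ 'n ^ 'n) measure" +
  fixes Orb :: "(real ^ 'n) set" and \<xi>0 :: "real ^ 'n"
  assumes Orb_eq: "Orb = dual_orbit H \<xi>0" and open_Orb: "open Orb"
begin

lemma base_in_Orb: "\<xi>0 \<in> Orb"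
proof -
  have "mat 1 \<in> H" using closed_subgroup unfolding closed_subgroup_GL_def by simp
  then have "transpose (mat 1) *v \<xi>0 \<in> Orb" unfolding Orb_eq dual_orbit_def by blast
  then show ?thesis by (simp add: transpose_mat)
qed

lemma borel_Orb[measurable]: "Orb \<in> sets borel"
  using open_Orb by simp

lemma transpose_inverse: "h \<in> H \<Longrightarrow> transpose (matrix_inv h) *v (transpose h *v x) = x"
  "h \<in> H \<Longrightarrow> transpose h *v (transpose (matrix_inv h) *v x) = x"
  by (simp_all add: transpose_mult_vector[symmetric] matrix_inv_mult invertible_H transpose_mat)

lemma Orb_invariant_imp: "h \<in> H \<Longrightarrow> \<xi> \<in> Orb \<Longrightarrow> transpose h *v \<xi> \<in> Orb"
  unfolding Orb_eq dual_orbit_def by (auto simp: transpose_mult_vector[symmetric] mult_H)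

lemma Orb_invariant: "h \<in> H \<Longrightarrow> transpose h *v \<xi> \<in> Orb \<longleftrightarrow> \<xi> \<in> Orb"
  using Orb_invariant_imp[of h \<xi>] Orb_invariant_imp[of "matrix_inv h" "transpose h *v \<xi>"]
  by (auto simp: transpose_inverse inv_H)

lemma zero_notin_Orb: "0 \<notin> Orb"
proof
  assume "0 \<in> Orb"
  then obtain h where h: "h \<in> H" "0 = transpose h *v \<xi>0" unfolding Orb_eq dual_orbit_def by auto
  then have "\<xi>0 = 0" using transpose_inverse(1)[OF h(1), of \<xi>0] by simp
  then have "Orb \<subseteq> {0}" unfolding Orb_eq dual_orbit_def by auto
  then have "Orb = {0}" using \<open>0 \<in> Orb\<close> by blast
  then have "open {0 :: real ^ 'n}" using open_Orb by simp
  then show False using not_open_singleton by blast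
qed

lemma emeasure_Orb_pos: "emeasure lborel Orb \<noteq> 0"
proof
  assume "emeasure lborel Orb = 0"
  then have "negligible Orb" using borel_Orb by (simp add: negligible_iff_null_sets null_sets_completionI null_setsI)
  then show False using open_not_negligible[OF open_Orb] base_in_Orb by blast
qed

text \<open>The orbit map transports Haar measure to a measure on the orbit of \<open>\<xi>\<close>; the factor
  \<open>1 / |det k|\<close> makes it transform under the dual action as Lebesgue measure does.\<close>

definition pullback :: "(real ^ 'n \<Rightarrow> ennreal) \<Rightarrow> real ^ 'n \<Rightarrow> ennreal" where
  "pullback F \<xi> = (\<integral>\<^sup>+k. F (transpose (matrix_inv k) *v \<xi>) * ennreal (1 / \<bar>det k\<bar>) \<partial>\<mu>)"

lemma measurable_pullback[measurable]:
  assumes [measurable]: "F \<in> borel_measurable borel"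
  shows "pullback F \<in> borel_measurable borel"
  unfolding pullback_def by measurable

text \<open>Fubini, the substitution \<open>\<xi> = k\<^sup>T \<eta>\<close> in the inner integral, which cancels the
  determinant, and left invariance: if \<open>\<eta> = b\<^sup>T \<xi>\<^sub>0\<close> is in the orbit, then
  \<open>k\<^sup>T \<eta> = (b k)\<^sup>T \<xi>\<^sub>0\<close>, so the integral over \<open>k\<close> is the same for every \<open>\<eta>\<close>.\<close>

lemma orbit_fubini:
  assumes [measurable]: "F \<in> borel_measurable borel" "\<phi> \<in> borel_measurable borel"
  shows "(\<integral>\<^sup>+\<xi>. \<phi> \<xi> * indicator Orb \<xi> * pullback F \<xi> \<partial>lborel)
     = (\<integral>\<^sup>+k. \<phi> (transpose k *v \<xi>0) \<partial>\<mu>) * (\<integral>\<^sup>+\<eta>. F \<eta> * indicator Orb \<eta> \<partial>lborel)"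
proof -
  have "(\<integral>\<^sup>+\<xi>. \<phi> \<xi> * indicator Orb \<xi> * pullback F \<xi> \<partial>lborel)
     = (\<integral>\<^sup>+\<xi>. \<integral>\<^sup>+k. \<phi> \<xi> * indicator Orb \<xi> * (F (transpose (matrix_inv k) *v \<xi>) * ennreal (1 / \<bar>det k\<bar>)) \<partial>\<mu> \<partial>lborel)"
    unfolding pullback_def by (intro nn_integral_cong nn_integral_cmult[symmetric]) measurable
  also have "\<dots> = (\<integral>\<^sup>+k. \<integral>\<^sup>+\<xi>. \<phi> \<xi> * indicator Orb \<xi> * (F (transpose (matrix_inv k) *v \<xi>) * ennreal (1 / \<bar>det k\<bar>)) \<partial>lborel \<partial>\<mu>)"
    by (rule mulb.Fubini') measurable
  also have "\<dots> = (\<integral>\<^sup>+k. \<integral>\<^sup>+\<eta>. \<phi> (transpose k *v \<eta>) * (F \<eta> * indicator Orb \<eta>) \<partial>lborel \<partial>\<mu>)"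
  proof (rule nn_integral_cong)
    fix k assume "k \<in> space \<mu>"
    then have k: "k \<in> H" by simp
    have km[measurable]: "k \<in> space \<mu>" using k by simp
    have d: "det k \<noteq> 0" using invertible_H[OF k] by (simp add: invertible_det_nz)
    have inv: "invertible (transpose k)" using d by (simp add: invertible_det_nz)
    have "(\<integral>\<^sup>+\<xi>. \<phi> \<xi> * indicator Orb \<xi> * (F (transpose (matrix_inv k) *v \<xi>) * ennreal (1 / \<bar>det k\<bar>)) \<partial>lborel)
      = ennreal \<bar>det (transpose k)\<bar> * (\<integral>\<^sup>+\<eta>. \<phi> (transpose k *v \<eta>) * indicator Orb (transpose k *v \<eta>) *
            (F (transpose (matrix_inv k) *v (transpose k *v \<eta>)) * ennreal (1 / \<bar>det k\<bar>)) \<partial>lborel)"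
      by (rule nn_integral_lborel_linear[OF inv]) measurable
    also have "\<dots> = (\<integral>\<^sup>+\<eta>. (ennreal \<bar>det k\<bar> * ennreal (1 / \<bar>det k\<bar>)) * (\<phi> (transpose k *v \<eta>) * (F \<eta> * indicator Orb \<eta>)) \<partial>lborel)"
      by (subst nn_integral_cmult[symmetric], measurable)
         (auto intro!: nn_integral_cong simp: transpose_inverse[OF k] indicator_def Orb_invariant[OF k] ac_simps det_transpose)
    also have "ennreal \<bar>det k\<bar> * ennreal (1 / \<bar>det k\<bar>) = 1"
      using d by (simp add: ennreal_mult[symmetric])
    finally show "(\<integral>\<^sup>+\<xi>. \<phi> \<xi> * indicator Orb \<xi> * (F (transpose (matrix_inv k) *v \<xi>) * ennreal (1 / \<bar>det k\<bar>)) \<partial>lborel)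
      = (\<integral>\<^sup>+\<eta>. \<phi> (transpose k *v \<eta>) * (F \<eta> * indicator Orb \<eta>) \<partial>lborel)" by simp
  qed
  also have "\<dots> = (\<integral>\<^sup>+\<eta>. \<integral>\<^sup>+k. \<phi> (transpose k *v \<eta>) * (F \<eta> * indicator Orb \<eta>) \<partial>\<mu> \<partial>lborel)"
    by (rule mulb.Fubini'[symmetric]) measurable
  also have "\<dots> = (\<integral>\<^sup>+\<eta>. (\<integral>\<^sup>+k. \<phi> (transpose k *v \<xi>0) \<partial>\<mu>) * (F \<eta> * indicator Orb \<eta>) \<partial>lborel)"
  proof (rule nn_integral_cong)
    fix \<eta>
    show "(\<integral>\<^sup>+k. \<phi> (transpose k *v \<eta>) * (F \<eta> * indicator Orb \<eta>) \<partial>\<mu>) = (\<integral>\<^sup>+k. \<phi> (transpose k *v \<xi>0) \<partial>\<mu>) * (F \<eta> * indicator Orb \<eta>)"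
    proof (cases "\<eta> \<in> Orb")
      case True
      then obtain b where b: "b \<in> H" "\<eta> = transpose b *v \<xi>0" unfolding Orb_eq dual_orbit_def by auto
      have "(\<integral>\<^sup>+k. \<phi> (transpose k *v \<eta>) \<partial>\<mu>) = (\<integral>\<^sup>+k. \<phi> (transpose (b ** k) *v \<xi>0) \<partial>\<mu>)"
        by (simp add: b transpose_mult_vector)
      also have "\<dots> = (\<integral>\<^sup>+k. \<phi> (transpose k *v \<xi>0) \<partial>\<mu>)"
        by (rule nn_integral_left_translation[OF b(1), of "\<lambda>k. \<phi> (transpose k *v \<xi>0)"]) measurable
      finally show ?thesis by (subst nn_integral_multc) simp_all
    qed simp
  qed
  also have "\<dots> = (\<integral>\<^sup>+k. \<phi> (transpose k *v \<xi>0) \<partial>\<mu>) * (\<integral>\<^sup>+\<eta>. F \<eta> * indicator Orb \<eta> \<partial>lborel)"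
    by (rule nn_integral_cmult) measurable
  finally show ?thesis .
qed

text \<open>Apply \<open>orbit_fubini\<close> to the indicator of the exceptional set and \<open>F = 1\<close>: the left
  hand side is 0, and the orbit, being open, has positive Lebesgue measure.\<close>

lemma AE_orbit_map:
  assumes [measurable]: "Measurable.pred borel P" and AE: "AE \<xi> in lborel. \<xi> \<in> Orb \<longrightarrow> P \<xi>"
  shows "AE k in \<mu>. P (transpose k *v \<xi>0)"
proof -
  let ?\<phi> = "indicator {\<xi>. \<not> P \<xi>} :: _ \<Rightarrow> ennreal"
  have "(\<integral>\<^sup>+\<xi>. ?\<phi> \<xi> * indicator Orb \<xi> * pullback (\<lambda>_. 1) \<xi> \<partial>lborel) = 0"
    by (subst nn_integral_0_iff_AE) (use AE in \<open>auto simp: indicator_def elim!: eventually_mono\<close>)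
  then have "(\<integral>\<^sup>+k. ?\<phi> (transpose k *v \<xi>0) \<partial>\<mu>) * emeasure lborel Orb = 0"
    using orbit_fubini[of "\<lambda>_. 1" ?\<phi>] by simp
  then have "(\<integral>\<^sup>+k. ?\<phi> (transpose k *v \<xi>0) \<partial>\<mu>) = 0" using emeasure_Orb_pos by simp
  then have "AE k in \<mu>. ?\<phi> (transpose k *v \<xi>0) = 0"
    by (subst (asm) nn_integral_0_iff_AE) measurable
  then show ?thesis by eventually_elim (auto simp: indicator_def split: if_splits)
qed

text \<open>The averaging formula for the function \<open>k \<mapsto> F(k\<^sup>-\<^sup>T \<xi>\<^sub>0) / |det k|\<close>, whose right
  translate by \<open>a\<close> integrates to the pullback at \<open>a\<^sup>-\<^sup>T \<xi>\<^sub>0\<close> divided by \<open>|det a|\<close>.\<close>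

lemma pullback_average:
  assumes [measurable]: "F \<in> borel_measurable borel" "g \<in> borel_measurable \<mu>"
  shows "(\<integral>\<^sup>+a. g a * pullback F (transpose (matrix_inv a) *v \<xi>0) * ennreal (1 / \<bar>det a\<bar>) \<partial>\<mu>)
     = pullback F \<xi>0 * (\<integral>\<^sup>+y. g (matrix_inv y) \<partial>\<mu>)"
proof -
  let ?f = "\<lambda>k. F (transpose (matrix_inv k) *v \<xi>0) * ennreal (1 / \<bar>det k\<bar>)"
  have [measurable]: "\<xi>0 \<in> space borel" by simp
  have "(\<integral>\<^sup>+a. g a * pullback F (transpose (matrix_inv a) *v \<xi>0) * ennreal (1 / \<bar>det a\<bar>) \<partial>\<mu>)
      = (\<integral>\<^sup>+a. g a * (\<integral>\<^sup>+k. ?f (k ** a) \<partial>\<mu>) \<partial>\<mu>)"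
  proof (rule nn_integral_cong)
    fix a assume "a \<in> space \<mu>"
    then have a: "a \<in> H" by simp
    have "pullback F (transpose (matrix_inv a) *v \<xi>0) * ennreal (1 / \<bar>det a\<bar>) = (\<integral>\<^sup>+k. ?f (k ** a) \<partial>\<mu>)"
      unfolding pullback_def
      by (subst nn_integral_multc[symmetric], measurable)
         (auto intro!: nn_integral_cong simp: transpose_mult_vector matrix_inv_prod invertible_H a det_mul abs_mult ennreal_mult mult.assoc
           simp flip: ennreal_mult)
    then show "g a * pullback F (transpose (matrix_inv a) *v \<xi>0) * ennreal (1 / \<bar>det a\<bar>) = g a * (\<integral>\<^sup>+k. ?f (k ** a) \<partial>\<mu>)"
      by (simp add: mult.assoc)
  qed
  also have "\<dots> = (\<integral>\<^sup>+x. ?f x \<partial>\<mu>) * (\<integral>\<^sup>+y. g (matrix_inv y) \<partial>\<mu>)"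
    by (rule nn_integral_right_translation_average) measurable
  finally show ?thesis by (simp add: pullback_def)
qed

text \<open>By \<open>orbit_fubini\<close>, the function \<open>pullback F\<close> agrees almost everywhere on the orbit
  with a multiple of a fixed density, the factor being the integral of \<open>F\<close> over the orbit.
  Comparing \<open>F\<close> with one fixed positive integrable function \<open>F1\<close> gives
  \<open>pullback F \<xi> * \<integral>F1 = pullback F1 \<xi> * \<integral>F\<close> for almost every \<open>\<xi>\<close>, and \<open>pullback_average\<close>
  upgrades this to the point \<open>\<xi>0\<close>.\<close>

theorem orbit_integral_le:
  "\<exists>C>0. \<forall>F\<in>borel_measurable borel. (\<integral>\<^sup>+\<eta>. F \<eta> * indicator Orb \<eta> \<partial>lborel) \<le> ennreal C * pullback F \<xi>0"
proof -
  let ?I = "\<lambda>F. \<integral>\<^sup>+\<eta>. F \<eta> * indicator Orb \<eta> \<partial>lborel"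
  obtain F1 :: "real ^ 'n \<Rightarrow> ennreal" where F1[measurable]: "F1 \<in> borel_measurable borel"
      and F1_fin: "?I F1 < \<infinity>" and F1_pos: "\<And>x. 0 < F1 x"
  proof -
    obtain h :: "real ^ 'n \<Rightarrow> ennreal" where h: "h \<in> borel_measurable lborel" "integral\<^sup>N lborel h \<noteq> \<infinity>" "\<And>x. x \<in> space lborel \<Longrightarrow> 0 < h x"
      using sigma_finite_measure.Ex_finite_integrable_function[OF lborel.sigma_finite_measure_axioms] by blast
    have "?I h \<le> integral\<^sup>N lborel h" by (intro nn_integral_mono) (auto simp: indicator_def)
    then have "?I h < \<infinity>" using h(2) by (auto simp: less_top[symmetric] top_unique)
    then show ?thesis using h by (intro that[of h]) auto
  qed
  \<comment> \<open>\<open>g\<close> is the averaging weight: the integral of \<open>g (matrix_inv y)\<close> is positive and finite,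
    so it can be cancelled.\<close>
  obtain g0 where g0[measurable]: "g0 \<in> borel_measurable \<mu>" and g0_fin: "integral\<^sup>N \<mu> g0 \<noteq> \<infinity>" and g0_pos: "\<And>x. x \<in> H \<Longrightarrow> 0 < g0 x"
    using mu.Ex_finite_integrable_function by auto
  define g where "g h = g0 (matrix_inv h)" for h
  have [measurable]: "g \<in> borel_measurable \<mu>" unfolding g_def by measurable
  have cg: "(\<integral>\<^sup>+y. g (matrix_inv y) \<partial>\<mu>) = integral\<^sup>N \<mu> g0"
    unfolding g_def by (intro nn_integral_cong) (simp add: matrix_inv_involutive invertible_H)
  have cg0: "integral\<^sup>N \<mu> g0 \<noteq> 0"
  proof
    assume "integral\<^sup>N \<mu> g0 = 0"
    then have "AE x in \<mu>. g0 x = 0" by (subst (asm) nn_integral_0_iff_AE) measurable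
    moreover have "AE x in \<mu>. g0 x \<noteq> 0" using g0_pos by (intro AE_I2) (metis less_irrefl space_mu)
    ultimately have "AE x in \<mu>. False" by eventually_elim simp
    then show False using emeasure_H_pos by (simp add: eventually_False ae_filter_eq_bot_iff)
  qed
  have [measurable]: "\<xi>0 \<in> space borel" by simp
  have key: "pullback F \<xi>0 * ?I F1 = pullback F1 \<xi>0 * ?I F" if [measurable]: "F \<in> borel_measurable borel" for F
  proof -
    \<comment> \<open>By \<open>orbit_fubini\<close>, both densities define the same measure.\<close>
    have "density lborel (\<lambda>\<xi>. ?I F1 * (indicator Orb \<xi> * pullback F \<xi>)) = density lborel (\<lambda>\<xi>. ?I F * (indicator Orb \<xi> * pullback F1 \<xi>))"
    proof (rule measure_eqI)
      fix X :: "(real ^ 'n) set" assume "X \<in> sets (density lborel (\<lambda>\<xi>. ?I F1 * (indicator Orb \<xi> * pullback F \<xi>)))"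
      then have [measurable]: "X \<in> sets borel" by simp
      have em: "emeasure (density lborel (\<lambda>\<xi>. c * (indicator Orb \<xi> * pullback G \<xi>))) X = c * ((\<integral>\<^sup>+k. indicator X (transpose k *v \<xi>0) \<partial>\<mu>) * ?I G)"
        if [measurable]: "G \<in> borel_measurable borel" for G c
      proof -
        have "emeasure (density lborel (\<lambda>\<xi>. c * (indicator Orb \<xi> * pullback G \<xi>))) X = (\<integral>\<^sup>+\<xi>. c * (indicator X \<xi> * indicator Orb \<xi> * pullback G \<xi>) \<partial>lborel)"
          by (subst emeasure_density) (auto intro!: nn_integral_cong simp: ac_simps)
        also have "\<dots> = c * (\<integral>\<^sup>+\<xi>. indicator X \<xi> * indicator Orb \<xi> * pullback G \<xi> \<partial>lborel)"
          by (rule nn_integral_cmult) measurable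
        finally show ?thesis by (subst (asm) orbit_fubini) measurable
      qed
      show "emeasure (density lborel (\<lambda>\<xi>. ?I F1 * (indicator Orb \<xi> * pullback F \<xi>))) X = emeasure (density lborel (\<lambda>\<xi>. ?I F * (indicator Orb \<xi> * pullback F1 \<xi>))) X"
        by (simp only: em[OF that] em[OF F1]) (simp add: ac_simps)
    qed simp
    then have "AE \<xi> in lborel. ?I F1 * (indicator Orb \<xi> * pullback F \<xi>) = ?I F * (indicator Orb \<xi> * pullback F1 \<xi>)"
      by (subst (asm) sigma_finite_measure.density_unique_iff[OF lborel.sigma_finite_measure_axioms]) measurable
    then have "AE \<xi> in lborel. \<xi> \<in> Orb \<longrightarrow> ?I F1 * pullback F \<xi> = ?I F * pullback F1 \<xi>"
      by eventually_elim auto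
    then have "AE k in \<mu>. ?I F1 * pullback F (transpose k *v \<xi>0) = ?I F * pullback F1 (transpose k *v \<xi>0)"
      by (rule AE_orbit_map[rotated]) measurable
    \<comment> \<open>Transport the almost everywhere identity from the orbit to \<open>H\<close>, and invert, to match
      the argument in \<open>pullback_average\<close>.\<close>
    then have AE: "AE k in \<mu>. ?I F1 * pullback F (transpose (matrix_inv k) *v \<xi>0) = ?I F * pullback F1 (transpose (matrix_inv k) *v \<xi>0)"
      by (rule AE_matrix_inv[rotated]) measurable
    have av: "c * (pullback G \<xi>0 * integral\<^sup>N \<mu> g0) = (\<integral>\<^sup>+a. g a * (c * pullback G (transpose (matrix_inv a) *v \<xi>0)) * ennreal (1 / \<bar>det a\<bar>) \<partial>\<mu>)"
      if [measurable]: "G \<in> borel_measurable borel" for G c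
      unfolding cg[symmetric]
      by (subst pullback_average[symmetric], measurable, subst nn_integral_cmult[symmetric], measurable)
         (auto intro!: nn_integral_cong simp: ac_simps)
    have "?I F1 * (pullback F \<xi>0 * integral\<^sup>N \<mu> g0) = ?I F * (pullback F1 \<xi>0 * integral\<^sup>N \<mu> g0)"
      unfolding av[OF that] av[OF F1]
      by (rule nn_integral_cong_AE) (use AE in \<open>eventually_elim, simp\<close>)
    then have "integral\<^sup>N \<mu> g0 * (pullback F \<xi>0 * ?I F1) = integral\<^sup>N \<mu> g0 * (pullback F1 \<xi>0 * ?I F)"
      by (simp add: ac_simps)
    then show ?thesis using cg0 g0_fin by (simp add: ennreal_mult_cancel_left)
  qed
  have pos: "pullback F1 \<xi>0 \<noteq> 0"
  proof
    assume "pullback F1 \<xi>0 = 0"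
    then have "AE k in \<mu>. F1 (transpose (matrix_inv k) *v \<xi>0) * ennreal (1 / \<bar>det k\<bar>) = 0"
      unfolding pullback_def by (subst (asm) nn_integral_0_iff_AE) measurable
    moreover have "AE k in \<mu>. F1 (transpose (matrix_inv k) *v \<xi>0) * ennreal (1 / \<bar>det k\<bar>) \<noteq> 0"
      using invertible_H F1_pos by (intro AE_I2) (auto simp: invertible_det_nz less_imp_neq[symmetric])
    ultimately have "AE x in \<mu>. False" by eventually_elim simp
    then show False using emeasure_H_pos by (simp add: eventually_False ae_filter_eq_bot_iff)
  qed
  show ?thesis
  \<comment> \<open>With a noncompact stabilizer, the pullback is infinite for every \<open>F\<close> of positive
    integral, and the inequality is trivial.\<close>
  proof (cases "pullback F1 \<xi>0 = \<infinity>")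
    case True
    have "?I F \<le> ennreal 1 * pullback F \<xi>0" if F: "F \<in> borel_measurable borel" for F
    proof (cases "pullback F \<xi>0 = \<infinity>")
      case False
      then have "pullback F \<xi>0 * ?I F1 < \<infinity>" using F1_fin by (simp add: ennreal_mult_less_top less_top)
      then have "\<infinity> * ?I F < \<infinity>" using key[OF F] True by simp
      then have "?I F = 0" by (cases "?I F = 0") (auto simp: ennreal_top_mult)
      then show ?thesis by simp
    qed simp
    then show ?thesis by (intro exI[of _ 1]) simp
  next
    case False
    define c where "c = enn2real (pullback F1 \<xi>0)"
    have c: "pullback F1 \<xi>0 = ennreal c" "c > 0"
      using False pos unfolding c_def by (auto simp: less_top enn2real_positive_iff zero_less_iff_neq_zero)
    define d where "d = enn2real (?I F1)"
    have d: "?I F1 = ennreal d" "d \<ge> 0" using F1_fin unfolding d_def by (auto simp: less_top)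
    have "?I F \<le> ennreal ((d + 1) / c) * pullback F \<xi>0" if F: "F \<in> borel_measurable borel" for F
    proof -
      have "?I F = ennreal (1 / c) * (ennreal c * ?I F)"
        using c by (simp add: mult.assoc[symmetric] ennreal_mult[symmetric])
      also have "\<dots> = ennreal (1 / c) * (pullback F \<xi>0 * ennreal d)" using key[OF F] c d by simp
      also have "\<dots> = ennreal (d / c) * pullback F \<xi>0"
      proof -
        have "ennreal (1 / c) * ennreal d = ennreal (d / c)" using c d by (simp add: ennreal_mult[symmetric])
        then show ?thesis by (metis mult.commute mult.left_commute)
      qed
      also have "\<dots> \<le> ennreal ((d + 1) / c) * pullback F \<xi>0"
        using c d by (intro mult_right_mono ennreal_leI) (auto simp: divide_simps)
      finally show ?thesis .
    qed
    then show ?thesis using c d by (intro exI[of _ "(d + 1) / c"]) auto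
  qed
qed

end

section \<open>Powers, Lebesgue norms and convolution\<close>

lemma ennreal_powr_ennreal: "0 \<le> x \<Longrightarrow> ennreal_powr (ennreal x) a = ennreal (x powr a)"
  by (simp add: ennreal_powr_def)

lemma ennreal_powr_top[simp]: "ennreal_powr \<infinity> a = \<infinity>" "ennreal_powr top a = \<infinity>"
  by (simp_all add: ennreal_powr_def)

lemma ennreal_powr_zero[simp]: "ennreal_powr 0 a = 0"
  by (simp add: ennreal_powr_def)

lemma ennreal_powr_less_top[simp]: "ennreal_powr x a < top \<longleftrightarrow> x < top"
  by (auto simp: ennreal_powr_def less_top)

lemma ennreal_powr_mono:
  assumes "x \<le> y" "0 \<le> a"
  shows "ennreal_powr x a \<le> ennreal_powr y a"
proof (cases "y = \<infinity>")
  case False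
  then have "x \<noteq> \<infinity>" using assms by (auto simp: top_unique)
  then show ?thesis using False assms
    by (auto simp: ennreal_powr_def less_top intro!: ennreal_leI powr_mono2 enn2real_mono)
qed simp

lemma measurable_ennreal_powr[measurable (raw)]:
  assumes [measurable]: "f \<in> borel_measurable M"
  shows "(\<lambda>x. ennreal_powr (f x) a) \<in> borel_measurable M"
  unfolding ennreal_powr_def by measurable

lemma ennreal_powr_cmult:
  assumes "0 < c"
  shows "ennreal_powr (ennreal c * x) a = ennreal (c powr a) * ennreal_powr x a"
proof (cases x)
  case (real r)
  then show ?thesis using assms
    by (simp add: ennreal_mult[symmetric] ennreal_powr_ennreal powr_mult)
next
  case top
  then show ?thesis using assms by (simp add: ennreal_mult_top)
qed

text \<open>Measurability of \<open>F\<close> enters only for the essential supremum, which is infinite by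
  convention on functions that are not measurable.\<close>

lemma Lp_norm_scale_le:
  assumes p: "1 \<le> p" and K: "0 \<le> K" and [measurable]: "R \<in> borel_measurable M"
    and meas: "p = \<infinity> \<Longrightarrow> F \<in> borel_measurable M"
    and le: "AE x in M. F x \<le> ennreal K * R x"
  shows "Lp_norm M p F \<le> ennreal K * Lp_norm M p R"
proof (cases "p = \<infinity>")
  case True
  have "AE x in M. R x \<le> esssup M R" by (rule esssup_AE)
  with le have "AE x in M. F x \<le> ennreal K * esssup M R"
    by eventually_elim (metis order_trans mult_left_mono zero_le)
  then have "esssup M F \<le> ennreal K * esssup M R"
    by (rule esssup_I[OF meas[OF True]])
  then show ?thesis using True by (simp add: Lp_norm_def)
next
  case False
  define r where "r = enn2real p"
  have r: "1 \<le> r" using p False unfolding r_def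
    by (metis enn2real_mono enn2real_1 infinity_ennreal_def less_top)
  show ?thesis
  proof (cases "K = 0")
    case True
    have "AE x in M. ennreal_powr (F x) r = 0"
      using le by eventually_elim (simp add: True)
    then have "(\<integral>\<^sup>+x. ennreal_powr (F x) r \<partial>M) = (\<integral>\<^sup>+x. 0 \<partial>M)" by (rule nn_integral_cong_AE)
    then show ?thesis using False by (simp add: Lp_norm_def r_def)
  next
    case K0: False
    then have Kp: "0 < K" using K by simp
    have "(\<integral>\<^sup>+x. ennreal_powr (F x) r \<partial>M) \<le> (\<integral>\<^sup>+x. ennreal (K powr r) * ennreal_powr (R x) r \<partial>M)"
    proof (rule nn_integral_mono_AE)
      show "AE x in M. ennreal_powr (F x) r \<le> ennreal (K powr r) * ennreal_powr (R x) r"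
        using le
      proof eventually_elim
        case (elim x)
        then have "ennreal_powr (F x) r \<le> ennreal_powr (ennreal K * R x) r"
          using r by (intro ennreal_powr_mono) auto
        then show ?case by (simp add: ennreal_powr_cmult[OF Kp])
      qed
    qed
    also have "\<dots> = ennreal (K powr r) * (\<integral>\<^sup>+x. ennreal_powr (R x) r \<partial>M)"
      by (rule nn_integral_cmult) measurable
    finally have "ennreal_powr (\<integral>\<^sup>+x. ennreal_powr (F x) r \<partial>M) (1 / r)
        \<le> ennreal_powr (ennreal (K powr r) * (\<integral>\<^sup>+x. ennreal_powr (R x) r \<partial>M)) (1 / r)"
      using r by (intro ennreal_powr_mono) auto
    also have "\<dots> = ennreal K * ennreal_powr (\<integral>\<^sup>+x. ennreal_powr (R x) r \<partial>M) (1 / r)"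
      using Kp r by (subst ennreal_powr_cmult) (simp_all add: powr_powr)
    finally show ?thesis using False by (simp add: Lp_norm_def r_def)
  qed
qed

text \<open>The graph of \<open>x \<mapsto> x\<^sup>q\<close> lies above its tangent at \<open>a\<close>.\<close>

lemma powr_tangent_le:
  fixes a x q :: real
  assumes "0 \<le> a" "0 \<le> x" "1 \<le> q"
  shows "q * a powr (q - 1) * x \<le> x powr q + (q - 1) * a powr q"
proof (cases "a = 0 \<or> x = 0")
  case False
  have "(x powr q) powr (1 / q) * (a powr q) powr (1 - 1 / q) \<le> (1 / q) * x powr q + (1 - 1 / q) * a powr q"
    by (rule Youngs_inequality_0) (use assms False in auto)
  moreover have "(x powr q) powr (1 / q) = x" using assms by (simp add: powr_powr)
  moreover have "(a powr q) powr (1 - 1 / q) = a powr (q - 1)"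
    using assms by (simp add: powr_powr algebra_simps)
  ultimately have "q * (x * a powr (q - 1)) \<le> q * ((1 / q) * x powr q + (1 - 1 / q) * a powr q)"
    using assms by (intro mult_left_mono) auto
  then show ?thesis using assms by (simp add: algebra_simps)
qed (use assms in auto)

text \<open>Jensen's inequality for the measure with density \<open>G\<close> of total mass \<open>T\<close>: integrate the
  tangent inequality at the mean value \<open>a = (\<integral>G F) / T\<close>.\<close>

lemma nn_integral_powr_jensen:
  assumes [measurable]: "G \<in> borel_measurable M" "F \<in> borel_measurable M"
    and q: "1 \<le> q" and T: "(\<integral>\<^sup>+x. G x \<partial>M) = ennreal T" "0 \<le> T"
  shows "ennreal_powr (\<integral>\<^sup>+x. G x * F x \<partial>M) q \<le> ennreal (T powr (q - 1)) * (\<integral>\<^sup>+x. G x * ennreal_powr (F x) q \<partial>M)"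
proof (cases "T = 0")
  case True
  then have "AE x in M. G x = 0" using T by (simp add: nn_integral_0_iff_AE)
  then have "AE x in M. G x * F x = 0" by eventually_elim simp
  then have "(\<integral>\<^sup>+x. G x * F x \<partial>M) = 0" by (simp add: nn_integral_0_iff_AE)
  then show ?thesis by simp
next
  case False
  then have Tp: "0 < T" using T by simp
  let ?I = "\<integral>\<^sup>+x. G x * ennreal_powr (F x) q \<partial>M"
  show ?thesis
  proof (cases "(\<integral>\<^sup>+x. G x * F x \<partial>M)")
    case (real m)
    define a where "a = m / T"
    have a: "0 \<le> a" using real Tp by (simp add: a_def)
    have pt: "ennreal (q * a powr (q - 1)) * F x \<le> ennreal_powr (F x) q + ennreal ((q - 1) * a powr q)" for x
    proof (cases "F x")
      case (real y)
      then show ?thesis using powr_tangent_le[OF a _ q, of y] q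
        by (simp add: ennreal_powr_ennreal ennreal_mult[symmetric] ennreal_plus[symmetric] del: ennreal_plus)
    qed simp
    have "ennreal (q * a powr (q - 1)) * ennreal m = (\<integral>\<^sup>+x. ennreal (q * a powr (q - 1)) * (G x * F x) \<partial>M)"
      by (subst nn_integral_cmult) (simp_all add: real)
    also have "\<dots> \<le> (\<integral>\<^sup>+x. G x * ennreal_powr (F x) q + ennreal ((q - 1) * a powr q) * G x \<partial>M)"
    proof (rule nn_integral_mono)
      fix x
      show "ennreal (q * a powr (q - 1)) * (G x * F x) \<le> G x * ennreal_powr (F x) q + ennreal ((q - 1) * a powr q) * G x"
        using mult_left_mono[OF pt[of x], of "G x"] by (simp add: distrib_left ac_simps)
    qed
    also have "\<dots> = ?I + ennreal ((q - 1) * a powr q) * ennreal T"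
      by (subst nn_integral_add, measurable, subst nn_integral_cmult) (simp_all add: T)
    finally have *: "ennreal (q * a powr (q - 1)) * ennreal m \<le> ?I + ennreal ((q - 1) * a powr q) * ennreal T" .
    show ?thesis
    proof (cases ?I)
      case I: (real J)
      have "q * a powr (q - 1) * m \<le> J + (q - 1) * a powr q * T"
        using * I real a q Tp
        by (simp add: ennreal_mult[symmetric] ennreal_plus[symmetric] del: ennreal_plus)
      moreover
      have "a powr (q - 1) * m = a powr q * T"
      proof (cases "a = 0")
        case False
        then have "a powr q = a powr (q - 1) * a" using a by (metis powr_mult_base mult.commute add.commute diff_add_cancel)
        then show ?thesis using Tp by (simp add: a_def)
      qed (use q Tp in \<open>simp add: a_def\<close>)
      then have "q * a powr (q - 1) * m = q * (a powr q * T)" by (simp only: mult.assoc)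
      ultimately have "a powr q * T \<le> J" by (simp only: left_diff_distrib mult.assoc)
      then have "T powr (q - 1) * (a powr q * T) \<le> T powr (q - 1) * J" by (intro mult_left_mono) auto
      moreover have "T powr (q - 1) * (a powr q * T) = m powr q"
      proof -
        have "T powr (q - 1) * T = T powr q" using Tp by (metis powr_mult_base mult.commute add.commute diff_add_cancel less_imp_le)
        then have "T powr (q - 1) * (a powr q * T) = (a * T) powr q" using a Tp by (simp add: powr_mult mult.left_commute mult.commute)
        then show ?thesis using Tp by (simp add: a_def)
      qed
      ultimately show ?thesis using real I by (simp add: ennreal_powr_ennreal ennreal_mult[symmetric])
    qed (use Tp in \<open>simp add: ennreal_mult_top\<close>)
  next
    case top
    have "F x \<le> 1 + ennreal_powr (F x) q" for x
    proof (cases "F x")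
      case (real y)
      have "y \<le> 1 + y powr q"
      proof (cases "y \<le> 1")
        case False
        then have "y powr 1 \<le> y powr q" using q by (intro powr_mono) auto
        then show ?thesis using False by simp
      qed (simp add: add_increasing2)
      then have "ennreal y \<le> ennreal (1 + y powr q)" by (rule ennreal_leI)
      then show ?thesis using real by (simp add: ennreal_powr_ennreal)
    qed simp
    then have "(\<integral>\<^sup>+x. G x * F x \<partial>M) \<le> (\<integral>\<^sup>+x. G x + G x * ennreal_powr (F x) q \<partial>M)"
      by (intro nn_integral_mono) (metis distrib_left mult.right_neutral mult_left_mono zero_le)
    also have "\<dots> = ennreal T + ?I" by (subst nn_integral_add) (simp_all add: T)
    finally have "?I = \<infinity>" using top by (auto simp: top_unique)
    then show ?thesis using Tp by (simp add: ennreal_mult_top)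
  qed
qed

context haar_matrix_group begin

text \<open>Young's inequality for \<open>L\<^sup>1 * L\<^sup>q\<close> on \<open>H\<close>. In this order of the factors only left
  translations of \<open>F\<close> occur, so left Haar measure suffices.\<close>

lemma convolution_norm_finite:
  assumes G[measurable]: "G \<in> borel_measurable \<mu>" and F[measurable]: "F \<in> borel_measurable \<mu>" and q: "1 \<le> q"
    and fin: "(\<integral>\<^sup>+k. G k \<partial>\<mu>) < \<infinity>" "(\<integral>\<^sup>+h. ennreal_powr (F h) q \<partial>\<mu>) < \<infinity>"
  shows "(\<integral>\<^sup>+h. ennreal_powr (\<integral>\<^sup>+k. G k * F (matrix_inv k ** h) \<partial>\<mu>) q \<partial>\<mu>) < \<infinity>"
proof -
  obtain T where T: "(\<integral>\<^sup>+k. G k \<partial>\<mu>) = ennreal T" "0 \<le> T" using fin(1) by (cases "\<integral>\<^sup>+k. G k \<partial>\<mu>") auto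
  have "(\<integral>\<^sup>+h. ennreal_powr (\<integral>\<^sup>+k. G k * F (matrix_inv k ** h) \<partial>\<mu>) q \<partial>\<mu>)
      \<le> (\<integral>\<^sup>+h. ennreal (T powr (q - 1)) * (\<integral>\<^sup>+k. G k * ennreal_powr (F (matrix_inv k ** h)) q \<partial>\<mu>) \<partial>\<mu>)"
  proof (rule nn_integral_mono)
    fix h assume [measurable]: "h \<in> space \<mu>"
    show "ennreal_powr (\<integral>\<^sup>+k. G k * F (matrix_inv k ** h) \<partial>\<mu>) q \<le> ennreal (T powr (q - 1)) * (\<integral>\<^sup>+k. G k * ennreal_powr (F (matrix_inv k ** h)) q \<partial>\<mu>)"
      by (rule nn_integral_powr_jensen[OF _ _ q T]) measurable
  qed
  also have "\<dots> = ennreal (T powr (q - 1)) * (\<integral>\<^sup>+h. \<integral>\<^sup>+k. G k * ennreal_powr (F (matrix_inv k ** h)) q \<partial>\<mu> \<partial>\<mu>)"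
    by (rule nn_integral_cmult) measurable
  also have "(\<integral>\<^sup>+h. \<integral>\<^sup>+k. G k * ennreal_powr (F (matrix_inv k ** h)) q \<partial>\<mu> \<partial>\<mu>)
      = (\<integral>\<^sup>+k. \<integral>\<^sup>+h. G k * ennreal_powr (F (matrix_inv k ** h)) q \<partial>\<mu> \<partial>\<mu>)"
    by (rule mumu.Fubini') measurable
  also have "\<dots> = (\<integral>\<^sup>+k. G k * (\<integral>\<^sup>+h. ennreal_powr (F h) q \<partial>\<mu>) \<partial>\<mu>)"
  proof (rule nn_integral_cong)
    fix k assume km[measurable]: "k \<in> space \<mu>"
    then have k: "matrix_inv k \<in> H" by (simp add: inv_H)
    have "(\<integral>\<^sup>+h. G k * ennreal_powr (F (matrix_inv k ** h)) q \<partial>\<mu>) = G k * (\<integral>\<^sup>+h. ennreal_powr (F (matrix_inv k ** h)) q \<partial>\<mu>)"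
      by (rule nn_integral_cmult) measurable
    also have "(\<integral>\<^sup>+h. ennreal_powr (F (matrix_inv k ** h)) q \<partial>\<mu>) = (\<integral>\<^sup>+h. ennreal_powr (F h) q \<partial>\<mu>)"
      by (rule nn_integral_left_translation[OF k, of "\<lambda>h. ennreal_powr (F h) q"]) measurable
    finally show "(\<integral>\<^sup>+h. G k * ennreal_powr (F (matrix_inv k ** h)) q \<partial>\<mu>) = G k * (\<integral>\<^sup>+h. ennreal_powr (F h) q \<partial>\<mu>)" .
  qed
  also have "\<dots> = ennreal T * (\<integral>\<^sup>+h. ennreal_powr (F h) q \<partial>\<mu>)"
    by (subst nn_integral_multc) (simp_all add: T)
  finally show ?thesis
    by (rule le_less_trans) (use fin(2) in \<open>simp add: ennreal_mult_less_top\<close>)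
qed

end

section \<open>The orbit function\<close>

lemma aux_A_bounds:
  assumes "0 \<notin> Orb"
  shows "0 \<le> aux_A Orb \<xi>" "aux_A Orb \<xi> \<le> 1"
proof -
  have le: "infdist \<xi> (- Orb) \<le> norm \<xi>"
    using infdist_le[of 0 "- Orb" \<xi>] assms by simp
  have "0 \<le> (norm \<xi>)\<^sup>2 - (infdist \<xi> (- Orb))\<^sup>2"
    using power_mono[OF le infdist_nonneg, of 2] by simp
  then have "0 \<le> infdist \<xi> (- Orb) / (1 + sqrt ((norm \<xi>)\<^sup>2 - (infdist \<xi> (- Orb))\<^sup>2))"
    by (intro divide_nonneg_nonneg infdist_nonneg) simp
  then show "0 \<le> aux_A Orb \<xi>" unfolding aux_A_def by simp
  show "aux_A Orb \<xi> \<le> 1" unfolding aux_A_def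
  proof (rule min.coboundedI2)
    have "1 \<le> 1 + norm \<xi>" by simp
    then show "1 / (1 + norm \<xi>) \<le> 1" by (subst divide_le_eq_1) linarith
  qed
qed

lemma borel_measurable_aux_A[measurable]: "aux_A Orb \<in> borel_measurable borel"
proof -
  have [measurable]: "(\<lambda>\<xi>. infdist \<xi> (- Orb)) \<in> borel_measurable borel"
    by (intro borel_measurable_continuous_onI continuous_on_infdist continuous_on_id)
  show ?thesis unfolding aux_A_def by measurable
qed

lemma powr_one_plus_mult_le:
  fixes a b x y e :: real
  assumes "0 \<le> e" "0 \<le> x" "0 \<le> y" "z \<le> x * y" "0 \<le> z"
  shows "(1 + z) powr e \<le> (1 + x) powr e * (1 + y) powr e"
proof -
  have "1 + z \<le> (1 + x) * (1 + y)" using assms by (simp add: algebra_simps)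
  then have "(1 + z) powr e \<le> ((1 + x) * (1 + y)) powr e" using assms by (intro powr_mono2) auto
  then show ?thesis using assms by (simp add: powr_mult)
qed

context open_orbit begin

text \<open>With \<open>orbit_integral_le\<close> and \<open>h = k m\<close>, the weighted cross integral is at most a
  constant times the convolution of \<open>G\<close>, the function in \<open>T2\<close>, with \<open>F\<close>, the function in
  \<open>T1\<close>. The factor \<open>1 / |det k|\<close> lowers the exponent \<open>1/2 - 1/q\<close> of \<open>|det k|\<close> to
  \<open>-1/2 - 1/q\<close>.\<close>

theorem temperate_cross_integral_finite:
  assumes q: "1 \<le> q" and e: "0 \<le> e" and w: "weight_on H (**) w"
    and T1: "(\<lambda>h. \<bar>det h\<bar> powr (1 / 2 - 1 / q) * (1 + norm h) powr e * w h * aux_A Orb (transpose h *v \<xi>0) ^ l) \<in> Lp_space \<mu> (ennreal q)"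
    and T2: "(\<lambda>h. \<bar>det h\<bar> powr (- 1 / 2 - 1 / q) * (1 + norm h) powr e * w h * aux_A Orb (transpose (matrix_inv h) *v \<xi>0) ^ l) \<in> Lp_space \<mu> 1"
  shows "(\<integral>\<^sup>+h. ennreal_powr (ennreal (\<bar>det h\<bar> powr (1 / 2 - 1 / q) * (1 + norm h) powr e * w h) *
     (\<integral>\<^sup>+\<xi>. ennreal (aux_A Orb \<xi> ^ l * aux_A Orb (transpose h *v \<xi>) ^ l) * indicator Orb \<xi> \<partial>lborel)) q \<partial>\<mu>) < \<infinity>"
proof -
  note A0 = aux_A_bounds(1)[OF zero_notin_Orb]
  define W where "W h = \<bar>det h\<bar> powr (1 / 2 - 1 / q) * (1 + norm h) powr e * w h" for h :: "real ^ 'n ^ 'n"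
  define F where "F h = ennreal (W h * aux_A Orb (transpose h *v \<xi>0) ^ l)" for h
  define G where "G h = ennreal (\<bar>det h\<bar> powr (- 1 / 2 - 1 / q) * (1 + norm h) powr e * w h * aux_A Orb (transpose (matrix_inv h) *v \<xi>0) ^ l)" for h
  define A2 where "A2 h \<xi> = ennreal (aux_A Orb \<xi> ^ l * aux_A Orb (transpose h *v \<xi>) ^ l)" for h \<xi>
  have w0: "0 < w h" and wm: "k \<in> H \<Longrightarrow> w (h ** k) \<le> w h * w k" if "h \<in> H" for h k
    using w that unfolding weight_on_def by auto
  have wmeas[measurable]: "w \<in> borel_measurable \<mu>"
    using w unfolding weight_on_def by (intro borel_measurable_mu) auto
  have W0: "0 \<le> W h" if "h \<in> H" for h using w0[OF that] by (simp add: W_def)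
  have [measurable]: "W \<in> borel_measurable \<mu>" unfolding W_def by measurable
  have Fm[measurable]: "F \<in> borel_measurable \<mu>" and Gm[measurable]: "G \<in> borel_measurable \<mu>"
    unfolding F_def G_def by (measurable; simp)+
  have "Lp_norm \<mu> (ennreal q) F < \<infinity>"
  proof -
    have "Lp_norm \<mu> (ennreal q) F = Lp_norm \<mu> (ennreal q) (\<lambda>h. ennreal (norm (\<bar>det h\<bar> powr (1 / 2 - 1 / q) * (1 + norm h) powr e * w h * aux_A Orb (transpose h *v \<xi>0) ^ l)))"
      unfolding Lp_norm_def using q by (auto intro!: arg_cong2[where f=ennreal_powr] nn_integral_cong simp: F_def W_def W0 w0 A0 abs_mult less_imp_le)
    then show ?thesis using T1 unfolding Lp_space_def by simp
  qed
  then have Ffin: "(\<integral>\<^sup>+h. ennreal_powr (F h) q \<partial>\<mu>) < \<infinity>" using q by (simp add: Lp_norm_def)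
  have "Lp_norm \<mu> 1 G < \<infinity>"
  proof -
    have "Lp_norm \<mu> 1 G = Lp_norm \<mu> 1 (\<lambda>h. ennreal (norm (\<bar>det h\<bar> powr (- 1 / 2 - 1 / q) * (1 + norm h) powr e * w h * aux_A Orb (transpose (matrix_inv h) *v \<xi>0) ^ l)))"
      unfolding Lp_norm_def by (auto intro!: arg_cong2[where f=ennreal_powr] nn_integral_cong simp: G_def w0 A0 abs_mult less_imp_le)
    then show ?thesis using T2 unfolding Lp_space_def by simp
  qed
  then have "(\<integral>\<^sup>+h. ennreal_powr (G h) 1 \<partial>\<mu>) < \<infinity>" by (simp add: Lp_norm_def)
  moreover have "ennreal_powr (G h) 1 = G h" if "h \<in> H" for h
    using w0[OF that] A0 unfolding G_def by (subst ennreal_powr_ennreal) auto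
  ultimately have Gfin: "(\<integral>\<^sup>+h. G h \<partial>\<mu>) < \<infinity>" by (simp cong: nn_integral_cong_simp)
  obtain C where C: "C > 0" and orb: "\<And>F. F \<in> borel_measurable borel \<Longrightarrow> (\<integral>\<^sup>+\<eta>. F \<eta> * indicator Orb \<eta> \<partial>lborel) \<le> ennreal C * pullback F \<xi>0"
    using orbit_integral_le by blast
  have le: "ennreal (W h) * (\<integral>\<^sup>+\<xi>. A2 h \<xi> * indicator Orb \<xi> \<partial>lborel) \<le> ennreal C * (\<integral>\<^sup>+k. G k * F (matrix_inv k ** h) \<partial>\<mu>)"
    if h: "h \<in> H" for h
  proof -
    have hm[measurable]: "h \<in> space \<mu>" using h by simp
    have A2m[measurable]: "A2 h \<in> borel_measurable borel" unfolding A2_def by measurable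
    have "ennreal (W h) * (\<integral>\<^sup>+\<xi>. A2 h \<xi> * indicator Orb \<xi> \<partial>lborel) \<le> ennreal (W h) * (ennreal C * pullback (A2 h) \<xi>0)"
      by (intro mult_left_mono orb) measurable
    also have "\<dots> = ennreal C * (ennreal (W h) * pullback (A2 h) \<xi>0)" by (simp add: ac_simps)
    also have "ennreal (W h) * pullback (A2 h) \<xi>0 = (\<integral>\<^sup>+k. ennreal (W h) * (A2 h (transpose (matrix_inv k) *v \<xi>0) * ennreal (1 / \<bar>det k\<bar>)) \<partial>\<mu>)"
      unfolding pullback_def by (rule nn_integral_cmult[symmetric]) measurable
    also have "\<dots> \<le> (\<integral>\<^sup>+k. G k * F (matrix_inv k ** h) \<partial>\<mu>)"
    proof (rule nn_integral_mono)
      fix k assume "k \<in> space \<mu>"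
      then have k: "k \<in> H" by simp
      let ?m = "matrix_inv k ** h"
      have m: "?m \<in> H" using h k by (simp add: mult_H inv_H)
      have hkm: "h = k ** ?m" using matrix_inv_mult(1)[OF invertible_H[OF k]] by (simp add: matrix_mul_assoc)
      have dk: "\<bar>det k\<bar> > 0" and dm: "\<bar>det ?m\<bar> > 0"
        using invertible_H[OF k] invertible_H[OF m] by (simp_all add: invertible_det_nz)
      have d: "\<bar>det h\<bar> = \<bar>det k\<bar> * \<bar>det ?m\<bar>" by (subst hkm) (simp only: det_mul abs_mult)
      have nh: "norm h \<le> norm k * norm ?m" by (subst hkm) (rule norm_matrix_mult_le)
      have wh: "w h \<le> w k * w ?m" by (subst hkm) (rule wm[OF k m])
      have "\<bar>det h\<bar> powr (1 / 2 - 1 / q) = \<bar>det k\<bar> powr (1 / 2 - 1 / q) * \<bar>det ?m\<bar> powr (1 / 2 - 1 / q)"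
        unfolding d using dk dm by (simp add: powr_mult)
      moreover have "(1 + norm h) powr e \<le> (1 + norm k) powr e * (1 + norm ?m) powr e"
        using e nh by (intro powr_one_plus_mult_le) auto
      ultimately have "W h \<le> (\<bar>det k\<bar> powr (1 / 2 - 1 / q) * \<bar>det ?m\<bar> powr (1 / 2 - 1 / q)) * ((1 + norm k) powr e * (1 + norm ?m) powr e) * (w k * w ?m)"
        unfolding W_def using wh w0[OF h] by (intro mult_mono) auto
      then have Wle: "W h \<le> W k * W ?m" by (simp add: W_def ac_simps)
      have pw: "\<bar>det k\<bar> powr (1 / 2 - 1 / q) * (1 / \<bar>det k\<bar>) = \<bar>det k\<bar> powr (- 1 / 2 - 1 / q)"
      proof -
        have "\<bar>det k\<bar> powr (1 / 2 - 1 / q) / \<bar>det k\<bar> powr 1 = \<bar>det k\<bar> powr (1 / 2 - 1 / q - 1)"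
          by (rule powr_diff[symmetric])
        moreover have "1 / 2 - 1 / q - 1 = - 1 / 2 - 1 / q" by simp
        ultimately show ?thesis using dk by simp
      qed
      let ?a = "aux_A Orb (transpose (matrix_inv k) *v \<xi>0) ^ l" and ?b = "aux_A Orb (transpose ?m *v \<xi>0) ^ l"
      have ab: "0 \<le> ?a" "0 \<le> ?b" using A0 by auto
      have "W h * (?a * ?b * (1 / \<bar>det k\<bar>)) \<le> W k * W ?m * (?a * ?b * (1 / \<bar>det k\<bar>))"
        using Wle ab by (intro mult_right_mono) auto
      also have "\<dots> = (\<bar>det k\<bar> powr (1 / 2 - 1 / q) * (1 / \<bar>det k\<bar>)) * (1 + norm k) powr e * w k * ?a * (W ?m * ?b)"
        by (simp add: W_def ac_simps)
      finally have "W h * (?a * ?b * (1 / \<bar>det k\<bar>)) \<le> (\<bar>det k\<bar> powr (- 1 / 2 - 1 / q) * (1 + norm k) powr e * w k * ?a) * (W ?m * ?b)"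
        unfolding pw .
      then have "ennreal (W h * (?a * ?b * (1 / \<bar>det k\<bar>))) \<le> G k * F ?m"
        using ab w0[OF k] W0[OF m] unfolding G_def F_def by (subst ennreal_mult[symmetric]) (auto intro!: ennreal_leI)
      moreover have "transpose h *v (transpose (matrix_inv k) *v \<xi>0) = transpose ?m *v \<xi>0"
        by (simp add: transpose_mult_vector)
      ultimately show "ennreal (W h) * (A2 h (transpose (matrix_inv k) *v \<xi>0) * ennreal (1 / \<bar>det k\<bar>)) \<le> G k * F (matrix_inv k ** h)"
        using ab W0[OF h] by (simp add: A2_def ennreal_mult[symmetric])
    qed
    finally show ?thesis by (simp add: mult_left_mono)
  qed
  have "(\<integral>\<^sup>+h. ennreal_powr (ennreal (W h) * (\<integral>\<^sup>+\<xi>. A2 h \<xi> * indicator Orb \<xi> \<partial>lborel)) q \<partial>\<mu>)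
     \<le> (\<integral>\<^sup>+h. ennreal (C powr q) * ennreal_powr (\<integral>\<^sup>+k. G k * F (matrix_inv k ** h) \<partial>\<mu>) q \<partial>\<mu>)"
  proof (rule nn_integral_mono)
    fix h assume "h \<in> space \<mu>"
    then have "ennreal_powr (ennreal (W h) * (\<integral>\<^sup>+\<xi>. A2 h \<xi> * indicator Orb \<xi> \<partial>lborel)) q \<le> ennreal_powr (ennreal C * (\<integral>\<^sup>+k. G k * F (matrix_inv k ** h) \<partial>\<mu>)) q"
      using q by (intro ennreal_powr_mono le) auto
    then show "ennreal_powr (ennreal (W h) * (\<integral>\<^sup>+\<xi>. A2 h \<xi> * indicator Orb \<xi> \<partial>lborel)) q \<le> ennreal (C powr q) * ennreal_powr (\<integral>\<^sup>+k. G k * F (matrix_inv k ** h) \<partial>\<mu>) q"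
      by (simp add: ennreal_powr_cmult[OF C])
  qed
  also have "\<dots> = ennreal (C powr q) * (\<integral>\<^sup>+h. ennreal_powr (\<integral>\<^sup>+k. G k * F (matrix_inv k ** h) \<partial>\<mu>) q \<partial>\<mu>)"
    by (rule nn_integral_cmult) measurable
  also have "\<dots> < \<infinity>"
    using convolution_norm_finite[OF Gm Fm q Gfin Ffin] by (simp add: ennreal_mult_less_top)
  finally show ?thesis unfolding W_def A2_def .
qed

end

section \<open>Fourier inversion\<close>

definition fourier_char :: "real \<Rightarrow> complex" where
  "fourier_char t = exp (2 * of_real pi * \<i> * of_real t)"

lemma norm_fourier_char[simp]: "norm (fourier_char t) = 1"
proof -
  have "fourier_char t = cis (2 * pi * t)"
    unfolding fourier_char_def cis_conv_exp by (simp add: mult.commute mult.left_commute)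
  then show ?thesis by simp
qed

lemma fourier_char_add: "fourier_char (s + t) = fourier_char s * fourier_char t"
  by (simp add: fourier_char_def exp_add[symmetric] distrib_left)

lemma fourier_char_0[simp]: "fourier_char 0 = 1"
  by (simp add: fourier_char_def)

lemma fourier_char_sum: "finite I \<Longrightarrow> fourier_char (sum f I) = (\<Prod>i\<in>I. fourier_char (f i))"
  by (induction I rule: finite_induct) (simp_all add: fourier_char_add)

lemma cnj_fourier_char: "cnj (fourier_char t) = fourier_char (- t)"
  by (simp add: fourier_char_def exp_cnj)

lemma continuous_on_fourier_char[continuous_intros]:
  "continuous_on S f \<Longrightarrow> continuous_on S (\<lambda>x. fourier_char (f x))"
  unfolding fourier_char_def by (intro continuous_intros)

lemma measurable_fourier_char[measurable]: "fourier_char \<in> borel_measurable borel"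
  by (intro borel_measurable_continuous_onI continuous_intros)

lemma fourier_eq: "fourier f \<xi> = (LINT x|lborel. f x * fourier_char (- (x \<bullet> \<xi>)))"
  unfolding fourier_def fourier_char_def by simp

lemma lborel_integral_affine:
  fixes F :: "'a::euclidean_space \<Rightarrow> complex"
  assumes [measurable]: "F \<in> borel_measurable borel" and c: "c \<noteq> 0"
  shows "(LINT x|lborel. F x) = complex_of_real (\<bar>c\<bar> ^ DIM('a)) * (LINT x|lborel. F (t + c *\<^sub>R x))"
proof -
  have "(LINT x|density (distr lborel borel (\<lambda>x. t + c *\<^sub>R x)) (\<lambda>_. ennreal (\<bar>c\<bar> ^ DIM('a))). F x) = complex_of_real (\<bar>c\<bar> ^ DIM('a)) * (LINT x|lborel. F (t + c *\<^sub>R x))"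
    by (simp add: integral_density integral_distr scaleR_conv_of_real)
  moreover have "lborel = density (distr lborel borel (\<lambda>x. t + c *\<^sub>R x)) (\<lambda>_. ennreal (\<bar>c\<bar> ^ DIM('a)))"
    using lborel_affine[OF c, of t] by (simp add: ennreal_power)
  ultimately show ?thesis by simp
qed

lemma lborel_nn_integral_affine:
  fixes F :: "'a::euclidean_space \<Rightarrow> ennreal"
  assumes [measurable]: "F \<in> borel_measurable borel" and c: "c \<noteq> 0"
  shows "(\<integral>\<^sup>+x. F x \<partial>lborel) = ennreal (\<bar>c\<bar> ^ DIM('a)) * (\<integral>\<^sup>+x. F (t + c *\<^sub>R x) \<partial>lborel)"
proof -
  have "(\<integral>\<^sup>+x. F x \<partial>density (distr lborel borel (\<lambda>x. t + c *\<^sub>R x)) (\<lambda>_. ennreal (\<bar>c\<bar> ^ DIM('a)))) = ennreal (\<bar>c\<bar> ^ DIM('a)) * (\<integral>\<^sup>+x. F (t + c *\<^sub>R x) \<partial>lborel)"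
    by (simp add: nn_integral_density nn_integral_distr nn_integral_cmult)
  moreover have "lborel = density (distr lborel borel (\<lambda>x. t + c *\<^sub>R x)) (\<lambda>_. ennreal (\<bar>c\<bar> ^ DIM('a)))"
    using lborel_affine[OF c, of t] by (simp add: ennreal_power)
  ultimately show ?thesis by simp
qed

lemma integrable_lborel_affine:
  fixes F :: "'a::euclidean_space \<Rightarrow> 'b::{banach, second_countable_topology}"
  assumes F: "integrable lborel F" and c: "c \<noteq> 0"
  shows "integrable lborel (\<lambda>x. F (t + c *\<^sub>R x))"
proof (rule integrableI_bounded)
  have [measurable]: "F \<in> borel_measurable borel" using F by (simp add: integrable_iff_bounded)
  show "(\<lambda>x. F (t + c *\<^sub>R x)) \<in> borel_measurable lborel" by measurable
  have "ennreal (\<bar>c\<bar> ^ DIM('a)) * (\<integral>\<^sup>+x. ennreal (norm (F (t + c *\<^sub>R x))) \<partial>lborel) < \<infinity>"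
    using F c by (subst lborel_nn_integral_affine[symmetric]) (auto simp: integrable_iff_bounded)
  then show "(\<integral>\<^sup>+x. ennreal (norm (F (t + c *\<^sub>R x))) \<partial>lborel) < \<infinity>"
    using c by (auto simp: ennreal_mult_less_top)
qed

lemma integrable_pair_bounded_kernel:
  fixes f g :: "_ \<Rightarrow> complex"
  assumes f: "integrable lborel f" and g: "integrable lborel g"
    and [measurable]: "(\<lambda>(x, y). K x y) \<in> borel_measurable (lborel \<Otimes>\<^sub>M lborel)"
    and bd: "\<And>x y. norm (K x y :: complex) \<le> C"
  shows "integrable (lborel \<Otimes>\<^sub>M lborel) (\<lambda>(x, y). f x * g y * K x y)"
proof (rule integrableI_bounded)
  have [measurable]: "f \<in> borel_measurable borel" "g \<in> borel_measurable borel"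
    using f g by (simp_all add: integrable_iff_bounded)
  show "(\<lambda>(x, y). f x * g y * K x y) \<in> borel_measurable (lborel \<Otimes>\<^sub>M lborel)" by measurable
  have C: "0 \<le> C" using order_trans[OF norm_ge_zero bd] .
  have "(\<integral>\<^sup>+p. ennreal (norm (case p of (x, y) \<Rightarrow> f x * g y * K x y)) \<partial>(lborel \<Otimes>\<^sub>M lborel))
     \<le> (\<integral>\<^sup>+p. (case p of (x, y) \<Rightarrow> ennreal C * (ennreal (norm (f x)) * ennreal (norm (g y)))) \<partial>(lborel \<Otimes>\<^sub>M lborel))"
  proof (rule nn_integral_mono, clarify)
    fix x y
    have "norm (f x) * norm (g y) * norm (K x y) \<le> norm (f x) * norm (g y) * C"
      by (intro mult_left_mono bd) simp
    then show "ennreal (norm (f x * g y * K x y)) \<le> ennreal C * (ennreal (norm (f x)) * ennreal (norm (g y)))"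
      using C by (simp add: norm_mult ennreal_mult[symmetric] mult.commute)
  qed
  also have "\<dots> = (\<integral>\<^sup>+x. \<integral>\<^sup>+y. ennreal C * (ennreal (norm (f x)) * ennreal (norm (g y))) \<partial>lborel \<partial>lborel)"
    by (subst lborel.nn_integral_fst[symmetric]) simp_all
  also have "\<dots> = ennreal C * ((\<integral>\<^sup>+x. ennreal (norm (f x)) \<partial>lborel) * (\<integral>\<^sup>+y. ennreal (norm (g y)) \<partial>lborel))"
    by (simp add: nn_integral_cmult nn_integral_multc)
  also have "\<dots> < \<infinity>"
    using f g by (simp add: integrable_iff_bounded ennreal_mult_less_top)
  finally show "(\<integral>\<^sup>+p. ennreal (norm (case p of (x, y) \<Rightarrow> f x * g y * K x y)) \<partial>(lborel \<Otimes>\<^sub>M lborel)) < \<infinity>" .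
qed

definition gauss :: "real ^ 'n::finite \<Rightarrow> real" where
  "gauss z = (\<Prod>i\<in>UNIV. std_normal_density (z $ i))"

lemma continuous_on_gauss: "continuous_on S f \<Longrightarrow> continuous_on S (\<lambda>x. gauss (f x))"
  unfolding gauss_def std_normal_density_def by (intro continuous_intros continuous_on_component) auto

lemma measurable_gauss[measurable]: "gauss \<in> borel_measurable borel"
  by (intro borel_measurable_continuous_onI continuous_on_gauss continuous_intros)

lemma gauss_pos: "0 < gauss z"
  unfolding gauss_def by (intro prod_pos) (auto intro: normal_density_pos)

lemma gauss_nonneg[simp]: "0 \<le> gauss z"
  by (rule less_imp_le[OF gauss_pos])

lemma gauss_zero: "gauss (0 :: real ^ 'n::finite) = 1 / sqrt (2 * pi) ^ CARD('n)"
  by (simp add: gauss_def std_normal_density_def power_divide)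

lemma gauss_le: "gauss z \<le> gauss (0 :: real ^ 'n)" for z :: "real ^ 'n::finite"
proof -
  have "std_normal_density y \<le> std_normal_density 0" for y
    by (simp add: std_normal_density_def divide_right_mono)
  then have "(\<Prod>i\<in>UNIV. std_normal_density (z $ i)) \<le> (\<Prod>i\<in>(UNIV :: 'n set). std_normal_density 0)"
    by (intro prod_mono) (auto simp: normal_density_nonneg)
  then show ?thesis by (simp add: gauss_def)
qed

lemma integrable_gauss: "integrable lborel (gauss :: real ^ 'n::finite \<Rightarrow> real)"
proof -
  have "integrable lborel (\<lambda>z :: real ^ 'n. \<Prod>i\<in>UNIV. complex_of_real (std_normal_density (z $ i)))"
    by (rule lebesgue_integral_lborel_vec_prod(2)) (auto intro!: integrable_of_real)
  then have "integrable lborel (\<lambda>z :: real ^ 'n. complex_of_real (gauss z))" by (simp add: gauss_def)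
  from integrable_Re[OF this] show ?thesis by simp
qed

text \<open>The Gaussian is its own Fourier transform up to scaling; in each coordinate this is
  the characteristic function of the normal distribution.\<close>

lemma integral_gauss_fourier_char:
  fixes s :: "real ^ 'n::finite"
  shows "(LINT z|lborel. gauss z * fourier_char (z \<bullet> s)) = complex_of_real (sqrt (2 * pi) ^ CARD('n) * gauss ((2 * pi) *\<^sub>R s))"
proof -
  have one: "(LINT y|lborel. std_normal_density y * fourier_char (y * a)) = sqrt (2 * pi) * std_normal_density (2 * pi * a)" for a
  proof -
    have "char std_normal_distribution (2 * pi * a) = (LINT y|lborel. std_normal_density y *\<^sub>R iexp (2 * pi * a * y))"
      unfolding char_def by (rule integral_density) (auto simp: normal_density_nonneg)
    also have "\<dots> = (LINT y|lborel. std_normal_density y * fourier_char (y * a))"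
      by (intro Bochner_Integration.integral_cong) (auto simp: fourier_char_def scaleR_conv_of_real ac_simps)
    finally have "(LINT y|lborel. std_normal_density y * fourier_char (y * a)) = complex_of_real (exp (- ((2 * pi * a)\<^sup>2) / 2))"
      by (simp only: char_std_normal_distribution)
    moreover have "sqrt (2 * pi) * std_normal_density (2 * pi * a) = exp (- ((2 * pi * a)\<^sup>2) / 2)"
      by (simp add: std_normal_density_def)
    ultimately show ?thesis by simp
  qed
  have int: "integrable lborel (\<lambda>y. std_normal_density y * fourier_char (y * a))" for a
  proof (rule Bochner_Integration.integrable_bound[of _ "std_normal_density"])
    show "(\<lambda>y. complex_of_real (std_normal_density y) * fourier_char (y * a)) \<in> borel_measurable lborel" by measurable
  qed (auto simp: norm_mult)
  have "(LINT z|lborel. gauss z * fourier_char (z \<bullet> s)) = (LINT z|lborel. (\<Prod>i\<in>UNIV. std_normal_density (z $ i) * fourier_char (z $ i * s $ i)))"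
    by (intro Bochner_Integration.integral_cong) (simp_all add: gauss_def inner_vec_def fourier_char_sum prod.distrib)
  also have "\<dots> = (\<Prod>i\<in>UNIV. complex_of_real (sqrt (2 * pi) * std_normal_density (2 * pi * s $ i)))"
    by (subst lebesgue_integral_lborel_vec_prod(1)) (simp_all only: int one)
  also have "\<dots> = complex_of_real (sqrt (2 * pi) ^ CARD('n) * gauss ((2 * pi) *\<^sub>R s))"
    by (simp add: gauss_def prod.distrib)
  finally show ?thesis .
qed

lemma integral_gauss: "(LINT z|lborel. gauss (z :: real ^ 'n::finite)) = 1"
proof -
  have "complex_of_real (LINT z|lborel. gauss (z :: real ^ 'n)) = (LINT z|lborel. gauss z * fourier_char (z \<bullet> (0 :: real ^ 'n)))"
    by simp
  also have "\<dots> = 1" unfolding integral_gauss_fourier_char by (simp add: gauss_zero)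
  finally show ?thesis by (simp only: of_real_eq_1_iff)
qed

text \<open>Boxes form a generator of the Borel sets that is stable under intersection, so all
  Borel integrals vanish by Dynkin's lemma.\<close>

lemma AE_zero_of_box_integrals:
  fixes f :: "'a::euclidean_space \<Rightarrow> complex"
  assumes f: "integrable lborel f" and box: "\<And>a b. (LINT x:box a b|lborel. f x) = 0"
  shows "AE x in lborel. f x = 0"
proof (rule sigma_finite_measure.density_zero[OF lborel.sigma_finite_measure_axioms f])
  have si: "set_integrable lborel A f" if "A \<in> sets borel" for A
    unfolding set_integrable_def using that f by (intro integrable_mult_indicator) auto
  have tot: "(LINT x|lborel. f x) = 0"
  proof -
    let ?B = "\<lambda>n::nat. box (- (real n *\<^sub>R One)) (real n *\<^sub>R One) :: 'a set"
    have "(\<lambda>n. LINT x|lborel. indicator (?B n) x *\<^sub>R f x) \<longlonglongrightarrow> (LINT x|lborel. f x)"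
    proof (rule integral_dominated_convergence[where w="\<lambda>x. norm (f x)"])
      show "AE x in lborel. (\<lambda>n. indicator (?B n) x *\<^sub>R f x) \<longlonglongrightarrow> f x"
      proof (intro AE_I2 tendsto_eventually)
        fix x :: 'a
        obtain N where N: "norm x < real N" using reals_Archimedean2 by blast
        have "x \<in> ?B n" if "n \<ge> N" for n
        proof -
          have "\<bar>x \<bullet> i\<bar> < real n" if "i \<in> Basis" for i
            using Basis_le_norm[OF that, of x] N \<open>n \<ge> N\<close> by linarith
          then show ?thesis unfolding mem_box by (auto simp: abs_less_iff minus_less_iff)
        qed
        then show "\<forall>\<^sub>F n in sequentially. indicator (?B n) x *\<^sub>R f x = f x"
          unfolding eventually_sequentially by (intro exI[of _ N]) simp
      qed
    qed (use f in \<open>auto simp: indicator_def\<close>)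
    moreover have "(LINT x|lborel. indicator (?B n) x *\<^sub>R f x) = 0" for n
      using box unfolding set_lebesgue_integral_def by blast
    ultimately show ?thesis by (simp add: LIMSEQ_const_iff)
  qed
  fix A :: "'a set" assume "A \<in> sets lborel"
  then have A: "A \<in> sigma_sets UNIV (range (\<lambda>(a, b). box a b :: 'a set))"
    by (simp add: borel_eq_box)
  have rb: "box p q \<in> range (\<lambda>(a, b). box a b :: 'a set)" for p q
    by (rule image_eqI[of _ _ "(p, q)"]) simp_all
  have stable: "Int_stable (range (\<lambda>(a, b). box a b :: 'a set))"
  proof (rule Int_stableI)
    fix X Y assume "X \<in> range (\<lambda>(a, b). box a b :: 'a set)" "Y \<in> range (\<lambda>(a, b). box a b :: 'a set)"
    then obtain a b c d where "X = box a b" "Y = box c d" by auto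
    then show "X \<inter> Y \<in> range (\<lambda>(a, b). box a b :: 'a set)"
      by (simp only: box_Int_box rb)
  qed
  have pow: "range (\<lambda>(a, b). box a b :: 'a set) \<subseteq> Pow UNIV" by simp
  from stable pow A show "(LINT x:A|lborel. f x) = 0"
  proof (induction rule: sigma_sets_induct_disjoint)
    case (compl A)
    then have A: "A \<in> sets borel" by (simp add: borel_eq_box)
    have "(LINT x:A \<union> (UNIV - A)|lborel. f x) = (LINT x|lborel. f x)"
      by (simp add: set_lebesgue_integral_def)
    moreover have "(LINT x:A \<union> (UNIV - A)|lborel. f x) = (LINT x:A|lborel. f x) + (LINT x:UNIV - A|lborel. f x)"
      by (rule set_integral_Un) (use A si in auto)
    ultimately show ?case using compl tot by simp
  next
    case (union A)
    then have A: "A i \<in> sets borel" for i by (auto simp: borel_eq_box)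
    have "(LINT x:(\<Union>i. A i)|lborel. f x) = (\<Sum>i. LINT x:A i|lborel. f x)"
      by (rule lebesgue_integral_countable_add) (use A si union in \<open>auto simp: disjoint_family_on_def\<close>)
    then show ?case using union by simp
  qed (use box in \<open>auto simp: set_lebesgue_integral_def\<close>)
qed

text \<open>Damping the inversion integral with a Gaussian makes Fubini applicable and turns it
  into the convolution of \<open>W\<close> with a Gaussian of width \<open>1 / (2\<pi> n)\<close>.\<close>

lemma fourier_gauss_regularized:
  fixes W :: "real ^ 'n::finite \<Rightarrow> complex"
  assumes W: "integrable lborel W" and n: "0 < n"
  shows "(LINT \<xi>|lborel. fourier W \<xi> * complex_of_real (sqrt (2 * pi) ^ CARD('n) * gauss ((1 / n) *\<^sub>R \<xi>)) * fourier_char (x \<bullet> \<xi>))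
     = (LINT y|lborel. W y * complex_of_real ((2 * pi * n) ^ CARD('n) * gauss ((2 * pi * n) *\<^sub>R (x - y))))"
proof -
  have [measurable]: "W \<in> borel_measurable borel" using W by (simp add: integrable_iff_bounded)
  define M where "M \<xi> = complex_of_real (sqrt (2 * pi) ^ CARD('n) * gauss ((1 / n) *\<^sub>R \<xi>))" for \<xi> :: "real ^ 'n"
  have [measurable]: "M \<in> borel_measurable borel" unfolding M_def by measurable
  have Mint: "integrable lborel M"
  proof -
    have "integrable lborel (\<lambda>\<xi>. gauss (0 + (1 / n) *\<^sub>R \<xi>))"
      using n by (intro integrable_lborel_affine integrable_gauss) simp
    then show ?thesis unfolding M_def by (intro integrable_of_real integrable_mult_right) simp
  qed
  have kernel: "(LINT \<xi>|lborel. M \<xi> * fourier_char (z \<bullet> \<xi>)) = complex_of_real ((2 * pi * n) ^ CARD('n) * gauss ((2 * pi * n) *\<^sub>R z))" for z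
  proof -
    have "(LINT \<xi>|lborel. M \<xi> * fourier_char (z \<bullet> \<xi>)) = complex_of_real (\<bar>n\<bar> ^ CARD('n)) * (LINT \<zeta>|lborel. M (0 + n *\<^sub>R \<zeta>) * fourier_char (z \<bullet> (0 + n *\<^sub>R \<zeta>)))"
      using n by (subst lborel_integral_affine[where c=n and t=0]) auto
    also have "(LINT \<zeta>|lborel. M (0 + n *\<^sub>R \<zeta>) * fourier_char (z \<bullet> (0 + n *\<^sub>R \<zeta>))) = (LINT \<zeta>|lborel. complex_of_real (sqrt (2 * pi) ^ CARD('n)) * (gauss \<zeta> * fourier_char (\<zeta> \<bullet> (n *\<^sub>R z))))"
      using n by (intro Bochner_Integration.integral_cong) (auto simp: M_def inner_commute)
    also have "\<dots> = complex_of_real (sqrt (2 * pi) ^ CARD('n)) * complex_of_real (sqrt (2 * pi) ^ CARD('n) * gauss ((2 * pi) *\<^sub>R (n *\<^sub>R z)))"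
      by (simp only: integral_mult_right_zero integral_gauss_fourier_char)
    also have "complex_of_real (\<bar>n\<bar> ^ CARD('n)) * (complex_of_real (sqrt (2 * pi) ^ CARD('n)) * complex_of_real (sqrt (2 * pi) ^ CARD('n) * gauss ((2 * pi) *\<^sub>R (n *\<^sub>R z))))
        = complex_of_real ((2 * pi * n) ^ CARD('n) * gauss ((2 * pi * n) *\<^sub>R z))"
    proof -
      have "sqrt (2 * pi) ^ CARD('n) * sqrt (2 * pi) ^ CARD('n) = (2 * pi) ^ CARD('n)"
        unfolding power_mult_distrib[symmetric] by simp
      then have "\<bar>n\<bar> ^ CARD('n) * (sqrt (2 * pi) ^ CARD('n) * (sqrt (2 * pi) ^ CARD('n) * g)) = (2 * pi * n) ^ CARD('n) * g" for g
        using n by (simp add: power_mult_distrib mult.assoc[symmetric])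
      then show ?thesis by (simp only: of_real_mult[symmetric] scaleR_scaleR)
    qed
    finally show ?thesis by simp
  qed
  have pm: "(\<lambda>(\<xi>, y). fourier_char ((x - y) \<bullet> \<xi>)) \<in> borel_measurable (lborel \<Otimes>\<^sub>M lborel)" by measurable
  have int: "integrable (lborel \<Otimes>\<^sub>M lborel) (\<lambda>(\<xi>, y). M \<xi> * W y * fourier_char ((x - y) \<bullet> \<xi>))"
    by (rule integrable_pair_bounded_kernel[OF Mint W pm, of 1]) simp
  have "(LINT \<xi>|lborel. fourier W \<xi> * M \<xi> * fourier_char (x \<bullet> \<xi>)) = (LINT \<xi>|lborel. LINT y|lborel. M \<xi> * W y * fourier_char ((x - y) \<bullet> \<xi>))"
  proof (intro Bochner_Integration.integral_cong refl)
    fix \<xi>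
    have "fourier W \<xi> * M \<xi> * fourier_char (x \<bullet> \<xi>) = (LINT y|lborel. (M \<xi> * fourier_char (x \<bullet> \<xi>)) * (W y * fourier_char (- (y \<bullet> \<xi>))))"
      unfolding integral_mult_right_zero fourier_eq[symmetric] by (simp only: mult.assoc mult.commute mult.left_commute)
    also have "\<dots> = (LINT y|lborel. M \<xi> * W y * fourier_char ((x - y) \<bullet> \<xi>))"
      by (intro Bochner_Integration.integral_cong refl) (simp add: inner_diff_left fourier_char_add[of "x \<bullet> \<xi>" "- (_ \<bullet> \<xi>)", simplified] ac_simps)
    finally show "fourier W \<xi> * M \<xi> * fourier_char (x \<bullet> \<xi>) = (LINT y|lborel. M \<xi> * W y * fourier_char ((x - y) \<bullet> \<xi>))" .
  qed
  also have "\<dots> = (LINT y|lborel. LINT \<xi>|lborel. M \<xi> * W y * fourier_char ((x - y) \<bullet> \<xi>))"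
    by (rule lborel_pair.Fubini_integral[symmetric]) (use int in simp)
  also have "\<dots> = (LINT y|lborel. W y * (LINT \<xi>|lborel. M \<xi> * fourier_char ((x - y) \<bullet> \<xi>)))"
    by (intro Bochner_Integration.integral_cong refl) (simp add: integral_mult_right_zero[symmetric] ac_simps del: integral_mult_right_zero)
  finally show ?thesis unfolding kernel unfolding M_def .
qed

text \<open>As \<open>n\<close> grows, the damped inversion integrals converge pointwise to the undamped one
  \<open>V\<close>. They also are convolutions of \<open>W\<close> with an approximate identity. Almost everywhere
  convergence of the latter would need Lebesgue points; testing against indicators of boxes
  avoids this: the convolution can be moved to the indicator, which converges pointwise off
  the boundary of the box. So \<open>V\<close> and \<open>W\<close> have the same integral over every box.\<close>

theorem fourier_inversion_AE:
  fixes W :: "real ^ 'n::finite \<Rightarrow> complex"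
  assumes W: "integrable lborel W" and u: "integrable lborel (fourier W)"
  shows "AE x in lborel. W x = (LINT \<xi>|lborel. fourier W \<xi> * fourier_char (x \<bullet> \<xi>))"
proof -
  have [measurable]: "W \<in> borel_measurable borel" "fourier W \<in> borel_measurable borel"
    using W u by (simp_all add: integrable_iff_bounded)
  define c where "c = sqrt (2 * pi) ^ CARD('n)"
  have c0: "c * gauss (0 :: real ^ 'n) = 1" by (simp add: c_def gauss_zero)
  have cpos: "c > 0" by (simp add: c_def)
  define V where "V x = (LINT \<xi>|lborel. fourier W \<xi> * fourier_char (x \<bullet> \<xi>))" for x
  define M where "M n \<xi> = c * gauss ((1 / real (Suc n)) *\<^sub>R \<xi>)" for n and \<xi> :: "real ^ 'n"
  have [measurable]: "M n \<in> borel_measurable borel" for n unfolding M_def by measurable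
  have M1: "\<bar>M n \<xi>\<bar> \<le> 1" for n \<xi>
  proof -
    have "M n \<xi> \<le> c * gauss (0 :: real ^ 'n)" "0 < M n \<xi>"
      unfolding M_def using cpos by (simp_all add: gauss_le gauss_pos)
    then show ?thesis using c0 by simp
  qed
  have Mlim: "(\<lambda>n. M n \<xi>) \<longlonglongrightarrow> 1" for \<xi>
  proof -
    have "(\<lambda>n. (1 / real (Suc n)) *\<^sub>R \<xi>) \<longlonglongrightarrow> 0 *\<^sub>R \<xi>"
      by (intro tendsto_intros LIMSEQ_Suc lim_1_over_n)
    moreover have "isCont gauss (0 :: real ^ 'n)"
      using continuous_on_gauss[OF continuous_on_id, of "UNIV :: (real ^ 'n) set"] by (simp add: continuous_on_eq_continuous_at)
    ultimately have "(\<lambda>n. gauss ((1 / real (Suc n)) *\<^sub>R \<xi>)) \<longlonglongrightarrow> gauss (0 :: real ^ 'n)"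
      by (metis isCont_tendsto_compose scaleR_zero_left)
    then have "(\<lambda>n. c * gauss ((1 / real (Suc n)) *\<^sub>R \<xi>)) \<longlonglongrightarrow> c * gauss (0 :: real ^ 'n)"
      by (rule tendsto_mult_left)
    then show ?thesis by (simp only: M_def c0)
  qed
  define Vn where "Vn n x = (LINT \<xi>|lborel. fourier W \<xi> * M n \<xi> * fourier_char (x \<bullet> \<xi>))" for n x
  have [measurable]: "V \<in> borel_measurable borel" "Vn n \<in> borel_measurable borel" for n
    unfolding V_def Vn_def by measurable
  define S where "S = (LINT \<xi>|lborel. norm (fourier W \<xi>))"
  have Vbd: "norm (V x) \<le> S" for x
    unfolding V_def S_def by (rule order_trans[OF integral_norm_bound]) (simp add: norm_mult)
  have Vnbd: "norm (Vn n x) \<le> S" for n x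
    unfolding Vn_def S_def
  proof (rule order_trans[OF integral_norm_bound], rule integral_mono_AE')
    show "AE \<xi> in lborel. norm (fourier W \<xi> * M n \<xi> * fourier_char (x \<bullet> \<xi>)) \<le> norm (fourier W \<xi>)"
      using M1 by (auto simp: norm_mult intro!: mult_left_le)
  qed (use u in auto)
  have Vnlim: "(\<lambda>n. Vn n x) \<longlonglongrightarrow> V x" for x
    unfolding V_def Vn_def
  proof (rule integral_dominated_convergence[where w="\<lambda>\<xi>. norm (fourier W \<xi>)"])
    show "AE \<xi> in lborel. (\<lambda>n. fourier W \<xi> * M n \<xi> * fourier_char (x \<bullet> \<xi>)) \<longlonglongrightarrow> fourier W \<xi> * fourier_char (x \<bullet> \<xi>)"
    proof (rule AE_I2)
      fix \<xi>
      have "(\<lambda>n. fourier W \<xi> * M n \<xi> * fourier_char (x \<bullet> \<xi>)) \<longlonglongrightarrow> fourier W \<xi> * of_real 1 * fourier_char (x \<bullet> \<xi>)"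
        by (intro tendsto_intros Mlim)
      then show "(\<lambda>n. fourier W \<xi> * M n \<xi> * fourier_char (x \<bullet> \<xi>)) \<longlonglongrightarrow> fourier W \<xi> * fourier_char (x \<bullet> \<xi>)" by simp
    qed
    show "AE \<xi> in lborel. norm (fourier W \<xi> * M n \<xi> * fourier_char (x \<bullet> \<xi>)) \<le> norm (fourier W \<xi>)" for n
      using M1 by (auto simp: norm_mult intro!: mult_left_le)
  qed (use u in auto)
  define \<kappa> where "\<kappa> n = 2 * pi * real (Suc n)" for n
  have kpos: "\<kappa> n > 0" for n by (simp add: \<kappa>_def)
  have Vn_eq: "Vn n x = (LINT y|lborel. W y * complex_of_real (\<kappa> n ^ CARD('n) * gauss (\<kappa> n *\<^sub>R (x - y))))" for n x
    unfolding Vn_def M_def c_def \<kappa>_def using fourier_gauss_regularized[OF W, of "real (Suc n)" x] by simp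
  have boxes: "(LINT x:box a b|lborel. W x) = (LINT x:box a b|lborel. V x)" for a b :: "real ^ 'n"
  proof -
    let ?B = "box a b"
    let ?i = "\<lambda>x. indicator ?B x :: complex"
    have Bint: "integrable lborel ?i"
    proof -
      have "integrable lborel (\<lambda>x. complex_of_real (indicator ?B x))"
        by (intro integrable_of_real integrable_real_indicator) (auto simp: emeasure_lborel_box_eq)
      moreover have "(\<lambda>x. complex_of_real (indicator ?B x)) = ?i" by (auto simp: indicator_def)
      ultimately show ?thesis by simp
    qed
    define P where "P n y = (LINT z|lborel. indicator ?B (y + (1 / \<kappa> n) *\<^sub>R z) * gauss z)" for n y
    have Pm[measurable]: "P n \<in> borel_measurable borel" for n unfolding P_def by measurable
    have P_eq: "(LINT x|lborel. ?i x * complex_of_real (\<kappa> n ^ CARD('n) * gauss (\<kappa> n *\<^sub>R (x - y)))) = P n y" for n y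
    proof -
      have "(LINT x|lborel. ?i x * complex_of_real (\<kappa> n ^ CARD('n) * gauss (\<kappa> n *\<^sub>R (x - y))))
        = complex_of_real (\<bar>1 / \<kappa> n\<bar> ^ CARD('n)) * (LINT z|lborel. ?i (y + (1 / \<kappa> n) *\<^sub>R z) * complex_of_real (\<kappa> n ^ CARD('n) * gauss (\<kappa> n *\<^sub>R (y + (1 / \<kappa> n) *\<^sub>R z - y))))"
        using kpos[of n] by (subst lborel_integral_affine[where c="1 / \<kappa> n" and t=y]) auto
      also have "\<dots> = (LINT z|lborel. complex_of_real (indicator ?B (y + (1 / \<kappa> n) *\<^sub>R z) * gauss z))"
        unfolding integral_mult_right_zero[symmetric]
        using kpos[of n] by (intro Bochner_Integration.integral_cong) (auto simp: indicator_def power_divide)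
      finally show ?thesis unfolding P_def by (simp only: integral_complex_of_real)
    qed
    have Pbd: "\<bar>P n y\<bar> \<le> 1" for n y
    proof -
      have "norm (P n y) \<le> (LINT z|lborel. norm (indicator ?B (y + (1 / \<kappa> n) *\<^sub>R z) * gauss z))"
        unfolding P_def by (rule integral_norm_bound)
      also have "\<dots> \<le> (LINT z|lborel. gauss (z :: real ^ 'n))"
        by (rule integral_mono_AE') (use integrable_gauss in \<open>auto simp: indicator_def less_imp_le intro!: AE_I2\<close>)
      finally show ?thesis by (simp add: integral_gauss)
    qed
    have Plim: "(\<lambda>n. P n y) \<longlonglongrightarrow> indicator ?B y" if y: "y \<notin> frontier ?B" for y
    proof -
      have "(\<lambda>n. P n y) \<longlonglongrightarrow> (LINT z|lborel. indicator ?B y * gauss (z :: real ^ 'n))"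
        unfolding P_def
      proof (rule integral_dominated_convergence[where w=gauss])
        show "AE z in lborel. (\<lambda>n. indicator ?B (y + (1 / \<kappa> n) *\<^sub>R z) * gauss z) \<longlonglongrightarrow> indicator ?B y * gauss z"
        proof (rule AE_I2, rule tendsto_eventually)
          fix z :: "real ^ 'n"
          have "(\<lambda>n. y + ((1 / (2 * pi)) * (1 / real (Suc n))) *\<^sub>R z) \<longlonglongrightarrow> y + ((1 / (2 * pi)) * 0) *\<^sub>R z"
            by (intro tendsto_intros LIMSEQ_Suc lim_1_over_n)
          then have lim: "(\<lambda>n. y + (1 / \<kappa> n) *\<^sub>R z) \<longlonglongrightarrow> y" by (simp add: \<kappa>_def)
          have "y \<in> ?B \<or> y \<in> - closure ?B" using y by (auto simp: frontier_def interior_open[OF open_box])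
          then have "\<forall>\<^sub>F n in sequentially. (y + (1 / \<kappa> n) *\<^sub>R z \<in> ?B) = (y \<in> ?B)"
          proof
            assume "y \<in> ?B"
            then show ?thesis using topological_tendstoD[OF lim open_box, of a b] by (auto elim: eventually_mono)
          next
            assume y': "y \<in> - closure ?B"
            then have "\<forall>\<^sub>F n in sequentially. y + (1 / \<kappa> n) *\<^sub>R z \<in> - closure ?B"
              by (intro topological_tendstoD[OF lim]) auto
            then show ?thesis by eventually_elim (use y' closure_subset[of ?B] in auto)
          qed
          then show "\<forall>\<^sub>F n in sequentially. indicator ?B (y + (1 / \<kappa> n) *\<^sub>R z) * gauss z = indicator ?B y * gauss z"
            by eventually_elim (auto simp: indicator_def)
        qed
      qed (use integrable_gauss in \<open>auto simp: indicator_def less_imp_le\<close>)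
      then show ?thesis by (simp add: integral_gauss)
    qed
    have swap: "(LINT x|lborel. ?i x * Vn n x) = (LINT y|lborel. W y * P n y)" for n
    proof -
      have pm: "(\<lambda>(x, y). complex_of_real (\<kappa> n ^ CARD('n) * gauss (\<kappa> n *\<^sub>R (x - y)))) \<in> borel_measurable (lborel \<Otimes>\<^sub>M lborel)"
        by measurable
      have bd: "norm (complex_of_real (\<kappa> n ^ CARD('n) * gauss (\<kappa> n *\<^sub>R (x - y)))) \<le> \<kappa> n ^ CARD('n) * gauss (0 :: real ^ 'n)" for x y :: "real ^ 'n"
        using kpos[of n] gauss_pos[of "\<kappa> n *\<^sub>R (x - y)"] gauss_le[of "\<kappa> n *\<^sub>R (x - y)"]
        by (simp only: norm_of_real abs_mult power_abs) (intro mult_mono; simp)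
      have int: "integrable (lborel \<Otimes>\<^sub>M lborel) (\<lambda>(x, y). ?i x * W y * complex_of_real (\<kappa> n ^ CARD('n) * gauss (\<kappa> n *\<^sub>R (x - y))))"
        by (rule integrable_pair_bounded_kernel[OF Bint W pm bd])
      have "(LINT x|lborel. ?i x * Vn n x) = (LINT x|lborel. LINT y|lborel. ?i x * W y * complex_of_real (\<kappa> n ^ CARD('n) * gauss (\<kappa> n *\<^sub>R (x - y))))"
        unfolding Vn_eq integral_mult_right_zero[symmetric] by (simp add: mult.assoc)
      also have "\<dots> = (LINT y|lborel. LINT x|lborel. ?i x * W y * complex_of_real (\<kappa> n ^ CARD('n) * gauss (\<kappa> n *\<^sub>R (x - y))))"
        by (rule lborel_pair.Fubini_integral[symmetric]) (use int in simp)
      also have "\<dots> = (LINT y|lborel. W y * (LINT x|lborel. ?i x * complex_of_real (\<kappa> n ^ CARD('n) * gauss (\<kappa> n *\<^sub>R (x - y)))))"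
        unfolding integral_mult_right_zero[symmetric] by (intro Bochner_Integration.integral_cong refl) (simp add: ac_simps)
      finally show ?thesis unfolding P_eq .
    qed
    have L: "(\<lambda>n. LINT x|lborel. ?i x * Vn n x) \<longlonglongrightarrow> (LINT x|lborel. ?i x * V x)"
    proof (rule integral_dominated_convergence[where w="\<lambda>x. S * norm (?i x)"])
      show "AE x in lborel. (\<lambda>n. ?i x * Vn n x) \<longlonglongrightarrow> ?i x * V x"
        by (intro AE_I2 tendsto_intros Vnlim)
      show "AE x in lborel. norm (?i x * Vn n x) \<le> S * norm (?i x)" for n
        using Vnbd by (auto simp: norm_mult mult.commute intro!: mult_right_mono)
      show "integrable lborel (\<lambda>x. S * norm (?i x))" using Bint by (intro integrable_mult_right integrable_norm)
    qed auto
    \<comment> \<open>\<open>P n\<close> converges to the indicator off the boundary of the box, which is a null set.\<close>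
    have R: "(\<lambda>n. LINT y|lborel. W y * P n y) \<longlonglongrightarrow> (LINT y|lborel. W y * ?i y)"
    proof (rule integral_dominated_convergence[where w="\<lambda>y. norm (W y)"])
      have "AE y in lborel. y \<notin> frontier ?B"
      proof -
        have "negligible (frontier ?B)" by (simp add: negligible_convex_frontier)
        then have "frontier ?B \<in> null_sets lborel"
          by (simp add: negligible_iff_null_sets null_sets_completion_iff)
        then show ?thesis by (rule AE_not_in)
      qed
      then show "AE y in lborel. (\<lambda>n. W y * P n y) \<longlonglongrightarrow> W y * ?i y"
      proof eventually_elim
        case (elim y)
        then have "(\<lambda>n. W y * P n y) \<longlonglongrightarrow> W y * of_real (indicator ?B y)" by (intro tendsto_intros Plim)
        then show ?case by (cases "y \<in> ?B") simp_all
      qed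
      show "AE y in lborel. norm (W y * P n y) \<le> norm (W y)" for n
        using Pbd by (auto simp: norm_mult intro!: mult_left_le)
    qed (use W in auto)
    have "(LINT x|lborel. ?i x * V x) = (LINT y|lborel. W y * ?i y)"
      using LIMSEQ_unique[OF L] R unfolding swap by blast
    moreover have "(LINT x:?B|lborel. W x) = (LINT y|lborel. W y * ?i y)"
      unfolding set_lebesgue_integral_def by (intro Bochner_Integration.integral_cong refl) (simp add: indicator_def)
    moreover have "(LINT x:?B|lborel. V x) = (LINT x|lborel. ?i x * V x)"
      unfolding set_lebesgue_integral_def by (intro Bochner_Integration.integral_cong refl) (simp add: indicator_def)
    ultimately show ?thesis by simp
  qed
  \<comment> \<open>\<open>V\<close> is bounded but need not be integrable, so the comparison is made on large boxes.\<close>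
  have "AE x in lborel. x \<in> box (- (real n *\<^sub>R One)) (real n *\<^sub>R One) \<longrightarrow> W x = V x" for n :: nat
  proof -
    let ?Q = "box (- (real n *\<^sub>R One)) (real n *\<^sub>R One) :: (real ^ 'n) set"
    have Wi: "set_integrable lborel A W" if "A \<in> sets borel" for A
      unfolding set_integrable_def using that W by (intro integrable_mult_indicator) auto
    have Vi: "set_integrable lborel (box a b) V" for a b
      unfolding set_integrable_def
    proof (rule Bochner_Integration.integrable_bound[of _ "\<lambda>x. S * indicator (box a b) x"])
      show "integrable lborel (\<lambda>x. S * indicator (box a b) x :: real)"
        by (intro integrable_mult_right integrable_real_indicator) (auto simp: emeasure_lborel_box_eq)
    qed (use Vbd in \<open>auto simp: indicator_def intro: order_trans[OF _ abs_ge_self]\<close>)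
    have "AE x in lborel. indicator ?Q x *\<^sub>R (W x - V x) = 0"
    proof (rule AE_zero_of_box_integrals)
      show "integrable lborel (\<lambda>x. indicator ?Q x *\<^sub>R (W x - V x))"
      proof -
        have "set_integrable lborel ?Q (\<lambda>x. W x - V x)"
          by (rule set_integral_diff(1)) (auto intro: Wi Vi)
        then show ?thesis unfolding set_integrable_def .
      qed
      fix a b :: "real ^ 'n"
      obtain a' b' where ab: "box a b \<inter> ?Q = box a' b'" unfolding box_Int_box by blast
      have "(LINT x:box a b|lborel. indicator ?Q x *\<^sub>R (W x - V x)) = (LINT x:box a' b'|lborel. W x - V x)"
        unfolding set_lebesgue_integral_def ab[symmetric] by (intro Bochner_Integration.integral_cong) (auto simp: indicator_def)
      also have "\<dots> = (LINT x:box a' b'|lborel. W x) - (LINT x:box a' b'|lborel. V x)"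
        by (rule set_integral_diff(2)) (auto intro: Wi Vi)
      finally show "(LINT x:box a b|lborel. indicator ?Q x *\<^sub>R (W x - V x)) = 0" by (simp add: boxes)
    qed
    then show ?thesis by eventually_elim auto
  qed
  then have "AE x in lborel. \<forall>n. x \<in> box (- (real n *\<^sub>R One)) (real n *\<^sub>R One) \<longrightarrow> W x = V x"
    by (simp only: AE_all_countable) simp
  then show ?thesis
  proof eventually_elim
    case (elim x)
    obtain N :: nat where N: "norm x < real N" using reals_Archimedean2 by blast
    have "\<bar>x \<bullet> i\<bar> < real N" if "i \<in> Basis" for i
      using Basis_le_norm[OF that, of x] N by linarith
    then have "x \<in> box (- (real N *\<^sub>R One)) (real N *\<^sub>R One)" unfolding mem_box by (auto simp: abs_less_iff minus_less_iff)
    then show ?case using elim by (auto simp: V_def)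
  qed
qed

section \<open>The wavelet transform on the Fourier side\<close>

lemma borel_measurable_matrix_vector[measurable (raw)]:
  fixes A :: "real ^ 'n ^ 'm"
  assumes "g \<in> borel_measurable M"
  shows "(\<lambda>x. A *v g x) \<in> borel_measurable M"
  by (rule measurable_compose[OF assms])
     (intro borel_measurable_continuous_onI continuous_on_matrix_vector_mult continuous_intros)

lemma borel_measurable_cnj[measurable (raw)]:
  assumes "f \<in> borel_measurable M"
  shows "(\<lambda>x. cnj (f x)) \<in> borel_measurable M"
  by (rule measurable_compose[OF assms]) (intro borel_measurable_continuous_onI continuous_intros)

lemma nn_integral_dilate_reflect:
  fixes h :: "real ^ 'n ^ 'n"
  assumes h: "invertible h" and [measurable]: "G \<in> borel_measurable borel"
  shows "(\<integral>\<^sup>+x. G (matrix_inv h *v (y - x)) \<partial>lborel) = ennreal \<bar>det h\<bar> * (\<integral>\<^sup>+z. G z \<partial>lborel)"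
proof -
  have "(\<integral>\<^sup>+x. G (matrix_inv h *v (y - x)) \<partial>lborel) = (\<integral>\<^sup>+x. G (matrix_inv h *v x) \<partial>lborel)"
    by (subst lborel_nn_integral_affine[where c="-1" and t=y]) simp_all
  also have "\<dots> = ennreal \<bar>det h\<bar> * (\<integral>\<^sup>+x. G (matrix_inv h *v (h *v x)) \<partial>lborel)"
    by (rule nn_integral_lborel_linear[OF h]) measurable
  finally show ?thesis by (simp add: matrix_inv_vector_mult(2)[OF h])
qed

lemma integral_dilate_reflect:
  fixes h :: "real ^ 'n ^ 'n" and G :: "real ^ 'n \<Rightarrow> complex"
  assumes h: "invertible h" and [measurable]: "G \<in> borel_measurable borel" and K[measurable]: "K \<in> borel_measurable borel"
  shows "(LINT x|lborel. G (matrix_inv h *v (y - x)) * K x) = complex_of_real \<bar>det h\<bar> * (LINT z|lborel. G z * K (y - h *v z))"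
proof -
  have "(LINT x|lborel. G (matrix_inv h *v (y - x)) * K x) = (LINT x|lborel. G (matrix_inv h *v x) * K (y - x))"
    by (subst lborel_integral_affine[where c="-1" and t=y]) simp_all
  also have "\<dots> = complex_of_real \<bar>det h\<bar> * (LINT x|lborel. G (matrix_inv h *v (h *v x)) * K (y - h *v x))"
    by (rule lebesgue_integral_lborel_linear[OF h]) measurable
  finally show ?thesis by (simp add: matrix_inv_vector_mult(2)[OF h])
qed

lemma wavelet_transform_kernel_integrable:
  fixes f \<psi> :: "real ^ 'n \<Rightarrow> complex"
  assumes f: "integrable lborel f" and \<psi>: "integrable lborel \<psi>" and h: "invertible h"
  shows "integrable (lborel \<Otimes>\<^sub>M lborel) (\<lambda>(x, y). f y * cnj (\<psi> (matrix_inv h *v (y - x))))"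
proof (rule integrableI_bounded)
  have [measurable]: "f \<in> borel_measurable borel" "\<psi> \<in> borel_measurable borel"
    using f \<psi> by (simp_all add: integrable_iff_bounded)
  show "(\<lambda>(x, y). f y * cnj (\<psi> (matrix_inv h *v (y - x)))) \<in> borel_measurable (lborel \<Otimes>\<^sub>M lborel)"
    by measurable
  have "(\<integral>\<^sup>+p. ennreal (norm (case p of (x, y) \<Rightarrow> f y * cnj (\<psi> (matrix_inv h *v (y - x))))) \<partial>(lborel \<Otimes>\<^sub>M lborel))
     = (\<integral>\<^sup>+y. \<integral>\<^sup>+x. ennreal (norm (f y)) * ennreal (norm (\<psi> (matrix_inv h *v (y - x)))) \<partial>lborel \<partial>lborel)"
    by (subst lborel_pair.nn_integral_snd[symmetric]) (simp_all add: norm_mult ennreal_mult)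
  also have "\<dots> = (\<integral>\<^sup>+y. ennreal (norm (f y)) * (ennreal \<bar>det h\<bar> * (\<integral>\<^sup>+z. ennreal (norm (\<psi> z)) \<partial>lborel)) \<partial>lborel)"
  proof (rule nn_integral_cong)
    fix y
    have "(\<integral>\<^sup>+x. ennreal (norm (f y)) * ennreal (norm (\<psi> (matrix_inv h *v (y - x)))) \<partial>lborel)
       = ennreal (norm (f y)) * (\<integral>\<^sup>+x. ennreal (norm (\<psi> (matrix_inv h *v (y - x)))) \<partial>lborel)"
      by (rule nn_integral_cmult) measurable
    also have "(\<integral>\<^sup>+x. ennreal (norm (\<psi> (matrix_inv h *v (y - x)))) \<partial>lborel) = ennreal \<bar>det h\<bar> * (\<integral>\<^sup>+z. ennreal (norm (\<psi> z)) \<partial>lborel)"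
      by (rule nn_integral_dilate_reflect[OF h, of "\<lambda>z. ennreal (norm (\<psi> z))"]) measurable
    finally show "(\<integral>\<^sup>+x. ennreal (norm (f y)) * ennreal (norm (\<psi> (matrix_inv h *v (y - x)))) \<partial>lborel)
       = ennreal (norm (f y)) * (ennreal \<bar>det h\<bar> * (\<integral>\<^sup>+z. ennreal (norm (\<psi> z)) \<partial>lborel))" .
  qed
  also have "\<dots> = (\<integral>\<^sup>+y. ennreal (norm (f y)) \<partial>lborel) * (ennreal \<bar>det h\<bar> * (\<integral>\<^sup>+z. ennreal (norm (\<psi> z)) \<partial>lborel))"
    by (rule nn_integral_multc) measurable
  also have "\<dots> < \<infinity>"
    using f \<psi> by (simp add: integrable_iff_bounded ennreal_mult_less_top)
  finally show "(\<integral>\<^sup>+p. ennreal (norm (case p of (x, y) \<Rightarrow> f y * cnj (\<psi> (matrix_inv h *v (y - x))))) \<partial>(lborel \<Otimes>\<^sub>M lborel)) < \<infinity>" .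
qed

lemma wavelet_transform_eq:
  "wavelet_transform \<psi> f (x, h) = complex_of_real (\<bar>det h\<bar> powr (- 1 / 2)) * (LINT y|lborel. f y * cnj (\<psi> (matrix_inv h *v (y - x))))"
  unfolding wavelet_transform_def inner_L2_def quasi_regular_def
  by (subst integral_mult_right_zero[symmetric]) (simp add: ac_simps)

lemma wavelet_transform_integrable:
  fixes f \<psi> :: "real ^ 'n \<Rightarrow> complex"
  assumes f: "integrable lborel f" and \<psi>: "integrable lborel \<psi>" and h: "invertible h"
  shows "integrable lborel (\<lambda>x. wavelet_transform \<psi> f (x, h))"
  unfolding wavelet_transform_eq
  using lborel_pair.integrable_fst'[OF wavelet_transform_kernel_integrable[OF assms]]
  by (intro integrable_mult_right) simp

text \<open>Fubini and the substitution \<open>z = h\<^sup>-\<^sup>1 (y - x)\<close>; the Jacobian \<open>|det h|\<close> combines with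
  the normalization \<open>|det h| powr (- 1 / 2)\<close>.\<close>

lemma fourier_wavelet_transform:
  fixes f \<psi> :: "real ^ 'n \<Rightarrow> complex"
  assumes f: "integrable lborel f" and \<psi>: "integrable lborel \<psi>" and h: "invertible h"
  shows "fourier (\<lambda>x. wavelet_transform \<psi> f (x, h)) \<xi>
    = complex_of_real (\<bar>det h\<bar> powr (1 / 2)) * (fourier f \<xi> * cnj (fourier \<psi> (transpose h *v \<xi>)))"
proof -
  have [measurable]: "f \<in> borel_measurable borel" "\<psi> \<in> borel_measurable borel"
    using f \<psi> by (simp_all add: integrable_iff_bounded)
  let ?c = "complex_of_real (\<bar>det h\<bar> powr (- 1 / 2))"
  let ?k = "\<lambda>x y. f y * cnj (\<psi> (matrix_inv h *v (y - x)))"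
  have "integrable (lborel \<Otimes>\<^sub>M lborel) (\<lambda>p. (case p of (x, y) \<Rightarrow> ?k x y) * fourier_char (- (fst p \<bullet> \<xi>)))"
  proof (rule Bochner_Integration.integrable_bound[OF wavelet_transform_kernel_integrable[OF f \<psi> h]])
    show "(\<lambda>p. (case p of (x, y) \<Rightarrow> ?k x y) * fourier_char (- (fst p \<bullet> \<xi>))) \<in> borel_measurable (lborel \<Otimes>\<^sub>M lborel)"
      by measurable
  qed (simp add: norm_mult)
  then have int: "integrable (lborel \<Otimes>\<^sub>M lborel) (\<lambda>(x, y). ?k x y * fourier_char (- (x \<bullet> \<xi>)))"
    by (simp add: case_prod_beta')
  have psi: "(LINT z|lborel. cnj (\<psi> z) * fourier_char (- ((y - h *v z) \<bullet> \<xi>))) = fourier_char (- (y \<bullet> \<xi>)) * cnj (fourier \<psi> (transpose h *v \<xi>))" for y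
  proof -
    have "fourier_char (- ((y - h *v z) \<bullet> \<xi>)) = fourier_char (- (y \<bullet> \<xi>)) * cnj (fourier_char (- (z \<bullet> (transpose h *v \<xi>))))" for z
    proof -
      have "(h *v z) \<bullet> \<xi> = z \<bullet> (transpose h *v \<xi>)"
        by (metis dot_lmul_matrix inner_commute transpose_matrix_vector)
      then show ?thesis
        by (simp add: cnj_fourier_char inner_diff_left fourier_char_add[symmetric])
    qed
    then have "(LINT z|lborel. cnj (\<psi> z) * fourier_char (- ((y - h *v z) \<bullet> \<xi>))) = (LINT z|lborel. fourier_char (- (y \<bullet> \<xi>)) * cnj (\<psi> z * fourier_char (- (z \<bullet> (transpose h *v \<xi>)))))"
      by (intro Bochner_Integration.integral_cong refl) (simp only: complex_cnj_mult mult.left_commute)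
    also have "\<dots> = fourier_char (- (y \<bullet> \<xi>)) * cnj (fourier \<psi> (transpose h *v \<xi>))"
      unfolding integral_mult_right_zero fourier_eq by (simp del: complex_cnj_mult)
    finally show ?thesis .
  qed
  have "fourier (\<lambda>x. wavelet_transform \<psi> f (x, h)) \<xi> = (LINT x|lborel. ?c * (LINT y|lborel. ?k x y * fourier_char (- (x \<bullet> \<xi>))))"
    unfolding fourier_eq wavelet_transform_eq integral_mult_left_zero by (simp only: mult.assoc)
  also have "\<dots> = ?c * (LINT x|lborel. LINT y|lborel. ?k x y * fourier_char (- (x \<bullet> \<xi>)))"
    by (rule integral_mult_right_zero)
  also have "(LINT x|lborel. LINT y|lborel. ?k x y * fourier_char (- (x \<bullet> \<xi>))) = (LINT y|lborel. LINT x|lborel. ?k x y * fourier_char (- (x \<bullet> \<xi>)))"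
    by (rule lborel_pair.Fubini_integral[symmetric]) (use int in simp)
  also have "\<dots> = (LINT y|lborel. f y * fourier_char (- (y \<bullet> \<xi>)) * (complex_of_real \<bar>det h\<bar> * cnj (fourier \<psi> (transpose h *v \<xi>))))"
  proof (intro Bochner_Integration.integral_cong refl)
    fix y
    have "(LINT x|lborel. ?k x y * fourier_char (- (x \<bullet> \<xi>))) = f y * (LINT x|lborel. cnj (\<psi> (matrix_inv h *v (y - x))) * fourier_char (- (x \<bullet> \<xi>)))"
      by (simp only: integral_mult_right_zero[symmetric] mult.assoc)
    also have "(LINT x|lborel. cnj (\<psi> (matrix_inv h *v (y - x))) * fourier_char (- (x \<bullet> \<xi>))) = complex_of_real \<bar>det h\<bar> * (LINT z|lborel. cnj (\<psi> z) * fourier_char (- ((y - h *v z) \<bullet> \<xi>)))"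
      by (rule integral_dilate_reflect[OF h, of "\<lambda>z. cnj (\<psi> z)" "\<lambda>x. fourier_char (- (x \<bullet> \<xi>))"]) measurable
    finally show "(LINT x|lborel. ?k x y * fourier_char (- (x \<bullet> \<xi>))) = f y * fourier_char (- (y \<bullet> \<xi>)) * (complex_of_real \<bar>det h\<bar> * cnj (fourier \<psi> (transpose h *v \<xi>)))"
      unfolding psi by (simp only: mult.assoc mult.left_commute mult.commute)
  qed
  also have "\<dots> = fourier f \<xi> * (complex_of_real \<bar>det h\<bar> * cnj (fourier \<psi> (transpose h *v \<xi>)))"
    unfolding integral_mult_left_zero fourier_eq[symmetric] ..
  also have "?c * (fourier f \<xi> * (complex_of_real \<bar>det h\<bar> * cnj (fourier \<psi> (transpose h *v \<xi>))))
    = complex_of_real (\<bar>det h\<bar> powr (- 1 / 2) * \<bar>det h\<bar>) * (fourier f \<xi> * cnj (fourier \<psi> (transpose h *v \<xi>)))"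
    by simp
  also have "\<bar>det h\<bar> powr (- 1 / 2) * \<bar>det h\<bar> = \<bar>det h\<bar> powr (1 / 2)"
  proof -
    have "\<bar>det h\<bar> powr (- 1 / 2) * \<bar>det h\<bar> powr 1 = \<bar>det h\<bar> powr (- 1 / 2 + 1)" by (rule powr_add[symmetric])
    then show ?thesis by simp
  qed
  finally show ?thesis .
qed

section \<open>Decay of a Fourier integral from integrable derivatives\<close>

definition shift_difference :: "'a::ab_group_add \<Rightarrow> ('a \<Rightarrow> complex) \<Rightarrow> 'a \<Rightarrow> complex" where
  "shift_difference a F \<xi> = F (\<xi> + a) - F \<xi>"

lemma integrable_shift_difference_power:
  fixes F :: "'a::euclidean_space \<Rightarrow> complex"
  assumes "integrable lborel F"
  shows "integrable lborel ((shift_difference a ^^ k) F)"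
proof (induction k)
  case (Suc k)
  then show ?case
    using integrable_lborel_affine[OF Suc, of 1 a]
    by (simp add: shift_difference_def[abs_def] add.commute)
qed (simp add: assms)

text \<open>Translation by \<open>a\<close> becomes multiplication by a character, so each difference
  contributes a factor \<open>fourier_char (- (x \<bullet> a)) - 1\<close>.\<close>

lemma fourier_shift_difference:
  fixes F :: "'a::euclidean_space \<Rightarrow> complex"
  assumes "integrable lborel F"
  shows "(LINT \<xi>|lborel. (shift_difference a ^^ k) F \<xi> * fourier_char (x \<bullet> \<xi>))
     = (fourier_char (- (x \<bullet> a)) - 1) ^ k * (LINT \<xi>|lborel. F \<xi> * fourier_char (x \<bullet> \<xi>))"
proof (induction k)
  case (Suc k)
  let ?G = "(shift_difference a ^^ k) F"
  have G: "integrable lborel ?G" by (rule integrable_shift_difference_power[OF assms])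
  then have [measurable]: "?G \<in> borel_measurable borel" by (simp add: integrable_iff_bounded)
  have Gi: "integrable lborel (\<lambda>\<xi>. ?G \<xi> * fourier_char (x \<bullet> \<xi>))"
    by (rule Bochner_Integration.integrable_bound[OF G]) (auto simp: norm_mult)
  have Gsi: "integrable lborel (\<lambda>\<xi>. ?G (\<xi> + a) * fourier_char (x \<bullet> \<xi>))"
  proof (rule Bochner_Integration.integrable_bound)
    show "integrable lborel (\<lambda>\<xi>. ?G (a + 1 *\<^sub>R \<xi>))" by (rule integrable_lborel_affine[OF G]) simp
  qed (auto simp: norm_mult add.commute)
  have "(LINT \<xi>|lborel. ?G (\<xi> + a) * fourier_char (x \<bullet> \<xi>)) = (LINT \<xi>|lborel. ?G \<xi> * fourier_char (x \<bullet> (\<xi> - a)))"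
    by (subst (2) lborel_integral_affine[where c=1 and t=a]) (simp_all add: add.commute)
  also have "\<dots> = (LINT \<xi>|lborel. fourier_char (- (x \<bullet> a)) * (?G \<xi> * fourier_char (x \<bullet> \<xi>)))"
    by (intro Bochner_Integration.integral_cong refl)
       (simp add: inner_diff_right fourier_char_add[of "x \<bullet> _" "- (x \<bullet> a)", simplified])
  also have "\<dots> = fourier_char (- (x \<bullet> a)) * (LINT \<xi>|lborel. ?G \<xi> * fourier_char (x \<bullet> \<xi>))"
    by (rule integral_mult_right_zero)
  finally have shift: "(LINT \<xi>|lborel. ?G (\<xi> + a) * fourier_char (x \<bullet> \<xi>)) = fourier_char (- (x \<bullet> a)) * (LINT \<xi>|lborel. ?G \<xi> * fourier_char (x \<bullet> \<xi>))" .
  have "(LINT \<xi>|lborel. (shift_difference a ^^ Suc k) F \<xi> * fourier_char (x \<bullet> \<xi>))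
     = (LINT \<xi>|lborel. ?G (\<xi> + a) * fourier_char (x \<bullet> \<xi>) - ?G \<xi> * fourier_char (x \<bullet> \<xi>))"
    by (simp add: shift_difference_def left_diff_distrib)
  also have "\<dots> = (LINT \<xi>|lborel. ?G (\<xi> + a) * fourier_char (x \<bullet> \<xi>)) - (LINT \<xi>|lborel. ?G \<xi> * fourier_char (x \<bullet> \<xi>))"
    by (rule Bochner_Integration.integral_diff[OF Gsi Gi])
  finally show ?case using Suc by (simp only: shift) (simp add: algebra_simps)
qed simp

text \<open>\<open>U k\<close> is the \<open>k\<close>-th derivative of \<open>U 0\<close> in the direction \<open>e\<close>. Derivatives in other
  directions need not exist.\<close>

definition derivative_chain :: "'a::real_normed_vector \<Rightarrow> nat \<Rightarrow> (nat \<Rightarrow> 'a \<Rightarrow> complex) \<Rightarrow> bool" where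
  "derivative_chain e r U \<longleftrightarrow>
     (\<forall>k\<le>r. continuous_on UNIV (U k)) \<and>
     (\<forall>k<r. \<forall>\<xi>. ((\<lambda>s. U k (\<xi> + s *\<^sub>R e)) has_vector_derivative U (Suc k) \<xi>) (at 0))"

lemma derivative_chain_at:
  assumes "derivative_chain e r U" "k < r"
  shows "((\<lambda>s. U k (\<xi> + s *\<^sub>R e)) has_vector_derivative U (Suc k) (\<xi> + t *\<^sub>R e)) (at t)"
proof -
  have "((\<lambda>s. U k ((\<xi> + t *\<^sub>R e) + s *\<^sub>R e)) has_vector_derivative U (Suc k) (\<xi> + t *\<^sub>R e)) (at (t - t))"
    using assms unfolding derivative_chain_def by simp
  then have "((\<lambda>s. U k ((\<xi> + t *\<^sub>R e) + s *\<^sub>R e)) \<circ> (\<lambda>s. s - t) has_vector_derivative 1 *\<^sub>R U (Suc k) (\<xi> + t *\<^sub>R e)) (at t)"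
    by (intro vector_diff_chain_at derivative_eq_intros refl) (auto intro!: derivative_eq_intros)
  then show ?thesis by (simp add: o_def algebra_simps)
qed

lemma derivative_chain_shift_difference:
  assumes U: "derivative_chain e r U"
  shows "derivative_chain e r (\<lambda>k. shift_difference a (U k))"
  unfolding derivative_chain_def
proof (intro conjI allI impI)
  fix k assume "k \<le> r"
  then have c: "continuous_on UNIV (U k)" using U unfolding derivative_chain_def by blast
  show "continuous_on UNIV (shift_difference a (U k))"
    unfolding shift_difference_def[abs_def]
    by (intro continuous_intros c continuous_on_compose2[OF c]) auto
next
  fix k \<xi> assume "k < r"
  then have "((\<lambda>s. U k (\<xi> + s *\<^sub>R e)) has_vector_derivative U (Suc k) \<xi>) (at 0)" for \<xi>
    using U unfolding derivative_chain_def by blast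
  from has_vector_derivative_diff[OF this[of "\<xi> + a"] this[of \<xi>]]
  have "((\<lambda>s. U k (\<xi> + a + s *\<^sub>R e) - U k (\<xi> + s *\<^sub>R e)) has_vector_derivative U (Suc k) (\<xi> + a) - U (Suc k) \<xi>) (at 0)" .
  moreover have "\<xi> + a + s *\<^sub>R e = \<xi> + s *\<^sub>R e + a" for s by (simp add: add.commute add.left_commute)
  ultimately show "((\<lambda>s. shift_difference a (U k) (\<xi> + s *\<^sub>R e)) has_vector_derivative shift_difference a (U (Suc k)) \<xi>) (at 0)"
    by (simp only: shift_difference_def)
qed

text \<open>The difference is the integral of the derivative over a segment of length \<open>\<tau>\<close>, and
  Lebesgue measure is translation invariant.\<close>

lemma nn_integral_shift_difference_le:
  fixes e :: "'a::euclidean_space"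
  assumes U: "derivative_chain e r U" and k: "k < r" and \<tau>: "0 \<le> \<tau>"
  shows "(\<integral>\<^sup>+\<xi>. ennreal (norm (shift_difference (\<tau> *\<^sub>R e) (U k) \<xi>)) \<partial>lborel) \<le> ennreal \<tau> * (\<integral>\<^sup>+\<xi>. ennreal (norm (U (Suc k) \<xi>)) \<partial>lborel)"
proof -
  have c: "continuous_on UNIV (U (Suc k))" using U k unfolding derivative_chain_def by auto
  then have [measurable]: "U (Suc k) \<in> borel_measurable borel" by (rule borel_measurable_continuous_onI)
  have pt: "ennreal (norm (shift_difference (\<tau> *\<^sub>R e) (U k) \<xi>)) \<le> (\<integral>\<^sup>+t. ennreal (norm (U (Suc k) (\<xi> + t *\<^sub>R e))) * indicator {0..\<tau>} t \<partial>lborel)" for \<xi>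
  proof -
    have ct: "continuous_on {0..\<tau>} (\<lambda>t. U (Suc k) (\<xi> + t *\<^sub>R e))"
      by (rule continuous_on_compose2[OF c]) (auto intro!: continuous_intros)
    have hb: "has_bochner_integral lborel (\<lambda>t. indicator {0..\<tau>} t *\<^sub>R U (Suc k) (\<xi> + t *\<^sub>R e)) (U k (\<xi> + \<tau> *\<^sub>R e) - U k (\<xi> + 0 *\<^sub>R e))"
      by (rule has_bochner_integral_FTC_Icc[OF \<tau> _ ct])
         (rule has_vector_derivative_at_within[OF derivative_chain_at[OF U k]])
    have "ennreal (norm (shift_difference (\<tau> *\<^sub>R e) (U k) \<xi>)) = ennreal (norm (LINT t|lborel. indicator {0..\<tau>} t *\<^sub>R U (Suc k) (\<xi> + t *\<^sub>R e)))"
      using has_bochner_integral_integral_eq[OF hb] by (simp add: shift_difference_def)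
    also have "\<dots> \<le> (\<integral>\<^sup>+t. ennreal (norm (indicator {0..\<tau>} t *\<^sub>R U (Suc k) (\<xi> + t *\<^sub>R e))) \<partial>lborel)"
      by (rule integral_norm_bound_ennreal) (use hb in \<open>simp add: has_bochner_integral_iff\<close>)
    also have "\<dots> = (\<integral>\<^sup>+t. ennreal (norm (U (Suc k) (\<xi> + t *\<^sub>R e))) * indicator {0..\<tau>} t \<partial>lborel)"
      by (intro nn_integral_cong) (auto simp: indicator_def)
    finally show ?thesis .
  qed
  have "(\<integral>\<^sup>+\<xi>. ennreal (norm (shift_difference (\<tau> *\<^sub>R e) (U k) \<xi>)) \<partial>lborel)
     \<le> (\<integral>\<^sup>+\<xi>. \<integral>\<^sup>+t. ennreal (norm (U (Suc k) (\<xi> + t *\<^sub>R e))) * indicator {0..\<tau>} t \<partial>lborel \<partial>lborel)"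
    by (intro nn_integral_mono pt)
  also have "\<dots> = (\<integral>\<^sup>+t. \<integral>\<^sup>+\<xi>. ennreal (norm (U (Suc k) (\<xi> + t *\<^sub>R e))) * indicator {0..\<tau>} t \<partial>lborel \<partial>lborel)"
    by (rule lborel_pair.Fubini'[symmetric]) measurable
  also have "\<dots> = (\<integral>\<^sup>+t. (\<integral>\<^sup>+\<xi>. ennreal (norm (U (Suc k) \<xi>)) \<partial>lborel) * indicator {0..\<tau>} t \<partial>lborel)"
  proof (rule nn_integral_cong)
    fix t :: real
    have "(\<integral>\<^sup>+\<xi>. ennreal (norm (U (Suc k) \<xi>)) \<partial>lborel) = (\<integral>\<^sup>+\<xi>. ennreal (norm (U (Suc k) (t *\<^sub>R e + 1 *\<^sub>R \<xi>))) \<partial>lborel)"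
      by (subst lborel_nn_integral_affine[where c=1 and t="t *\<^sub>R e"]) simp_all
    then have "(\<integral>\<^sup>+\<xi>. ennreal (norm (U (Suc k) (\<xi> + t *\<^sub>R e))) \<partial>lborel) = (\<integral>\<^sup>+\<xi>. ennreal (norm (U (Suc k) \<xi>)) \<partial>lborel)"
      by (simp add: add.commute)
    then show "(\<integral>\<^sup>+\<xi>. ennreal (norm (U (Suc k) (\<xi> + t *\<^sub>R e))) * indicator {0..\<tau>} t \<partial>lborel) = (\<integral>\<^sup>+\<xi>. ennreal (norm (U (Suc k) \<xi>)) \<partial>lborel) * indicator {0..\<tau>} t"
      by (subst nn_integral_multc) simp_all
  qed
  also have "\<dots> = (\<integral>\<^sup>+\<xi>. ennreal (norm (U (Suc k) \<xi>)) \<partial>lborel) * ennreal \<tau>"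
    using \<tau> by (subst nn_integral_cmult_indicator) simp_all
  finally show ?thesis by (simp add: mult.commute)
qed

lemma nn_integral_shift_difference_power_le:
  fixes e :: "'a::euclidean_space"
  assumes "derivative_chain e r U" and \<tau>: "0 \<le> \<tau>" and "k \<le> r"
  shows "(\<integral>\<^sup>+\<xi>. ennreal (norm ((shift_difference (\<tau> *\<^sub>R e) ^^ k) (U 0) \<xi>)) \<partial>lborel) \<le> ennreal (\<tau> ^ k) * (\<integral>\<^sup>+\<xi>. ennreal (norm (U k \<xi>)) \<partial>lborel)"
  using assms(1,3)
proof (induction k arbitrary: U)
  case (Suc k)
  have "(\<integral>\<^sup>+\<xi>. ennreal (norm ((shift_difference (\<tau> *\<^sub>R e) ^^ k) (shift_difference (\<tau> *\<^sub>R e) (U 0)) \<xi>)) \<partial>lborel)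
     \<le> ennreal (\<tau> ^ k) * (\<integral>\<^sup>+\<xi>. ennreal (norm (shift_difference (\<tau> *\<^sub>R e) (U k) \<xi>)) \<partial>lborel)"
    using Suc.IH[OF derivative_chain_shift_difference[OF Suc.prems(1), of "\<tau> *\<^sub>R e"]] Suc.prems(2) by simp
  also have "\<dots> \<le> ennreal (\<tau> ^ k) * (ennreal \<tau> * (\<integral>\<^sup>+\<xi>. ennreal (norm (U (Suc k) \<xi>)) \<partial>lborel))"
    by (intro mult_left_mono nn_integral_shift_difference_le[OF Suc.prems(1) _ \<tau>]) (use Suc.prems(2) in auto)
  also have "\<dots> = ennreal (\<tau> ^ Suc k) * (\<integral>\<^sup>+\<xi>. ennreal (norm (U (Suc k) \<xi>)) \<partial>lborel)"
    using \<tau> by (simp add: mult.assoc[symmetric] ennreal_mult[symmetric] mult.commute)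
  finally show ?case by (simp only: funpow_Suc_right o_apply)
qed simp

text \<open>Integration by parts would require boundary terms to vanish. Instead, an \<open>r\<close>-fold
  difference with step \<open>\<tau>\<close> multiplies the Fourier integral by
  \<open>(fourier_char (- \<tau> * (x \<bullet> e)) - 1) ^ r\<close> and has \<open>L\<^sup>1\<close> norm at most \<open>\<tau> ^ r\<close> times that of
  \<open>U r\<close>; divide by \<open>\<tau> ^ r\<close> and let \<open>\<tau>\<close> tend to 0.\<close>

theorem fourier_integral_decay:
  fixes e :: "'a::euclidean_space"
  assumes U: "derivative_chain e r U" and int: "integrable lborel (U 0)"
  shows "ennreal ((2 * pi * \<bar>x \<bullet> e\<bar>) ^ r * norm (LINT \<xi>|lborel. U 0 \<xi> * fourier_char (x \<bullet> \<xi>))) \<le> (\<integral>\<^sup>+\<xi>. ennreal (norm (U r \<xi>)) \<partial>lborel)"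
proof (cases "\<integral>\<^sup>+\<xi>. ennreal (norm (U r \<xi>)) \<partial>lborel")
  case (real J)
  let ?V = "LINT \<xi>|lborel. U 0 \<xi> * fourier_char (x \<bullet> \<xi>)"
  define c where "c \<tau> = norm (fourier_char (- (x \<bullet> (\<tau> *\<^sub>R e))) - 1) / \<tau>" for \<tau>
  have bound: "(c \<tau>) ^ r * norm ?V \<le> J" if \<tau>: "0 < \<tau>" for \<tau>
  proof -
    have D: "integrable lborel ((shift_difference (\<tau> *\<^sub>R e) ^^ r) (U 0))" by (rule integrable_shift_difference_power[OF int])
    then have [measurable]: "(shift_difference (\<tau> *\<^sub>R e) ^^ r) (U 0) \<in> borel_measurable borel" by (simp add: integrable_iff_bounded)
    have Di: "integrable lborel (\<lambda>\<xi>. (shift_difference (\<tau> *\<^sub>R e) ^^ r) (U 0) \<xi> * fourier_char (x \<bullet> \<xi>))"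
      by (rule Bochner_Integration.integrable_bound[OF D]) (auto simp: norm_mult)
    have "ennreal (norm (fourier_char (- (x \<bullet> (\<tau> *\<^sub>R e))) - 1) ^ r * norm ?V) = ennreal (norm (LINT \<xi>|lborel. (shift_difference (\<tau> *\<^sub>R e) ^^ r) (U 0) \<xi> * fourier_char (x \<bullet> \<xi>)))"
      by (simp only: fourier_shift_difference[OF int] norm_mult norm_power)
    also have "\<dots> \<le> (\<integral>\<^sup>+\<xi>. ennreal (norm ((shift_difference (\<tau> *\<^sub>R e) ^^ r) (U 0) \<xi> * fourier_char (x \<bullet> \<xi>))) \<partial>lborel)"
      by (rule integral_norm_bound_ennreal[OF Di])
    also have "\<dots> = (\<integral>\<^sup>+\<xi>. ennreal (norm ((shift_difference (\<tau> *\<^sub>R e) ^^ r) (U 0) \<xi>)) \<partial>lborel)"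
      by (simp add: norm_mult)
    also have "\<dots> \<le> ennreal (\<tau> ^ r) * ennreal J"
      using nn_integral_shift_difference_power_le[OF U less_imp_le[OF \<tau>] order_refl] real by simp
    finally have "norm (fourier_char (- (x \<bullet> (\<tau> *\<^sub>R e))) - 1) ^ r * norm ?V \<le> \<tau> ^ r * J"
      using \<tau> real by (simp add: ennreal_mult[symmetric])
    then show ?thesis using \<tau> by (simp add: c_def power_divide field_simps)
  qed
  have lim: "(c \<longlongrightarrow> 2 * pi * \<bar>x \<bullet> e\<bar>) (at_right 0)"
  proof -
    let ?b = "pi * (x \<bullet> e)"
    have c_eq: "c \<tau> = 2 * \<bar>sin (?b * \<tau>) / \<tau>\<bar>" if "0 < \<tau>" for \<tau>
    proof -
      have "fourier_char (- (x \<bullet> (\<tau> *\<^sub>R e))) = exp (\<i> * of_real (- (2 * (?b * \<tau>))))"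
        unfolding fourier_char_def by (simp add: ac_simps)
      then have "norm (fourier_char (- (x \<bullet> (\<tau> *\<^sub>R e))) - 1) = 2 * \<bar>sin (- (2 * (?b * \<tau>)) / 2)\<bar>"
        by (simp only: dist_exp_i_1)
      then show ?thesis using that by (simp add: c_def abs_divide)
    qed
    have "((\<lambda>\<tau>. sin (?b * \<tau>)) has_real_derivative ?b) (at 0)"
      by (auto intro!: derivative_eq_intros)
    then have "((\<lambda>\<tau>. sin (?b * \<tau>) / \<tau>) \<longlongrightarrow> ?b) (at 0)"
      by (simp add: has_field_derivative_iff)
    then have "((\<lambda>\<tau>. 2 * \<bar>sin (?b * \<tau>) / \<tau>\<bar>) \<longlongrightarrow> 2 * \<bar>?b\<bar>) (at_right 0)"
      by (intro tendsto_intros) (auto intro: filterlim_mono at_le)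
    moreover have "2 * \<bar>?b\<bar> = 2 * pi * \<bar>x \<bullet> e\<bar>" by (simp add: abs_mult)
    ultimately have "((\<lambda>\<tau>. 2 * \<bar>sin (?b * \<tau>) / \<tau>\<bar>) \<longlongrightarrow> 2 * pi * \<bar>x \<bullet> e\<bar>) (at_right 0)" by simp
    then show ?thesis
    proof (rule Lim_transform_eventually)
      show "\<forall>\<^sub>F \<tau> in at_right 0. 2 * \<bar>sin (?b * \<tau>) / \<tau>\<bar> = c \<tau>"
        unfolding eventually_at_right_field by (intro exI[of _ 1]) (auto simp: c_eq)
    qed
  qed
  have "((\<lambda>\<tau>. (c \<tau>) ^ r * norm ?V) \<longlongrightarrow> (2 * pi * \<bar>x \<bullet> e\<bar>) ^ r * norm ?V) (at_right 0)"
    by (intro tendsto_intros lim)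
  then have "(2 * pi * \<bar>x \<bullet> e\<bar>) ^ r * norm ?V \<le> J"
  proof (rule tendsto_upperbound)
    show "\<forall>\<^sub>F \<tau> in at_right 0. (c \<tau>) ^ r * norm ?V \<le> J"
      unfolding eventually_at_right_field by (intro exI[of _ 1]) (auto intro: bound)
  qed simp
  then show ?thesis using real by simp
qed simp

section \<open>Smooth bump functions\<close>

text \<open>The \<open>n\<close>-th derivative of \<open>U a * V b\<close>, when \<open>U\<close> and \<open>V\<close> list successive derivatives.
  Expanding one order at a time avoids the binomial coefficients of Leibniz' formula, whose
  sum \<open>2\<^sup>n\<close> is all that the estimates use.\<close>

primrec product_derivative ::
  "(nat \<Rightarrow> 'x \<Rightarrow> 'b::semiring_0) \<Rightarrow> (nat \<Rightarrow> 'x \<Rightarrow> 'b) \<Rightarrow> nat \<Rightarrow> nat \<Rightarrow> nat \<Rightarrow> 'x \<Rightarrow> 'b" where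
  "product_derivative U V 0 a b = (\<lambda>x. U a x * V b x)"
| "product_derivative U V (Suc n) a b =
     (\<lambda>x. product_derivative U V n (Suc a) b x + product_derivative U V n a (Suc b) x)"

lemma product_derivative_eq_0:
  assumes "(\<forall>a. U a x = 0) \<or> (\<forall>b. V b x = 0)"
  shows "product_derivative U V n a b x = 0"
  using assms by (induction n arbitrary: a b) auto

text \<open>A smooth function together with the list of its derivatives.\<close>

definition smooth_chain :: "(nat \<Rightarrow> real \<Rightarrow> real) \<Rightarrow> bool" where
  "smooth_chain b \<longleftrightarrow> (\<forall>n x. (b n has_real_derivative b (Suc n) x) (at x))"

lemma smooth_chain_product:
  assumes "smooth_chain U" "smooth_chain V"
  shows "smooth_chain (\<lambda>n. product_derivative U V n 0 0)"
proof -
  have "(product_derivative U V n a b has_real_derivative product_derivative U V (Suc n) a b x) (at x)" for n a b x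
  proof (induction n arbitrary: a b)
    case 0
    have "(U a has_real_derivative U (Suc a) x) (at x)" "(V b has_real_derivative V (Suc b) x) (at x)"
      using assms unfolding smooth_chain_def by auto
    from DERIV_mult[OF this] show ?case by (simp add: add.commute mult.commute)
  next
    case (Suc n)
    from DERIV_add[OF Suc[of "Suc a" b] Suc[of a "Suc b"]] show ?case by simp
  qed
  then show ?thesis unfolding smooth_chain_def by blast
qed

lemma smooth_chain_affine:
  assumes "smooth_chain b"
  shows "smooth_chain (\<lambda>n x. c ^ n * b n (c * x + d))"
  unfolding smooth_chain_def
proof (intro allI)
  fix n x
  have d1: "(b n has_real_derivative b (Suc n) (c * x + d)) (at (c * x + d))"
    using assms unfolding smooth_chain_def by simp
  have d2: "((\<lambda>x. c * x + d) has_real_derivative c) (at x)" by (auto intro!: derivative_eq_intros)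
  have "((\<lambda>x. b n (c * x + d)) has_real_derivative b (Suc n) (c * x + d) * c) (at x)"
    by (rule DERIV_chain2[OF d1 d2])
  from DERIV_cmult[OF this, of "c ^ n"]
  show "((\<lambda>x. c ^ n * b n (c * x + d)) has_real_derivative c ^ Suc n * b (Suc n) (c * x + d)) (at x)"
    by (simp add: ac_simps)
qed

text \<open>Differentiating \<open>P(1/x) exp (-1/x)\<close> replaces \<open>P(y)\<close> by \<open>y\<^sup>2 (P(y) - P'(y))\<close>.\<close>

primrec exp_inverse_poly :: "nat \<Rightarrow> real poly" where
  "exp_inverse_poly 0 = 1"
| "exp_inverse_poly (Suc n) = monom 1 2 * (exp_inverse_poly n - pderiv (exp_inverse_poly n))"

text \<open>The \<open>n\<close>-th derivative of the function \<open>exp (-1/x)\<close> on the positive half line, extended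
  by 0.\<close>

definition exp_inverse :: "nat \<Rightarrow> real \<Rightarrow> real" where
  "exp_inverse n x = (if 0 < x then poly (exp_inverse_poly n) (1 / x) * exp (- (1 / x)) else 0)"

lemma poly_div_exp_tendsto_0: "((\<lambda>y::real. poly p y / exp y) \<longlongrightarrow> 0) at_top"
proof -
  have "((\<lambda>y. \<Sum>i\<le>degree p. coeff p i * (y ^ i / exp y)) \<longlongrightarrow> (\<Sum>i\<le>degree p. coeff p i * 0)) at_top"
    by (intro tendsto_intros tendsto_power_div_exp_0)
  moreover have "(\<Sum>i\<le>degree p. coeff p i * (y ^ i / exp y)) = poly p y / exp y" for y
    by (simp add: poly_altdef sum_divide_distrib)
  ultimately show ?thesis by simp
qed

text \<open>Away from 0 this is the chain rule. At 0 the difference quotient from the right is a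
  polynomial in \<open>y = 1/h\<close> divided by \<open>exp y\<close>.\<close>

lemma smooth_chain_exp_inverse: "smooth_chain exp_inverse"
  unfolding smooth_chain_def
proof (intro allI)
  fix n and x :: real
  let ?p = "exp_inverse_poly n"
  consider "x < 0" | "x > 0" | "x = 0" by linarith
  then show "(exp_inverse n has_real_derivative exp_inverse (Suc n) x) (at x)"
  proof cases
    case 1
    have "((\<lambda>_. 0) has_real_derivative exp_inverse (Suc n) x) (at x)" using 1 by (simp add: exp_inverse_def)
    then show ?thesis
      by (rule has_field_derivative_transform_within_open[of _ _ _ "{..<0}"]) (use 1 in \<open>auto simp: exp_inverse_def\<close>)
  next
    case 2
    have "((\<lambda>x. poly ?p (1 / x) * exp (- (1 / x))) has_real_derivative
        poly (pderiv ?p) (1 / x) * (- (1 / x\<^sup>2)) * exp (- (1 / x)) + poly ?p (1 / x) * (exp (- (1 / x)) * (1 / x\<^sup>2))) (at x)"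
    proof -
      have d: "((\<lambda>x. 1 / x) has_real_derivative - (1 / x\<^sup>2)) (at x)"
        using 2 by (auto intro!: derivative_eq_intros simp: power2_eq_square)
      have e: "((\<lambda>x. exp (- (1 / x))) has_real_derivative exp (- (1 / x)) * (1 / x\<^sup>2)) (at x)"
        using DERIV_chain2[OF DERIV_exp DERIV_minus[OF d]] by simp
      from DERIV_mult'[OF DERIV_chain2[OF poly_DERIV d] e] show ?thesis by (simp add: add.commute)
    qed
    also have "poly (pderiv ?p) (1 / x) * (- (1 / x\<^sup>2)) * exp (- (1 / x)) + poly ?p (1 / x) * (exp (- (1 / x)) * (1 / x\<^sup>2)) = exp_inverse (Suc n) x"
      using 2 by (simp add: exp_inverse_def poly_monom algebra_simps power_divide)
    finally show ?thesis
      by (rule has_field_derivative_transform_within_open[of _ _ _ "{0<..}"]) (use 2 in \<open>auto simp: exp_inverse_def\<close>)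
  next
    case 3
    have right: "((\<lambda>h. exp_inverse n h / h) \<longlongrightarrow> 0) (at_right 0)"
    proof -
      have "((\<lambda>h::real. poly (?p * monom 1 1) (inverse h) / exp (inverse h)) \<longlongrightarrow> 0) (at_right 0)"
        by (rule filterlim_compose[OF poly_div_exp_tendsto_0 filterlim_inverse_at_top_right])
      moreover have "\<forall>\<^sub>F h in at_right 0. poly (?p * monom 1 1) (inverse h) / exp (inverse h) = exp_inverse n h / h"
        unfolding eventually_at_right_field
        by (intro exI[of _ 1]) (auto simp: exp_inverse_def poly_monom exp_minus field_simps)
      ultimately show ?thesis by (rule Lim_transform_eventually)
    qed
    have left: "((\<lambda>h. exp_inverse n h / h) \<longlongrightarrow> 0) (at_left 0)"
    proof (rule tendsto_eventually)
      show "\<forall>\<^sub>F h in at_left 0. exp_inverse n h / h = 0"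
        unfolding eventually_at_left_field by (intro exI[of _ "-1"]) (auto simp: exp_inverse_def)
    qed
    have "((\<lambda>h. exp_inverse n h / h) \<longlongrightarrow> 0) (at 0)"
      using left right by (simp add: filterlim_at_split)
    then show ?thesis using 3 by (simp add: has_field_derivative_iff exp_inverse_def)
  qed
qed

text \<open>The derivatives of \<open>exp_inverse 0 (1 - x) * exp_inverse 0 (1 + x)\<close>, which is supported
  in \<open>[-1, 1]\<close>. The trivial factors have the shape of \<open>smooth_chain_affine\<close>.\<close>

definition bump :: "nat \<Rightarrow> real \<Rightarrow> real" where
  "bump n = product_derivative (\<lambda>n x. (- 1) ^ n * exp_inverse n (- 1 * x + 1)) (\<lambda>n x. 1 ^ n * exp_inverse n (1 * x + 1)) n 0 0"

lemma smooth_chain_bump: "smooth_chain bump"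
  unfolding bump_def[abs_def]
  by (intro smooth_chain_product smooth_chain_affine smooth_chain_exp_inverse)

lemma bump_eq_0: "1 \<le> \<bar>x\<bar> \<Longrightarrow> bump n x = 0"
  unfolding bump_def by (rule product_derivative_eq_0) (auto simp: exp_inverse_def abs_if split: if_splits)

lemma bump_nonneg: "0 \<le> bump 0 x"
  by (simp add: bump_def exp_inverse_def)

lemma bump_zero_pos: "0 < bump 0 0"
  by (simp add: bump_def exp_inverse_def)

lemma smooth_chain_continuous: "smooth_chain b \<Longrightarrow> continuous_on S (b n)"
  unfolding smooth_chain_def by (intro continuous_at_imp_continuous_on ballI) (metis DERIV_isCont)

section \<open>Product test functions\<close>

text \<open>The mixed partial derivative of order \<open>\<alpha>\<close> of the product of the functions \<open>B j 0\<close>,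
  each in its own coordinate. For these functions partial derivatives commute by
  construction.\<close>

definition tensor :: "('n::finite \<Rightarrow> nat \<Rightarrow> real \<Rightarrow> real) \<Rightarrow> ('n \<Rightarrow> nat) \<Rightarrow> real ^ 'n \<Rightarrow> complex" where
  "tensor B \<alpha> y = complex_of_real (\<Prod>j\<in>UNIV. B j (\<alpha> j) (y $ j))"

lemma tensor_shift: "tensor B (\<alpha>(i := Suc (\<alpha> i))) = tensor (B(i := \<lambda>n. B i (Suc n))) \<alpha>"
  by (rule ext) (auto simp: tensor_def intro!: prod.cong)

lemma tensor_partial_derivative:
  fixes B :: "'n::finite \<Rightarrow> nat \<Rightarrow> real \<Rightarrow> real"
  assumes "\<And>j. smooth_chain (B j)"
  shows "((\<lambda>u. tensor B \<alpha> (y + u *\<^sub>R axis i 1)) has_vector_derivative tensor B (\<alpha>(i := Suc (\<alpha> i))) (y + t *\<^sub>R axis i 1)) (at t)"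
proof -
  define R where "R = (\<Prod>j\<in>UNIV - {i}. B j (\<alpha> j) (y $ j))"
  have comp: "(y + u *\<^sub>R axis i 1) $ j = (if j = i then y $ i + u else y $ j)" for u j by (simp add: axis_def)
  have split: "(\<Prod>j\<in>UNIV. B j (\<beta> j) ((y + u *\<^sub>R axis i 1) $ j)) = B i (\<beta> i) (y $ i + u) * (\<Prod>j\<in>UNIV - {i}. B j (\<beta> j) (y $ j))" for \<beta> u
    unfolding comp by (subst prod.remove[of _ i]) (auto intro!: prod.cong)
  have d1: "(B i (\<alpha> i) has_real_derivative B i (Suc (\<alpha> i)) (y $ i + t)) (at (y $ i + t))"
    using assms[of i] unfolding smooth_chain_def by simp
  have d2: "((\<lambda>u. y $ i + u) has_real_derivative 1) (at t)" by (auto intro!: derivative_eq_intros)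
  from DERIV_chain2[OF d1 d2]
  have "((\<lambda>u. B i (\<alpha> i) (y $ i + u)) has_real_derivative B i (Suc (\<alpha> i)) (y $ i + t)) (at t)" by simp
  then have "((\<lambda>u. B i (\<alpha> i) (y $ i + u) * R) has_real_derivative B i (Suc (\<alpha> i)) (y $ i + t) * R) (at t)"
    by (rule DERIV_cmult_right)
  from has_vector_derivative_of_real[OF this]
  have "((\<lambda>u. complex_of_real (B i (\<alpha> i) (y $ i + u) * R)) has_vector_derivative complex_of_real (B i (Suc (\<alpha> i)) (y $ i + t) * R)) (at t)" .
  moreover have "(\<Prod>j\<in>UNIV - {i}. B j ((\<alpha>(i := Suc (\<alpha> i))) j) (y $ j)) = R"
    unfolding R_def by (rule prod.cong) auto
  ultimately show ?thesis unfolding tensor_def split R_def[symmetric] by simp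
qed

lemma partials_tensor:
  fixes B :: "'n::finite \<Rightarrow> nat \<Rightarrow> real \<Rightarrow> real"
  assumes "\<And>j. smooth_chain (B j)"
  shows "partials is (tensor B (\<lambda>_. 0)) = tensor B (count_list is)"
proof (induction "is")
  case (Cons i "is")
  have pt: "partial i (tensor B (count_list is)) x = tensor B ((count_list is)(i := Suc (count_list is i))) x" for x
    unfolding partial_def
    using vector_derivative_at[OF tensor_partial_derivative[OF assms, where \<alpha>="count_list is" and y=x and i=i and t=0]] by simp
  have upd: "(count_list is)(i := Suc (count_list is i)) = count_list (i # is)" by auto
  have "partials (i # is) (tensor B (\<lambda>_. 0)) = partial i (tensor B (count_list is))"
    using Cons by (simp add: partials_def)
  also have "\<dots> = tensor B (count_list (i # is))" by (rule ext) (simp only: pt upd)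
  finally show ?case .
qed (auto simp: partials_def)

lemma tensor_differentiable:
  fixes B :: "'n::finite \<Rightarrow> nat \<Rightarrow> real \<Rightarrow> real"
  assumes "\<And>j. smooth_chain (B j)"
  shows "tensor B \<alpha> differentiable_on UNIV"
proof -
  have "(\<lambda>y. B j (\<alpha> j) (y $ j)) differentiable (at y)" for j and y :: "real ^ 'n"
  proof -
    have "(B j (\<alpha> j) has_derivative (*) (B j (Suc (\<alpha> j)) (y $ j))) (at (y $ j))"
      using assms[of j] unfolding smooth_chain_def has_field_derivative_def by blast
    moreover have "((\<lambda>y :: real ^ 'n. y $ j) has_derivative (\<lambda>v. v $ j)) (at y)"
      by (rule bounded_linear_imp_has_derivative) (rule bounded_linear_vec_nth)
    ultimately have "((\<lambda>y. B j (\<alpha> j) (y $ j)) has_derivative (\<lambda>v. B j (Suc (\<alpha> j)) (y $ j) * v $ j)) (at y)"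
      using has_derivative_compose by blast
    then show ?thesis unfolding differentiable_def by blast
  qed
  then have "\<exists>D. ((\<lambda>y. B j (\<alpha> j) (y $ j)) has_derivative D) (at y)" for j and y :: "real ^ 'n"
    unfolding differentiable_def by blast
  then obtain D where D: "\<And>j y :: real ^ 'n. ((\<lambda>y. B j (\<alpha> j) (y $ j)) has_derivative D j y) (at y)" by metis
  have "tensor B \<alpha> differentiable (at y)" for y
  proof -
    have "((\<lambda>y. \<Prod>j\<in>UNIV. B j (\<alpha> j) (y $ j)) has_derivative (\<lambda>v. \<Sum>i\<in>UNIV. D i y v * (\<Prod>j\<in>UNIV - {i}. B j (\<alpha> j) (y $ j)))) (at y)"
      by (rule has_derivative_prod) (rule D)
    from has_derivative_of_real[OF this] show ?thesis
      unfolding differentiable_def tensor_def by blast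
  qed
  then show ?thesis by (simp add: differentiable_on_def differentiable_at_withinI)
qed

lemma test_function_tensor:
  fixes B :: "'n::finite \<Rightarrow> nat \<Rightarrow> real \<Rightarrow> real"
  assumes B: "\<And>j. smooth_chain (B j)" and supp: "\<And>j n x. R \<le> \<bar>x\<bar> \<Longrightarrow> B j n x = 0"
  shows "test_function (tensor B (\<lambda>_. 0))"
  unfolding test_function_def
proof (intro conjI allI)
  show "partials is (tensor B (\<lambda>_. 0)) differentiable_on UNIV" for "is"
    by (simp add: partials_tensor[OF B] tensor_differentiable[OF B])
  have "{x. tensor B (\<lambda>_. 0) x \<noteq> 0} \<subseteq> cbox (\<chi> j. - R) (\<chi> j. R)"
  proof
    fix x assume "x \<in> {x. tensor B (\<lambda>_. 0) x \<noteq> 0}"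
    then have "B j 0 (x $ j) \<noteq> 0" for j by (simp add: tensor_def)
    then have "\<bar>x $ j\<bar> < R" for j using supp[of "x $ j" j 0] by force
    then show "x \<in> cbox (\<chi> j. - R) (\<chi> j. R)"
      by (auto simp: mem_box_cart abs_less_iff less_imp_le) (metis less_imp_le minus_less_iff)
  qed
  then have "closure {x. tensor B (\<lambda>_. 0) x \<noteq> 0} \<subseteq> cbox (\<chi> j. - R) (\<chi> j. R)"
    by (rule closure_minimal) (rule closed_cbox)
  then show "compact (closure {x. tensor B (\<lambda>_. 0) x \<noteq> 0})"
    by (metis bounded_cbox bounded_subset closed_closure compact_eq_bounded_closed)
qed

lemma exists_list_with_counts:
  fixes \<alpha> :: "'n::finite \<Rightarrow> nat"
  shows "\<exists>is. \<forall>i. count_list is i = \<alpha> i"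
proof -
  obtain xs :: "'n list" where xs: "set xs = UNIV" "distinct xs"
    using finite_distinct_list[of "UNIV :: 'n set"] by auto
  have cr: "count_list (replicate n x) i = (if x = i then n else 0)" for n and x i :: 'n
    by (induction n) auto
  have "count_list (concat (map (\<lambda>i. replicate (\<alpha> i) i) ys)) i = (if i \<in> set ys then \<alpha> i else 0)" if "distinct ys" for ys i
    using that by (induction ys) (auto simp: cr)
  from this[OF xs(2)] show ?thesis using xs(1) by auto
qed

text \<open>The derivative depends only on how often each coordinate occurs in the list, hence not
  on the order of differentiation that was chosen.\<close>

lemma multi_deriv_tensor:
  fixes B :: "'n::finite \<Rightarrow> nat \<Rightarrow> real \<Rightarrow> real"
  assumes "\<And>j. smooth_chain (B j)"
  shows "multi_deriv \<alpha> (tensor B (\<lambda>_. 0)) = tensor B \<alpha>"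
proof -
  have "\<forall>i. count_list (SOME is. \<forall>i. count_list is i = \<alpha> i) i = \<alpha> i"
    by (rule someI_ex[OF exists_list_with_counts])
  then have "count_list (SOME is. \<forall>i. count_list is i = \<alpha> i) = \<alpha>" by auto
  then show ?thesis unfolding multi_deriv_def by (simp add: partials_tensor[OF assms])
qed

lemma multi_order_count_list: "multi_order (count_list is) = length is"
proof (induction "is")
  case (Cons i "is")
  have "multi_order (count_list (i # is)) = (\<Sum>j\<in>UNIV. count_list is j + (if j = i then 1 else 0))"
    unfolding multi_order_def by (rule sum.cong) auto
  then show ?case using Cons by (simp add: sum.distrib multi_order_def)
qed (simp add: multi_order_def)

section \<open>Mollification and regularity\<close>

text \<open>A bump of radius \<open>\<epsilon>\<close> around the \<open>j\<close>-th coordinate of \<open>x\<close>, with its derivatives.\<close>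

definition bump_at :: "real ^ 'n::finite \<Rightarrow> real \<Rightarrow> 'n \<Rightarrow> nat \<Rightarrow> real \<Rightarrow> real" where
  "bump_at x \<epsilon> j n y = (1 / \<epsilon>) ^ n * bump n ((1 / \<epsilon>) * y + (- (1 / \<epsilon>) * x $ j))"

lemma smooth_chain_bump_at: "smooth_chain (bump_at x \<epsilon> j)"
  unfolding bump_at_def[abs_def] by (rule smooth_chain_affine[OF smooth_chain_bump])

lemma bump_at_eq_0: "0 < \<epsilon> \<Longrightarrow> \<epsilon> \<le> \<bar>y - x $ j\<bar> \<Longrightarrow> bump_at x \<epsilon> j n y = 0"
proof -
  assume e: "0 < \<epsilon>" "\<epsilon> \<le> \<bar>y - x $ j\<bar>"
  have "(1 / \<epsilon>) * y + (- (1 / \<epsilon>) * x $ j) = (y - x $ j) / \<epsilon>" by (simp add: diff_divide_distrib)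
  then have "1 \<le> \<bar>(1 / \<epsilon>) * y + (- (1 / \<epsilon>) * x $ j)\<bar>" using e by (simp add: abs_divide)
  then show ?thesis unfolding bump_at_def by (simp add: bump_eq_0)
qed

lemma test_function_bump_at: "0 < \<epsilon> \<Longrightarrow> test_function (tensor (bump_at x \<epsilon>) (\<lambda>_. 0))"
proof (rule test_function_tensor[OF smooth_chain_bump_at])
  fix j n y assume e: "0 < \<epsilon>" and y: "norm x + \<epsilon> \<le> \<bar>y\<bar>"
  have "\<bar>x $ j\<bar> \<le> norm x" by (rule component_le_norm_cart)
  then show "bump_at x \<epsilon> j n y = 0" using y by (intro bump_at_eq_0[OF e]) linarith
qed

text \<open>Replacing one factor by its derivative gives again a product of smooth functions; this
  is how a derivative of a test function is used as a test function.\<close>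

lemma test_function_bump_at_shift:
  "0 < \<epsilon> \<Longrightarrow> test_function (tensor ((bump_at x \<epsilon>)(i := \<lambda>n. bump_at x \<epsilon> i (Suc n))) (\<lambda>_. 0))"
proof (rule test_function_tensor)
  show "smooth_chain (((bump_at x \<epsilon>)(i := \<lambda>n. bump_at x \<epsilon> i (Suc n))) j)" for j
    using smooth_chain_bump_at[of x \<epsilon>] unfolding smooth_chain_def by auto
  fix j n y assume e: "0 < \<epsilon>" and y: "norm x + \<epsilon> \<le> \<bar>y\<bar>"
  have "bump_at x \<epsilon> k m y = 0" for k m
  proof (rule bump_at_eq_0[OF e])
    show "\<epsilon> \<le> \<bar>y - x $ k\<bar>" using y component_le_norm_cart[of x k] by linarith
  qed
  then show "((bump_at x \<epsilon>)(i := \<lambda>n. bump_at x \<epsilon> i (Suc n))) j n y = 0" by simp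
qed

definition mollifier :: "real ^ 'n::finite \<Rightarrow> real" where
  "mollifier z = (\<Prod>j\<in>UNIV. bump 0 (z $ j))"

lemma continuous_on_mollifier: "continuous_on S f \<Longrightarrow> continuous_on S (\<lambda>x. mollifier (f x))"
  unfolding mollifier_def
  by (intro continuous_on_prod continuous_on_compose2[OF smooth_chain_continuous[OF smooth_chain_bump, of UNIV 0]] continuous_on_component) auto

lemma mollifier_nonneg: "0 \<le> mollifier z"
  unfolding mollifier_def by (intro prod_nonneg) (simp add: bump_nonneg)

lemma mollifier_nonzero_imp: "mollifier z \<noteq> 0 \<Longrightarrow> norm z \<le> real CARD('n)" for z :: "real ^ 'n::finite"
proof -
  assume "mollifier z \<noteq> 0"
  then have "bump 0 (z $ j) \<noteq> 0" for j unfolding mollifier_def by simp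
  then have "\<bar>z $ j\<bar> \<le> 1" for j using bump_eq_0[of "z $ j" 0] by force
  then have "(\<Sum>j\<in>UNIV. \<bar>z $ j\<bar>) \<le> (\<Sum>j\<in>(UNIV :: 'n set). 1)" by (intro sum_mono) auto
  then show ?thesis using norm_le_l1_cart[of z] by simp
qed

lemma lebesgue_integral_compact_support:
  fixes F :: "'a::euclidean_space \<Rightarrow> 'b::euclidean_space"
  assumes c: "continuous_on UNIV F" and 0: "\<And>x. x \<notin> cbox a b \<Longrightarrow> F x = 0"
  shows "integrable lborel F" "(LINT x|lborel. F x) = integral (cbox a b) F"
proof -
  have cc: "continuous_on (cbox a b) F" using c continuous_on_subset by blast
  have si: "set_integrable lborel (cbox a b) F"
    unfolding set_integrable_def by (rule borel_integrable_compact[OF compact_cbox cc])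
  have eq: "(\<lambda>x. indicator (cbox a b) x *\<^sub>R F x) = F" using 0 by (auto simp: indicator_def)
  show "integrable lborel F" using si unfolding set_integrable_def eq .
  show "(LINT x|lborel. F x) = integral (cbox a b) F"
    using set_borel_integral_eq_integral(2)[OF si] unfolding set_lebesgue_integral_def eq .
qed

lemma integrable_mollifier: "integrable lborel (mollifier :: real ^ 'n::finite \<Rightarrow> real)"
proof (rule lebesgue_integral_compact_support(1))
  show "continuous_on UNIV (mollifier :: real ^ 'n \<Rightarrow> real)"
    using continuous_on_mollifier[OF continuous_on_id] by simp
  fix z :: "real ^ 'n" assume "z \<notin> cbox (\<chi> j. -1) (\<chi> j. 1)"
  then obtain j where "\<not> (-1 \<le> z $ j \<and> z $ j \<le> 1)" by (auto simp: mem_box_cart)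
  then have "bump 0 (z $ j) = 0" by (intro bump_eq_0) linarith
  then show "mollifier z = 0" unfolding mollifier_def by (auto intro: prod_zero)
qed

definition mollifier_mass :: "'n::finite itself \<Rightarrow> real" where
  "mollifier_mass _ = (LINT z|lborel. mollifier (z :: real ^ 'n))"

text \<open>A nonnegative continuous function with integral 0 vanishes everywhere, but the
  mollifier is positive at 0.\<close>

lemma mollifier_mass_pos: "0 < mollifier_mass TYPE('n::finite)"
proof -
  have "mollifier_mass TYPE('n) \<noteq> 0"
  proof
    assume "mollifier_mass TYPE('n) = 0"
    then have "AE z in lborel. mollifier (z :: real ^ 'n) = 0"
      unfolding mollifier_mass_def
      by (subst (asm) integral_nonneg_eq_0_iff_AE[OF integrable_mollifier]) (simp_all add: mollifier_nonneg)
    moreover have "closed {z :: real ^ 'n. mollifier z = 0}"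
      by (intro closed_Collect_eq continuous_on_mollifier continuous_intros)
    ultimately have "\<forall>z :: real ^ 'n. mollifier z = 0"
      using mem_closed_if_AE_lebesgue[of "{z :: real ^ 'n. mollifier z = 0}"] AE_completion[of "\<lambda>z :: real ^ 'n. mollifier z = 0" lborel] by auto
    then have "mollifier (0 :: real ^ 'n) = 0" by blast
    then show False using bump_zero_pos by (simp add: mollifier_def)
  qed
  moreover have "0 \<le> mollifier_mass TYPE('n)"
    unfolding mollifier_mass_def by (intro Bochner_Integration.integral_nonneg) (simp add: mollifier_nonneg)
  ultimately show ?thesis by simp
qed

text \<open>The mollifier is not normalized: as \<open>\<epsilon>\<close> tends to 0 the limit is \<open>mollifier_mass\<close> times
  \<open>g x\<close>.\<close>

definition mollify :: "real \<Rightarrow> (real ^ 'n::finite \<Rightarrow> complex) \<Rightarrow> real ^ 'n \<Rightarrow> complex" where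
  "mollify \<epsilon> g x = (LINT z|lborel. g (x + \<epsilon> *\<^sub>R z) * mollifier z)"

lemma integrable_mollify:
  fixes g :: "real ^ 'n::finite \<Rightarrow> complex"
  assumes "continuous_on UNIV g"
  shows "integrable lborel (\<lambda>z. g (x + \<epsilon> *\<^sub>R z) * mollifier z)"
proof (rule lebesgue_integral_compact_support(1))
  show "continuous_on UNIV (\<lambda>z. g (x + \<epsilon> *\<^sub>R z) * mollifier z)"
    by (intro continuous_intros continuous_on_mollifier continuous_on_compose2[OF assms]) auto
  fix z :: "real ^ 'n" assume "z \<notin> cbox (\<chi> j. -1) (\<chi> j. 1)"
  then obtain j where "\<not> (-1 \<le> z $ j \<and> z $ j \<le> 1)" by (auto simp: mem_box_cart)
  then have "bump 0 (z $ j) = 0" by (intro bump_eq_0) linarith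
  then show "g (x + \<epsilon> *\<^sub>R z) * mollifier z = 0" unfolding mollifier_def by (auto intro: prod_zero)
qed

lemma mollify_close:
  fixes g :: "real ^ 'n::finite \<Rightarrow> complex" and K :: complex
  assumes g: "continuous_on UNIV g" and \<epsilon>: "0 \<le> \<epsilon>"
    and close: "\<And>y. dist y x \<le> \<epsilon> * real CARD('n) \<Longrightarrow> norm (g y - K) \<le> \<eta>"
  shows "norm (mollify \<epsilon> g x - mollifier_mass TYPE('n) * K) \<le> mollifier_mass TYPE('n) * \<eta>"
proof -
  have i2: "integrable lborel (\<lambda>z :: real ^ 'n. K * mollifier z)"
    by (intro integrable_mult_right integrable_of_real integrable_mollifier)
  have "mollify \<epsilon> g x - mollifier_mass TYPE('n) * K = (LINT z|lborel. g (x + \<epsilon> *\<^sub>R z) * mollifier z) - (LINT z|lborel. K * complex_of_real (mollifier (z :: real ^ 'n)))"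
    by (simp add: mollify_def mollifier_mass_def mult.commute)
  also have "\<dots> = (LINT z|lborel. g (x + \<epsilon> *\<^sub>R z) * mollifier z - K * mollifier z)"
    by (rule Bochner_Integration.integral_diff[symmetric, OF integrable_mollify[OF g] i2])
  also have "norm \<dots> \<le> (LINT z|lborel. mollifier (z :: real ^ 'n) * \<eta>)"
  proof (rule Bochner_Integration.integral_norm_bound_integral)
    show "integrable lborel (\<lambda>z. g (x + \<epsilon> *\<^sub>R z) * mollifier z - K * mollifier z)"
      by (rule Bochner_Integration.integrable_diff[OF integrable_mollify[OF g] i2])
    show "integrable lborel (\<lambda>z :: real ^ 'n. mollifier z * \<eta>)" by (intro integrable_mult_left integrable_mollifier)
    fix z :: "real ^ 'n"
    show "norm (g (x + \<epsilon> *\<^sub>R z) * mollifier z - K * mollifier z) \<le> mollifier z * \<eta>"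
    proof (cases "mollifier z = 0")
      case False
      then have "\<epsilon> * norm z \<le> \<epsilon> * real CARD('n)" using \<epsilon> mollifier_nonzero_imp by (intro mult_left_mono) auto
      then have "norm (g (x + \<epsilon> *\<^sub>R z) - K) \<le> \<eta>" using \<epsilon> by (intro close) (simp add: dist_norm)
      then have "norm (g (x + \<epsilon> *\<^sub>R z) - K) * mollifier z \<le> \<eta> * mollifier z" by (intro mult_right_mono mollifier_nonneg)
      moreover have "g (x + \<epsilon> *\<^sub>R z) * mollifier z - K * mollifier z = (g (x + \<epsilon> *\<^sub>R z) - K) * mollifier z"
        by (simp add: left_diff_distrib)
      ultimately show ?thesis using mollifier_nonneg[of z] by (simp add: norm_mult mult.commute)
    qed simp
  qed
  also have "\<dots> = mollifier_mass TYPE('n) * \<eta>" by (simp add: mollifier_mass_def)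
  finally show ?thesis .
qed

lemma mollify_tendsto:
  fixes g :: "real ^ 'n::finite \<Rightarrow> complex"
  assumes g: "continuous_on UNIV g"
  shows "((\<lambda>\<epsilon>. mollify \<epsilon> g x) \<longlongrightarrow> mollifier_mass TYPE('n) * g x) (at_right 0)"
proof (rule tendstoI)
  fix e :: real assume e: "0 < e"
  let ?m = "mollifier_mass TYPE('n)"
  have m: "0 < ?m" by (rule mollifier_mass_pos)
  have "isCont g x" using g by (simp add: continuous_on_eq_continuous_at)
  then obtain d where d: "0 < d" "\<And>y. dist y x < d \<Longrightarrow> dist (g y) (g x) < e / (2 * ?m)"
    using e m unfolding continuous_at_eps_delta by (metis divide_pos_pos mult_pos_pos zero_less_numeral)
  have "dist (mollify \<epsilon> g x) (?m * g x) < e" if "0 < \<epsilon>" "\<epsilon> < d / real CARD('n)" for \<epsilon>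
  proof -
    have "\<epsilon> * real CARD('n) < d" using that by (simp add: pos_less_divide_eq)
    then have "norm (g y - g x) \<le> e / (2 * ?m)" if "dist y x \<le> \<epsilon> * real CARD('n)" for y
      using d(2)[of y] that by (auto simp: dist_norm)
    from mollify_close[OF g less_imp_le[OF that(1)] this]
    have "norm (mollify \<epsilon> g x - ?m * g x) \<le> ?m * (e / (2 * ?m))" .
    also have "\<dots> < e" using m e by simp
    finally show ?thesis by (simp add: dist_norm)
  qed
  then show "\<forall>\<^sub>F \<epsilon> in at_right 0. dist (mollify \<epsilon> g x) (?m * g x) < e"
    unfolding eventually_at_right_field using d by (intro exI[of _ "d / real CARD('n)"]) auto
qed

lemma mollify_eq_tensor:
  fixes g :: "real ^ 'n::finite \<Rightarrow> complex"
  assumes g: "continuous_on UNIV g" and \<epsilon>: "0 < \<epsilon>"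
  shows "(LINT y|lborel. g y * tensor (bump_at x \<epsilon>) (\<lambda>_. 0) y) = complex_of_real (\<epsilon> ^ CARD('n)) * mollify \<epsilon> g x"
proof -
  have c: "continuous_on UNIV (tensor (bump_at x \<epsilon>) (\<lambda>_. 0))"
    by (rule differentiable_imp_continuous_on[OF tensor_differentiable[OF smooth_chain_bump_at]])
  have "(LINT y|lborel. g y * tensor (bump_at x \<epsilon>) (\<lambda>_. 0) y)
     = complex_of_real (\<bar>\<epsilon>\<bar> ^ CARD('n)) * (LINT z|lborel. g (x + \<epsilon> *\<^sub>R z) * tensor (bump_at x \<epsilon>) (\<lambda>_. 0) (x + \<epsilon> *\<^sub>R z))"
    using \<epsilon> by (subst lborel_integral_affine[where c=\<epsilon> and t=x]) (auto intro!: borel_measurable_continuous_onI continuous_intros g c)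
  moreover have "tensor (bump_at x \<epsilon>) (\<lambda>_. 0) (x + \<epsilon> *\<^sub>R z) = complex_of_real (mollifier z)" for z
    using \<epsilon> unfolding tensor_def mollifier_def by (auto intro!: prod.cong simp: bump_at_def algebra_simps)
  ultimately show ?thesis using \<epsilon> by (simp only: mollify_def abs_of_pos)
qed

lemma continuous_eq_of_test_integrals:
  fixes g u :: "real ^ 'n::finite \<Rightarrow> complex"
  assumes g: "continuous_on UNIV g" and u: "continuous_on UNIV u"
    and eq: "\<And>x \<epsilon>. 0 < \<epsilon> \<Longrightarrow> (LINT y|lborel. g y * tensor (bump_at x \<epsilon>) (\<lambda>_. 0) y) = (LINT y|lborel. u y * tensor (bump_at x \<epsilon>) (\<lambda>_. 0) y)"
  shows "g = u"
proof
  fix x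
  have e: "mollify \<epsilon> g x = mollify \<epsilon> u x" if "0 < \<epsilon>" for \<epsilon>
    using eq[OF that, of x] that by (simp add: mollify_eq_tensor g u)
  have "((\<lambda>\<epsilon>. mollify \<epsilon> g x) \<longlongrightarrow> mollifier_mass TYPE('n) * u x) (at_right 0)"
  proof (rule Lim_transform_eventually[OF mollify_tendsto[OF u]])
    show "\<forall>\<^sub>F \<epsilon> in at_right 0. mollify \<epsilon> u x = mollify \<epsilon> g x"
      unfolding eventually_at_right_field by (intro exI[of _ 1]) (auto simp: e)
  qed
  from tendsto_unique[OF _ mollify_tendsto[OF g] this] show "g x = u x"
    using mollifier_mass_pos[where 'n='n] by simp
qed

text \<open>The hypothesis \<open>weak\<close> says that \<open>k\<close> is the weak \<open>i\<close>-th partial derivative of \<open>g\<close>,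
  tested on bumps of radius \<open>\<epsilon>\<close>. The derivative of the mollified function falls on the bump,
  by differentiation under the integral, and \<open>weak\<close> moves it to \<open>k\<close>.\<close>

lemma mollify_has_derivative:
  fixes g k :: "real ^ 'n::finite \<Rightarrow> complex"
  assumes g: "continuous_on UNIV g" and k: "continuous_on UNIV k" and \<epsilon>: "0 < \<epsilon>" "\<epsilon> \<le> 1"
    and weak: "\<And>x. (LINT y|lborel. k y * tensor (bump_at x \<epsilon>) (\<lambda>_. 0) y) = - (LINT y|lborel. g y * tensor (bump_at x \<epsilon>) ((\<lambda>_. 0)(i := 1)) y)"
    and \<tau>: "\<tau> \<in> {-1..1}"
  shows "((\<lambda>\<tau>. mollify \<epsilon> g (x + \<tau> *\<^sub>R axis i 1)) has_vector_derivative mollify \<epsilon> k (x + \<tau> *\<^sub>R axis i 1)) (at \<tau> within {-1..1})"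
proof -
  let ?e = "axis i 1 :: real ^ 'n"
  let ?a = "x - (\<chi> j. 2)" and ?b = "x + (\<chi> j. 2)"
  let ?T = "tensor (bump_at x \<epsilon>)"
  have T_shift: "tensor (bump_at (x + \<tau> *\<^sub>R ?e) \<epsilon>) \<alpha> y = ?T \<alpha> (y - \<tau> *\<^sub>R ?e)" for \<alpha> y \<tau>
    unfolding tensor_def bump_at_def by (simp add: algebra_simps)
  have Tc: "continuous_on UNIV (?T \<alpha>)" for \<alpha>
    by (rule differentiable_imp_continuous_on[OF tensor_differentiable[OF smooth_chain_bump_at]])
  have T0: "?T \<alpha> (y - \<tau> *\<^sub>R ?e) = 0" if "y \<notin> cbox ?a ?b" "\<tau> \<in> {-1..1}" for \<alpha> y \<tau>
  proof -
    have "\<exists>j. \<not> (x $ j - 2 \<le> y $ j \<and> y $ j \<le> x $ j + 2)" using that(1) by (simp add: mem_box_cart)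
    then obtain j where j: "\<not> (x $ j - 2 \<le> y $ j \<and> y $ j \<le> x $ j + 2)" by blast
    have "\<bar>(\<tau> *\<^sub>R ?e) $ j\<bar> \<le> 1" using that(2) by (auto simp: axis_def)
    then have "\<epsilon> \<le> \<bar>(y - \<tau> *\<^sub>R ?e) $ j - x $ j\<bar>" using j \<epsilon> unfolding vector_minus_component by linarith
    then have "bump_at x \<epsilon> j (\<alpha> j) ((y - \<tau> *\<^sub>R ?e) $ j) = 0" by (rule bump_at_eq_0[OF \<epsilon>(1)])
    then show ?thesis unfolding tensor_def by (auto intro!: prod_zero)
  qed
  have cont: "continuous_on UNIV (\<lambda>y. F y * ?T \<alpha> (y - \<tau> *\<^sub>R ?e))" if "continuous_on UNIV F" for F :: "_ \<Rightarrow> complex" and \<alpha> \<tau>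
    by (intro continuous_intros that continuous_on_compose2[OF Tc]) auto
  have lint: "(LINT y|lborel. F y * ?T \<alpha> (y - \<tau> *\<^sub>R ?e)) = integral (cbox ?a ?b) (\<lambda>y. F y * ?T \<alpha> (y - \<tau> *\<^sub>R ?e))"
    if "continuous_on UNIV F" "\<tau> \<in> {-1..1}" for F :: "_ \<Rightarrow> complex" and \<alpha> \<tau>
    by (rule lebesgue_integral_compact_support(2)[OF cont[OF that(1)]]) (simp add: T0[OF _ that(2)])
  have "((\<lambda>\<tau>. integral (cbox ?a ?b) (\<lambda>y. g y * ?T (\<lambda>_. 0) (y - \<tau> *\<^sub>R ?e))) has_vector_derivative
      integral (cbox ?a ?b) (\<lambda>y. - (g y * ?T ((\<lambda>_. 0)(i := 1)) (y - \<tau> *\<^sub>R ?e)))) (at \<tau> within {-1..1})"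
  proof (rule leibniz_rule_vector_derivative[where fx="\<lambda>\<tau> y. - (g y * ?T ((\<lambda>_. 0)(i := 1)) (y - \<tau> *\<^sub>R ?e))"])
    fix \<tau> y assume "\<tau> \<in> {-1..1::real}" "y \<in> cbox ?a ?b"
    have "((\<lambda>u. ?T (\<lambda>_. 0) (y + u *\<^sub>R ?e)) has_vector_derivative ?T ((\<lambda>_. 0)(i := 1)) (y + (- \<tau>) *\<^sub>R ?e)) (at (- \<tau>))"
      using tensor_partial_derivative[OF smooth_chain_bump_at[of x \<epsilon>], where \<alpha>="\<lambda>_. 0" and y=y and i=i and t="- \<tau>"] by simp
    then have "((\<lambda>u. ?T (\<lambda>_. 0) (y + u *\<^sub>R ?e)) \<circ> uminus has_vector_derivative (-1) *\<^sub>R ?T ((\<lambda>_. 0)(i := 1)) (y + (- \<tau>) *\<^sub>R ?e)) (at \<tau>)"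
      by (intro vector_diff_chain_at) (auto intro!: derivative_eq_intros)
    then have "((\<lambda>\<tau>. ?T (\<lambda>_. 0) (y - \<tau> *\<^sub>R ?e)) has_vector_derivative - ?T ((\<lambda>_. 0)(i := 1)) (y - \<tau> *\<^sub>R ?e)) (at \<tau>)"
      by (simp add: o_def)
    from has_vector_derivative_mult_right[OF this, of "g y"]
    have "((\<lambda>\<tau>. g y * ?T (\<lambda>_. 0) (y - \<tau> *\<^sub>R ?e)) has_vector_derivative - (g y * ?T ((\<lambda>_. 0)(i := 1)) (y - \<tau> *\<^sub>R ?e))) (at \<tau>)" by simp
    then show "((\<lambda>\<tau>. g y * ?T (\<lambda>_. 0) (y - \<tau> *\<^sub>R ?e)) has_vector_derivative - (g y * ?T ((\<lambda>_. 0)(i := 1)) (y - \<tau> *\<^sub>R ?e))) (at \<tau> within {-1..1})"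
      by (rule has_vector_derivative_at_within)
  next
    fix \<tau> show "(\<lambda>y. g y * ?T (\<lambda>_. 0) (y - \<tau> *\<^sub>R ?e)) integrable_on cbox ?a ?b"
      by (rule integrable_continuous[OF continuous_on_subset[OF cont[OF g]]]) simp
  next
    have "continuous_on ({-1..1} \<times> cbox ?a ?b) (\<lambda>p. - (g (snd p) * ?T ((\<lambda>_. 0)(i := 1)) (snd p - fst p *\<^sub>R ?e)))"
      by (intro continuous_intros continuous_on_compose2[OF Tc] continuous_on_compose2[OF g]) auto
    then show "continuous_on ({-1..1} \<times> cbox ?a ?b) (\<lambda>(\<tau>, y). - (g y * ?T ((\<lambda>_. 0)(i := 1)) (y - \<tau> *\<^sub>R ?e)))"
      by (simp add: case_prod_beta')
  qed (use \<tau> in auto)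
  moreover have "integral (cbox ?a ?b) (\<lambda>y. - (g y * ?T ((\<lambda>_. 0)(i := 1)) (y - \<tau> *\<^sub>R ?e))) = complex_of_real (\<epsilon> ^ CARD('n)) * mollify \<epsilon> k (x + \<tau> *\<^sub>R ?e)"
    using mollify_eq_tensor[OF k \<epsilon>(1), of "x + \<tau> *\<^sub>R ?e"] weak[of "x + \<tau> *\<^sub>R ?e"] unfolding T_shift lint[OF g \<tau>] by simp
  ultimately have der: "((\<lambda>\<tau>. integral (cbox ?a ?b) (\<lambda>y. g y * ?T (\<lambda>_. 0) (y - \<tau> *\<^sub>R ?e))) has_vector_derivative
      complex_of_real (\<epsilon> ^ CARD('n)) * mollify \<epsilon> k (x + \<tau> *\<^sub>R ?e)) (at \<tau> within {-1..1})" by (simp only:)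
  have "((\<lambda>\<tau>. complex_of_real (\<epsilon> ^ CARD('n)) * mollify \<epsilon> g (x + \<tau> *\<^sub>R ?e)) has_vector_derivative complex_of_real (\<epsilon> ^ CARD('n)) * mollify \<epsilon> k (x + \<tau> *\<^sub>R ?e)) (at \<tau> within {-1..1})"
  proof (rule has_vector_derivative_transform[OF \<tau> _ der])
    fix \<tau> :: real assume "\<tau> \<in> {-1..1}"
    then show "complex_of_real (\<epsilon> ^ CARD('n)) * mollify \<epsilon> g (x + \<tau> *\<^sub>R ?e) = integral (cbox ?a ?b) (\<lambda>y. g y * ?T (\<lambda>_. 0) (y - \<tau> *\<^sub>R ?e))"
      using mollify_eq_tensor[OF g \<epsilon>(1), of "x + \<tau> *\<^sub>R ?e"] unfolding T_shift lint[OF g \<open>\<tau> \<in> {-1..1}\<close>] by simp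
  qed
  from has_vector_derivative_mult_right[OF this, of "1 / complex_of_real (\<epsilon> ^ CARD('n))"]
  show ?thesis using \<epsilon> by simp
qed

text \<open>Near \<open>x\<close> the derivative of \<open>mollify \<epsilon> g\<close> along the axis is \<open>mollify \<epsilon> k\<close>, which for
  small \<open>\<epsilon>\<close> is close to its value at \<open>x\<close>. The mean value inequality bounds the increments of
  \<open>mollify \<epsilon> g\<close> uniformly in \<open>\<epsilon>\<close>, and the bound survives the limit \<open>\<epsilon> \<rightarrow> 0\<close>.\<close>

theorem weak_derivative_imp_derivative:
  fixes g k :: "real ^ 'n::finite \<Rightarrow> complex"
  assumes g: "continuous_on UNIV g" and k: "continuous_on UNIV k"
    and weak: "\<And>x \<epsilon>. 0 < \<epsilon> \<Longrightarrow> (LINT y|lborel. k y * tensor (bump_at x \<epsilon>) (\<lambda>_. 0) y) = - (LINT y|lborel. g y * tensor (bump_at x \<epsilon>) ((\<lambda>_. 0)(i := 1)) y)"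
  shows "((\<lambda>u. g (x + u *\<^sub>R axis i 1)) has_vector_derivative k x) (at 0)"
proof -
  let ?e = "axis i 1 :: real ^ 'n" and ?m = "mollifier_mass TYPE('n)"
  have m: "0 < ?m" by (rule mollifier_mass_pos)
  have est: "\<exists>d>0. \<forall>\<tau>. norm (\<tau> - 0) < d \<longrightarrow> norm (g (x + \<tau> *\<^sub>R ?e) - g (x + 0 *\<^sub>R ?e) - (\<tau> - 0) *\<^sub>R k x) \<le> \<eta> * norm (\<tau> - 0)" if \<eta>: "0 < \<eta>" for \<eta>
  proof -
    have "isCont k x" using k by (simp add: continuous_on_eq_continuous_at)
    then obtain d where d: "0 < d" "\<And>y. dist y x < d \<Longrightarrow> dist (k y) (k x) < \<eta>"
      using \<eta> unfolding continuous_at_eps_delta by metis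
    have "norm (g (x + \<tau> *\<^sub>R ?e) - g x - \<tau> *\<^sub>R k x) \<le> \<eta> * \<bar>\<tau>\<bar>" if \<tau>: "\<bar>\<tau>\<bar> < min 1 (d / 2)" for \<tau>
    proof -
      let ?q = "d / (2 * real CARD('n))"
      have ev: "norm (mollify \<epsilon> g (x + \<tau> *\<^sub>R ?e) - mollify \<epsilon> g x - \<tau> *\<^sub>R (?m * k x)) \<le> ?m * \<eta> * \<bar>\<tau>\<bar>" if \<epsilon>: "0 < \<epsilon>" "\<epsilon> < min 1 ?q" for \<epsilon>
      proof -
        define \<phi> where "\<phi> t = mollify \<epsilon> g (x + t *\<^sub>R ?e) - t *\<^sub>R (?m * k x)" for t
        have der: "(\<phi> has_derivative (\<lambda>h. h *\<^sub>R (mollify \<epsilon> k (x + t *\<^sub>R ?e) - ?m * k x))) (at t within {-1..1})" if "t \<in> {-1..1}" for t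
        proof -
          have "((\<lambda>t. mollify \<epsilon> g (x + t *\<^sub>R ?e)) has_vector_derivative mollify \<epsilon> k (x + t *\<^sub>R ?e)) (at t within {-1..1})"
            by (rule mollify_has_derivative[OF g k \<epsilon>(1) _ weak[OF \<epsilon>(1)] that]) (use \<epsilon> in simp)
          moreover have "((\<lambda>t. t *\<^sub>R (?m * k x)) has_vector_derivative ?m * k x) (at t within {-1..1})"
            by (auto intro!: derivative_eq_intros)
          ultimately have "(\<phi> has_vector_derivative mollify \<epsilon> k (x + t *\<^sub>R ?e) - ?m * k x) (at t within {-1..1})"
            unfolding \<phi>_def by (rule has_vector_derivative_diff)
          then show ?thesis by (simp add: has_vector_derivative_def)
        qed
        let ?S = "closed_segment 0 \<tau>"
        have S: "?S \<subseteq> {-1..1}" using \<tau> by (auto simp: closed_segment_eq_real_ivl split: if_splits)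
        have "norm (\<phi> \<tau> - \<phi> 0) \<le> ?m * \<eta> * norm (\<tau> - 0)"
        proof (rule differentiable_bound[where S="?S" and f'="\<lambda>t h. h *\<^sub>R (mollify \<epsilon> k (x + t *\<^sub>R ?e) - ?m * k x)"])
          fix t assume t: "t \<in> ?S"
          then have "t \<in> {-1..1}" using S by blast
          then show "(\<phi> has_derivative (\<lambda>h. h *\<^sub>R (mollify \<epsilon> k (x + t *\<^sub>R ?e) - ?m * k x))) (at t within ?S)"
            using der has_derivative_subset[OF _ S] by blast
          have "\<bar>t\<bar> < d / 2" using t \<tau> by (auto simp: closed_segment_eq_real_ivl split: if_splits)
          have "norm (k y - k x) \<le> \<eta>" if "dist y (x + t *\<^sub>R ?e) \<le> \<epsilon> * real CARD('n)" for y
          proof -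
            have "\<epsilon> * real CARD('n) < d / 2" using \<epsilon> by (simp add: pos_less_divide_eq field_simps)
            moreover have "dist (x + t *\<^sub>R ?e) x = \<bar>t\<bar>" by (simp add: dist_norm norm_axis_1)
            ultimately have "dist y x < d" using that \<open>\<bar>t\<bar> < d / 2\<close> dist_triangle[of y x "x + t *\<^sub>R ?e"] by linarith
            then show ?thesis using d(2)[of y] by (simp add: dist_norm)
          qed
          from mollify_close[OF k less_imp_le[OF \<epsilon>(1)] this]
          have "norm (mollify \<epsilon> k (x + t *\<^sub>R ?e) - ?m * k x) \<le> ?m * \<eta>" .
          then show "onorm (\<lambda>h. h *\<^sub>R (mollify \<epsilon> k (x + t *\<^sub>R ?e) - ?m * k x)) \<le> ?m * \<eta>"
            using m \<eta> by (intro onorm_bound) (auto simp: mult.commute intro!: mult_left_mono)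
        qed auto
        then show ?thesis unfolding \<phi>_def by (simp add: algebra_simps)
      qed
      have lim: "((\<lambda>\<epsilon>. norm (mollify \<epsilon> g (x + \<tau> *\<^sub>R ?e) - mollify \<epsilon> g x - \<tau> *\<^sub>R (?m * k x)))
          \<longlongrightarrow> norm (?m * g (x + \<tau> *\<^sub>R ?e) - ?m * g x - \<tau> *\<^sub>R (?m * k x))) (at_right 0)"
        by (intro tendsto_intros mollify_tendsto[OF g])
      have "norm (?m * g (x + \<tau> *\<^sub>R ?e) - ?m * g x - \<tau> *\<^sub>R (?m * k x)) \<le> ?m * \<eta> * \<bar>\<tau>\<bar>"
      proof (rule tendsto_upperbound[OF lim])
        show "\<forall>\<^sub>F \<epsilon> in at_right 0. norm (mollify \<epsilon> g (x + \<tau> *\<^sub>R ?e) - mollify \<epsilon> g x - \<tau> *\<^sub>R (?m * k x)) \<le> ?m * \<eta> * \<bar>\<tau>\<bar>"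
          unfolding eventually_at_right_field using d by (intro exI[of _ "min 1 ?q"]) (auto intro!: ev)
      qed simp
      also have "?m * g (x + \<tau> *\<^sub>R ?e) - ?m * g x - \<tau> *\<^sub>R (?m * k x) = complex_of_real ?m * (g (x + \<tau> *\<^sub>R ?e) - g x - \<tau> *\<^sub>R k x)"
        by (simp add: algebra_simps)
      finally have "?m * norm (g (x + \<tau> *\<^sub>R ?e) - g x - \<tau> *\<^sub>R k x) \<le> ?m * (\<eta> * \<bar>\<tau>\<bar>)"
        using m by (simp add: norm_mult mult.assoc)
      then show ?thesis using m by simp
    qed
    then show ?thesis using d by (intro exI[of _ "min 1 (d / 2)"]) auto
  qed
  then show ?thesis
    unfolding has_vector_derivative_def has_derivative_at_alt
    by (intro conjI allI impI bounded_linear_scaleR_left) blast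
qed

text \<open>A product bump whose \<open>i\<close>-th factor is differentiated is itself a test function, so the
  distributional derivatives \<open>g \<alpha>\<close> and \<open>g (\<alpha> + e\<^sub>i)\<close> of \<open>u\<close> are related as a function and
  its weak \<open>i\<close>-th partial derivative. By induction on the list, the iterated partial
  derivatives of \<open>u\<close> exist and are the functions \<open>g\<close>.\<close>

theorem distributional_imp_classical:
  fixes u :: "real ^ 'n::finite \<Rightarrow> complex"
  assumes u: "continuous_on UNIV u"
    and dist: "\<And>\<alpha>. multi_order \<alpha> \<le> r \<Longrightarrow> continuous_on UNIV (g \<alpha>) \<and> distributional_deriv \<alpha> u (g \<alpha>)"
  shows "length is \<le> r \<Longrightarrow> partials is u = g (count_list is)"
    and "length is < r \<Longrightarrow> ((\<lambda>s. partials is u (x + s *\<^sub>R axis i 1)) has_vector_derivative partials (i # is) u x) (at 0)"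
proof -
  have test: "(LINT y|lborel. g \<alpha> y * tensor B (\<lambda>_. 0) y) = (- 1) ^ multi_order \<alpha> * (LINT y|lborel. u y * tensor B \<alpha> y)"
    if "multi_order \<alpha> \<le> r" "test_function (tensor B (\<lambda>_. 0))" "\<And>j. smooth_chain (B j)" for \<alpha> B
    using dist[OF that(1)] that(2) unfolding distributional_deriv_def by (simp add: multi_deriv_tensor[OF that(3)])
  have step: "((\<lambda>s. g (count_list is) (x + s *\<^sub>R axis i 1)) has_vector_derivative g (count_list (i # is)) x) (at 0)" if len: "length is < r" for "is" i x
  proof (rule weak_derivative_imp_derivative)
    let ?\<alpha> = "count_list is" and ?\<alpha>' = "count_list (i # is)"
    have o: "multi_order ?\<alpha> \<le> r" "multi_order ?\<alpha>' \<le> r" using len by (simp_all only: multi_order_count_list) auto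
    show "continuous_on UNIV (g ?\<alpha>)" "continuous_on UNIV (g ?\<alpha>')" using dist o by blast+
    fix x :: "real ^ 'n" and \<epsilon> :: real assume \<epsilon>: "0 < \<epsilon>"
    let ?B = "bump_at x \<epsilon>" and ?B' = "(bump_at x \<epsilon>)(i := \<lambda>n. bump_at x \<epsilon> i (Suc n))"
    have B': "smooth_chain (?B' j)" for j using smooth_chain_bump_at[of x \<epsilon>] unfolding smooth_chain_def by auto
    have upd: "?\<alpha>' = ?\<alpha>(i := Suc (?\<alpha> i))" by auto
    have "(LINT y|lborel. g ?\<alpha>' y * tensor ?B (\<lambda>_. 0) y) = (- 1) ^ Suc (length is) * (LINT y|lborel. u y * tensor ?B ?\<alpha>' y)"
      using test[OF o(2) test_function_bump_at[OF \<epsilon>] smooth_chain_bump_at] by (simp only: multi_order_count_list) simp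
    also have "(- 1) ^ Suc (length is) * (LINT y|lborel. u y * tensor ?B ?\<alpha>' y) = - (LINT y|lborel. g ?\<alpha> y * tensor ?B' (\<lambda>_. 0) y)"
      unfolding upd tensor_shift test[OF o(1) test_function_bump_at_shift[OF \<epsilon>] B'] by (simp add: multi_order_count_list)
    also have "tensor ?B' (\<lambda>_. 0) = tensor ?B ((\<lambda>_. 0)(i := 1))"
      using tensor_shift[of ?B "\<lambda>_. 0" i] by simp
    finally show "(LINT y|lborel. g ?\<alpha>' y * tensor ?B (\<lambda>_. 0) y) = - (LINT y|lborel. g ?\<alpha> y * tensor ?B ((\<lambda>_. 0)(i := 1)) y)" .
  qed
  have eq: "partials is u = g (count_list is)" if "length is \<le> r" for "is"
    using that
  proof (induction "is")
    case Nil
    have z: "multi_order (count_list ([] :: 'n list)) \<le> r" by (simp add: multi_order_def)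
    have "u = g (count_list [])"
    proof (rule continuous_eq_of_test_integrals[OF u])
      show "continuous_on UNIV (g (count_list []))" using dist[OF z] by blast
      fix x :: "real ^ 'n" and \<epsilon> :: real assume \<epsilon>: "0 < \<epsilon>"
      have "count_list ([] :: 'n list) = (\<lambda>_. 0)" by auto
      then show "(LINT y|lborel. u y * tensor (bump_at x \<epsilon>) (\<lambda>_. 0) y) = (LINT y|lborel. g (count_list []) y * tensor (bump_at x \<epsilon>) (\<lambda>_. 0) y)"
        using test[OF z test_function_bump_at[OF \<epsilon>] smooth_chain_bump_at] by (simp add: multi_order_def)
    qed
    then show ?case by (simp only: partials_def foldr.simps id_apply)
  next
    case (Cons i "is")
    then have "partials (i # is) u = partial i (g (count_list is))" by (simp add: partials_def)
    also have "\<dots> = g (count_list (i # is))"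
      unfolding partial_def using Cons.prems by (intro ext vector_derivative_at step) simp
    finally show ?case .
  qed
  then show "length is \<le> r \<Longrightarrow> partials is u = g (count_list is)" .
  assume len: "length is < r"
  then have "partials is u = g (count_list is)" "partials (i # is) u = g (count_list (i # is))"
    by (intro eq; simp)+
  then show "((\<lambda>s. partials is u (x + s *\<^sub>R axis i 1)) has_vector_derivative partials (i # is) u x) (at 0)"
    using step[OF len] by simp
qed

section \<open>Functions with continuous partial derivatives\<close>

definition partials_continuous :: "nat \<Rightarrow> (real ^ 'n::finite \<Rightarrow> complex) \<Rightarrow> bool" where
  "partials_continuous r u \<longleftrightarrow>
     (\<forall>is. length is \<le> r \<longrightarrow> continuous_on UNIV (partials is u)) \<and>
     (\<forall>is i x. length is < r \<longrightarrow>
        ((\<lambda>s. partials is u (x + s *\<^sub>R axis i 1)) has_vector_derivative partials (i # is) u x) (at 0))"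

text \<open>Move from \<open>z\<close> to \<open>x\<close> one coordinate at a time. All intermediate points are at least as
  close to \<open>z\<close> as \<open>x\<close> is, coordinate by coordinate.\<close>

lemma coordinate_mean_value:
  fixes F :: "real ^ 'n::finite \<Rightarrow> complex"
  assumes der: "\<And>i x. ((\<lambda>s. F (x + s *\<^sub>R axis i 1)) has_vector_derivative F' i x) (at 0)"
    and bd: "\<And>i y. norm (y - z) \<le> norm (x - z) \<Longrightarrow> norm (F' i y) \<le> M"
  shows "norm (F x - F z) \<le> M * (\<Sum>i\<in>UNIV. \<bar>x $ i - z $ i\<bar>)"
proof -
  define P where "P S = (\<chi> j. if j \<in> S then x $ j else z $ j)" for S
  have step: "norm (F (a + \<tau> *\<^sub>R axis i 1) - F a) \<le> M * \<bar>\<tau>\<bar>"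
    if "\<And>\<sigma>. \<bar>\<sigma>\<bar> \<le> \<bar>\<tau>\<bar> \<Longrightarrow> \<sigma> * \<tau> \<ge> 0 \<Longrightarrow> norm (F' i (a + \<sigma> *\<^sub>R axis i 1)) \<le> M" for a \<tau> i
  proof -
    have "((\<lambda>s. F (a + s *\<^sub>R axis i 1)) has_derivative (\<lambda>h. h *\<^sub>R F' i (a + t *\<^sub>R axis i 1))) (at t)" for t
    proof -
      have "((\<lambda>s. F ((a + t *\<^sub>R axis i 1) + s *\<^sub>R axis i 1)) has_vector_derivative F' i (a + t *\<^sub>R axis i 1)) (at (t - t))"
        using der[of "a + t *\<^sub>R axis i 1" i] by simp
      then have "((\<lambda>s. F ((a + t *\<^sub>R axis i 1) + s *\<^sub>R axis i 1)) \<circ> (\<lambda>s. s - t) has_vector_derivative 1 *\<^sub>R F' i (a + t *\<^sub>R axis i 1)) (at t)"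
        by (intro vector_diff_chain_at) (auto intro!: derivative_eq_intros)
      then show ?thesis by (simp add: o_def algebra_simps has_vector_derivative_def)
    qed
    then have "norm (F (a + \<tau> *\<^sub>R axis i 1) - F (a + 0 *\<^sub>R axis i 1)) \<le> M * norm (\<tau> - 0)"
    proof (intro differentiable_bound[where S="closed_segment 0 \<tau>" and f="\<lambda>s. F (a + s *\<^sub>R axis i 1)" and f'="\<lambda>t h. h *\<^sub>R F' i (a + t *\<^sub>R axis i 1)"])
      fix t assume t: "t \<in> closed_segment 0 \<tau>"
      then have "\<bar>t\<bar> \<le> \<bar>\<tau>\<bar>" "t * \<tau> \<ge> 0" by (auto simp: closed_segment_eq_real_ivl zero_le_mult_iff split: if_splits)
      then have le: "norm (F' i (a + t *\<^sub>R axis i 1)) \<le> M" by (rule that)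
      then have "0 \<le> M" using norm_ge_zero order_trans by blast
      then show "onorm (\<lambda>h. h *\<^sub>R F' i (a + t *\<^sub>R axis i 1)) \<le> M"
      proof (intro onorm_bound)
        show "norm (h *\<^sub>R F' i (a + t *\<^sub>R axis i 1)) \<le> M * norm h" for h
          using mult_right_mono[OF le, of "\<bar>h\<bar>"] by (simp add: mult.commute)
      qed
    qed (auto intro: has_derivative_at_withinI)
    then show ?thesis by simp
  qed
  have "norm (F (P S) - F z) \<le> M * (\<Sum>i\<in>S. \<bar>x $ i - z $ i\<bar>)" if "finite S" for S
    using that
  proof (induction S)
    case empty
    have "P {} = z" by (simp add: P_def vec_eq_iff)
    then show ?case by simp
  next
    case (insert i S)
    have eq: "P (insert i S) = P S + (x $ i - z $ i) *\<^sub>R axis i 1"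
      using insert.hyps by (simp add: P_def vec_eq_iff axis_def)
    have "norm (F (P S + (x $ i - z $ i) *\<^sub>R axis i 1) - F (P S)) \<le> M * \<bar>x $ i - z $ i\<bar>"
    proof (rule step, rule bd)
      fix \<sigma> assume \<sigma>: "\<bar>\<sigma>\<bar> \<le> \<bar>x $ i - z $ i\<bar>"
      show "norm (P S + \<sigma> *\<^sub>R axis i 1 - z) \<le> norm (x - z)"
      proof (rule norm_le_componentwise_cart)
        fix j
        show "norm ((P S + \<sigma> *\<^sub>R axis i 1 - z) $ j) \<le> norm ((x - z) $ j)"
          using \<sigma> insert.hyps by (auto simp: P_def axis_def)
      qed
    qed
    then have "norm (F (P (insert i S)) - F (P S)) \<le> M * \<bar>x $ i - z $ i\<bar>" by (simp only: eq)
    then have "norm (F (P (insert i S)) - F z) \<le> M * \<bar>x $ i - z $ i\<bar> + M * (\<Sum>i\<in>S. \<bar>x $ i - z $ i\<bar>)"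
      using insert.IH norm_triangle_ineq[of "F (P (insert i S)) - F (P S)" "F (P S) - F z"] by simp
    then show ?case using insert.hyps by (simp add: distrib_left)
  qed
  from this[of UNIV] have "norm (F (P UNIV) - F z) \<le> M * (\<Sum>i\<in>UNIV. \<bar>x $ i - z $ i\<bar>)" by simp
  moreover have "P UNIV = x" by (simp add: P_def vec_eq_iff)
  ultimately show ?thesis by simp
qed

lemma sum_abs_component_le: "(\<Sum>i\<in>UNIV. \<bar>v $ i\<bar>) \<le> real CARD('n) * norm v" for v :: "real ^ 'n::finite"
proof -
  have "(\<Sum>i\<in>UNIV. \<bar>v $ i\<bar>) \<le> (\<Sum>i\<in>(UNIV :: 'n set). norm v)"
    by (intro sum_mono component_le_norm_cart)
  then show ?thesis by simp
qed

text \<open>Continuous partial derivatives give all directional derivatives: subtract the linear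
  function with the same partial derivatives at \<open>x\<close> and apply \<open>coordinate_mean_value\<close> to the
  remainder \<open>G\<close>.\<close>

lemma has_derivative_of_partials:
  fixes F :: "real ^ 'n::finite \<Rightarrow> complex"
  assumes der: "\<And>i x. ((\<lambda>s. F (x + s *\<^sub>R axis i 1)) has_vector_derivative F' i x) (at 0)"
    and cont: "\<And>i. continuous_on UNIV (F' i)"
  shows "((\<lambda>s. F (x + s *\<^sub>R v)) has_vector_derivative (\<Sum>i\<in>UNIV. of_real (v $ i) * F' i x)) (at 0)"
proof -
  have lin: "((\<lambda>s. \<Sum>j\<in>UNIV. of_real ((y + s *\<^sub>R axis i 1) $ j) * F' j x) has_vector_derivative F' i x) (at 0)" for i y
  proof -
    have "(\<Sum>j\<in>UNIV. of_real ((y + s *\<^sub>R axis i 1) $ j) * F' j x) = (\<Sum>j\<in>UNIV. of_real (y $ j) * F' j x) + s *\<^sub>R F' i x" for s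
    proof -
      have "(\<Sum>j\<in>UNIV. of_real ((y + s *\<^sub>R axis i 1) $ j) * F' j x) = (\<Sum>j\<in>UNIV. of_real (y $ j) * F' j x + (if j = i then s *\<^sub>R F' i x else 0))"
        by (rule sum.cong) (auto simp: axis_def distrib_right scaleR_conv_of_real[where 'a=complex])
      then show ?thesis by (simp add: sum.distrib)
    qed
    then show ?thesis by (auto intro!: derivative_eq_intros)
  qed
  define G where "G y = F y - (\<Sum>j\<in>UNIV. of_real (y $ j) * F' j x)" for y
  have Gder: "((\<lambda>s. G (y + s *\<^sub>R axis i 1)) has_vector_derivative F' i y - F' i x) (at 0)" for i y
    unfolding G_def by (intro has_vector_derivative_diff der lin)
  let ?n = "real CARD('n)"
  have est: "\<exists>d>0. \<forall>s. norm (s - 0) < d \<longrightarrow> norm (F (x + s *\<^sub>R v) - F (x + 0 *\<^sub>R v) - (s - 0) *\<^sub>R (\<Sum>i\<in>UNIV. of_real (v $ i) * F' i x)) \<le> e * norm (s - 0)" if e: "0 < e" for e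
  proof -
    define \<eta> where "\<eta> = e / (?n * (norm v + 1))"
    have \<eta>: "0 < \<eta>" using e unfolding \<eta>_def by (intro divide_pos_pos mult_pos_pos) (auto simp: add_nonneg_pos)
    have "\<forall>i. \<exists>d>0. \<forall>y. dist y x < d \<longrightarrow> dist (F' i y) (F' i x) < \<eta>"
      using cont \<eta> by (simp add: continuous_on_eq_continuous_at continuous_at_eps_delta)
    then obtain d where d: "\<And>i. 0 < d i" "\<And>i y. dist y x < d i \<Longrightarrow> dist (F' i y) (F' i x) < \<eta>" by metis
    define D where "D = Min (range d)"
    have D: "0 < D" "\<And>i. D \<le> d i" unfolding D_def using d(1) by auto
    have "norm (F (x + s *\<^sub>R v) - F x - s *\<^sub>R (\<Sum>i\<in>UNIV. of_real (v $ i) * F' i x)) \<le> e * \<bar>s\<bar>" if s: "\<bar>s\<bar> < D / (norm v + 1)" for s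
    proof -
      have "\<bar>s\<bar> * (norm v + 1) < D" using s by (simp add: pos_less_divide_eq add_nonneg_pos)
      then have sv: "norm (s *\<^sub>R v) < D" by (simp add: distrib_left)
      have "norm (G (x + s *\<^sub>R v) - G x) \<le> \<eta> * (\<Sum>i\<in>UNIV. \<bar>(x + s *\<^sub>R v) $ i - x $ i\<bar>)"
      proof (rule coordinate_mean_value[OF Gder])
        fix i y assume "norm (y - x) \<le> norm (x + s *\<^sub>R v - x)"
        then have "dist y x < d i" using sv D(2)[of i] by (simp add: dist_norm)
        then show "norm (F' i y - F' i x) \<le> \<eta>" using d(2) by (simp add: dist_norm less_imp_le)
      qed
      also have "(\<Sum>i\<in>UNIV. \<bar>(x + s *\<^sub>R v) $ i - x $ i\<bar>) \<le> ?n * norm (s *\<^sub>R v)"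
        using sum_abs_component_le[of "s *\<^sub>R v"] by simp
      finally have "norm (G (x + s *\<^sub>R v) - G x) \<le> \<eta> * (?n * (\<bar>s\<bar> * norm v))" using \<eta> by simp
      also have "\<dots> \<le> \<eta> * (?n * (\<bar>s\<bar> * (norm v + 1)))" using \<eta> by (intro mult_left_mono) auto
      also have "\<dots> = e * \<bar>s\<bar>"
      proof -
        have "norm v + 1 > 0" by (simp add: add_nonneg_pos)
        then show ?thesis by (simp add: \<eta>_def)
      qed
      also have "G (x + s *\<^sub>R v) - G x = F (x + s *\<^sub>R v) - F x - s *\<^sub>R (\<Sum>i\<in>UNIV. of_real (v $ i) * F' i x)"
        by (simp add: G_def distrib_right sum.distrib scaleR_sum_right scaleR_conv_of_real[where 'a=complex] mult.assoc sum_distrib_left)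
      finally show ?thesis .
    qed
    then show ?thesis using D by (intro exI[of _ "D / (norm v + 1)"]) (auto simp: add_nonneg_pos)
  qed
  then show ?thesis
    unfolding has_vector_derivative_def has_derivative_at_alt
    by (intro conjI allI impI bounded_linear_scaleR_left) blast
qed

text \<open>The \<open>k\<close>-th derivative in the direction \<open>v\<close> of the iterated partial derivative
  \<open>partials is u\<close>, expanded in coordinates.\<close>

primrec directional :: "real ^ 'n::finite \<Rightarrow> nat \<Rightarrow> 'n list \<Rightarrow> (real ^ 'n \<Rightarrow> complex) \<Rightarrow> real ^ 'n \<Rightarrow> complex" where
  "directional v 0 is u = partials is u"
| "directional v (Suc k) is u = (\<lambda>x. \<Sum>i\<in>UNIV. of_real (v $ i) * directional v k (i # is) u x)"

lemma directional_derivative: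
  assumes u: "partials_continuous r u" and len: "length is + k < r"
  shows "((\<lambda>s. directional v k is u (x + s *\<^sub>R v)) has_vector_derivative directional v (Suc k) is u x) (at 0)"
  using len
proof (induction k arbitrary: "is")
  case 0
  then have "((\<lambda>s. partials is u (y + s *\<^sub>R axis i 1)) has_vector_derivative partials (i # is) u y) (at 0)" for i y
    using u unfolding partials_continuous_def by simp
  moreover have "continuous_on UNIV (partials (i # is) u)" for i
    using u 0 unfolding partials_continuous_def by simp
  ultimately have "((\<lambda>s. partials is u (x + s *\<^sub>R v)) has_vector_derivative (\<Sum>i\<in>UNIV. of_real (v $ i) * partials (i # is) u x)) (at 0)"
    by (rule has_derivative_of_partials)
  then show ?case by simp
next
  case (Suc k)
  have "((\<lambda>s. directional v k (i # is) u (x + s *\<^sub>R v)) has_vector_derivative directional v (Suc k) (i # is) u x) (at 0)" for i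
    using Suc.prems by (intro Suc.IH) simp
  then have "((\<lambda>s. of_real (v $ i) * directional v k (i # is) u (x + s *\<^sub>R v)) has_vector_derivative of_real (v $ i) * directional v (Suc k) (i # is) u x) (at 0)" for i
    by (rule has_vector_derivative_mult_right)
  then have "((\<lambda>s. \<Sum>i\<in>UNIV. of_real (v $ i) * directional v k (i # is) u (x + s *\<^sub>R v)) has_vector_derivative (\<Sum>i\<in>UNIV. of_real (v $ i) * directional v (Suc k) (i # is) u x)) (at 0)"
    by (intro has_vector_derivative_sum)
  then show ?case by simp
qed

lemma continuous_on_directional:
  assumes u: "partials_continuous r u" and len: "length is + k \<le> r"
  shows "continuous_on UNIV (directional v k is u)"
  using len
proof (induction k arbitrary: "is")
  case 0
  then show ?case using u unfolding partials_continuous_def by simp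
next
  case (Suc k)
  then have "continuous_on UNIV (directional v k (i # is) u)" for i by simp
  then show ?case by (simp add: continuous_on_sum continuous_on_mult_left)
qed

lemma norm_directional_le:
  assumes "\<And>js. length js = length is + k \<Longrightarrow> norm (partials js u x) \<le> M"
  shows "norm (directional v k is u x) \<le> (\<Sum>i\<in>UNIV. \<bar>v $ i\<bar>) ^ k * M"
  using assms
proof (induction k arbitrary: "is")
  case (Suc k)
  have "norm (directional v (Suc k) is u x) \<le> (\<Sum>i\<in>UNIV. \<bar>v $ i\<bar> * norm (directional v k (i # is) u x))"
    by (simp add: norm_mult sum_norm_le)
  also have "\<dots> \<le> (\<Sum>i\<in>UNIV. \<bar>v $ i\<bar> * ((\<Sum>i\<in>UNIV. \<bar>v $ i\<bar>) ^ k * M))"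
    using Suc.prems by (intro sum_mono mult_left_mono Suc.IH) auto
  also have "\<dots> = (\<Sum>i\<in>UNIV. \<bar>v $ i\<bar>) ^ Suc k * M"
    by (simp add: sum_distrib_right[symmetric] mult.assoc)
  finally show ?case .
qed simp

section \<open>Vanishing moments force decay near the exceptional set\<close>

text \<open>Induction on \<open>j\<close>, the number of orders between \<open>is\<close> and \<open>t\<close>. A derivative of order
  less than \<open>t\<close> vanishes at the point \<open>z\<close> of \<open>Z\<close> nearest to \<open>x\<close>, and on the ball around \<open>z\<close>
  through \<open>x\<close> the distance to \<open>Z\<close> does not exceed that of \<open>x\<close>; so the mean value inequality
  gains one factor \<open>infdist x Z\<close>. When this distance exceeds 1 the hypothesis \<open>N\<close> alone is
  enough.\<close>

lemma partials_decay:
  fixes u :: "real ^ 'n::finite \<Rightarrow> complex"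
  assumes u: "partials_continuous t u"
    and Z: "closed Z" "Z \<noteq> {}"
    and zero: "\<And>is z. length is < t \<Longrightarrow> z \<in> Z \<Longrightarrow> partials is u z = 0"
    and N: "\<And>is x. length is \<le> t \<Longrightarrow> (1 + norm x) ^ t * norm (partials is u x) \<le> N"
  shows "j \<le> t \<Longrightarrow> length is = t - j \<Longrightarrow>
    (1 + norm x) ^ t * norm (partials is u x) \<le> (3 ^ t * real CARD('n)) ^ j * N * min 1 (infdist x Z) ^ j"
proof (induction j arbitrary: "is" x)
  case 0
  then show ?case using N[of "is" x] by simp
next
  case (Suc j)
  let ?c = "3 ^ t * real CARD('n)"
  have c1: "1 \<le> ?c"
  proof -
    have "(1::real) * 1 \<le> 3 ^ t * real CARD('n)" by (intro mult_mono) (auto simp: Suc_leI)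
    then show ?thesis by simp
  qed
  have "0 \<le> (1 + norm (0 :: real ^ 'n)) ^ t * norm (partials [] u 0)" by simp
  also have "\<dots> \<le> N" by (rule N) simp
  finally have N0: "0 \<le> N" .
  have len: "length is < t" using Suc.prems by simp
  show ?case
  proof (cases "1 \<le> infdist x Z")
    case True
    have "(1 + norm x) ^ t * norm (partials is u x) \<le> 1 * N" using N[of "is" x] len by simp
    also have "\<dots> \<le> ?c ^ Suc j * N" using c1 N0 by (intro mult_right_mono one_le_power) auto
    finally show ?thesis using True by (simp add: min_absorb1)
  next
    case False
    define d where "d = infdist x Z"
    have d: "0 \<le> d" "d < 1" using False infdist_nonneg[of x Z] by (auto simp: d_def)
    obtain z where z: "z \<in> Z" "d = dist x z" unfolding d_def using infdist_attains_inf[OF Z] by blast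
    define M where "M = ?c ^ j * N * d ^ j * 3 ^ t / (1 + norm x) ^ t"
    have px: "0 < 1 + norm x" by (simp add: add_pos_nonneg)
    have "norm (partials is u x - partials is u z) \<le> M * (\<Sum>i\<in>UNIV. \<bar>x $ i - z $ i\<bar>)"
    proof (rule coordinate_mean_value[where F'="\<lambda>i. partials (i # is) u"])
      show "((\<lambda>s. partials is u (y + s *\<^sub>R axis i 1)) has_vector_derivative partials (i # is) u y) (at 0)" for i y
        using u len unfolding partials_continuous_def by blast
      fix i y assume "norm (y - z) \<le> norm (x - z)"
      then have yz: "dist y z \<le> d" using z by (simp add: dist_norm)
      have inf: "infdist y Z \<le> d" using infdist_le[OF z(1), of y] yz by simp
      have "norm x \<le> norm y + dist x z + dist y z"
        using norm_triangle_ineq[of y "x - y"] dist_triangle2[of x y z] by (simp add: dist_norm)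
      then have "norm x \<le> norm y + 2" using yz z(2) d(2) by linarith
      moreover have "0 \<le> norm y" by simp
      \<comment> \<open>Points of the ball are within distance 2 of \<open>x\<close>, so the polynomial weight changes
        by a factor of at most \<open>3 ^ t\<close>.\<close>
      ultimately have "1 + norm x \<le> 3 * (1 + norm y)" unfolding distrib_left by linarith
      then have "(1 + norm x) ^ t \<le> (3 * (1 + norm y)) ^ t" using px by (intro power_mono) auto
      then have "(1 + norm x) ^ t * norm (partials (i # is) u y) \<le> 3 ^ t * ((1 + norm y) ^ t * norm (partials (i # is) u y))"
        unfolding power_mult_distrib mult.assoc[symmetric] by (rule mult_right_mono) simp
      also have "\<dots> \<le> 3 ^ t * (?c ^ j * N * min 1 (infdist y Z) ^ j)"
        using Suc.prems by (intro mult_left_mono Suc.IH) auto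
      also have "\<dots> \<le> 3 ^ t * (?c ^ j * N * d ^ j)"
        using inf N0 infdist_nonneg[of y Z] by (intro mult_left_mono power_mono) auto
      finally show "norm (partials (i # is) u y) \<le> M"
        using px by (simp add: M_def pos_le_divide_eq mult.commute mult.left_commute)
    qed
    also have "M * (\<Sum>i\<in>UNIV. \<bar>x $ i - z $ i\<bar>) \<le> M * (real CARD('n) * d)"
    proof (rule mult_left_mono)
      show "(\<Sum>i\<in>UNIV. \<bar>x $ i - z $ i\<bar>) \<le> real CARD('n) * d"
        using sum_abs_component_le[of "x - z"] z(2) by (simp add: dist_norm)
      show "0 \<le> M" using N0 d px by (simp add: M_def)
    qed
    finally have "norm (partials is u x) \<le> M * (real CARD('n) * d)"
      by (simp add: zero[OF len z(1)])
    then have "(1 + norm x) ^ t * norm (partials is u x) \<le> (1 + norm x) ^ t * (M * (real CARD('n) * d))"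
      using px by (intro mult_left_mono) auto
    also have "\<dots> = ?c ^ Suc j * N * d ^ Suc j"
      using px by (simp add: M_def)
    finally show ?thesis using False by (simp add: d_def min_absorb2)
  qed
qed

text \<open>The square root in the definition of \<open>aux_A\<close> is at most \<open>norm \<xi>\<close>, because 0 lies
  outside the orbit.\<close>

lemma aux_A_lower_bound:
  assumes "0 \<notin> Orb"
  shows "min 1 (infdist \<xi> (- Orb)) / (1 + norm \<xi>) \<le> aux_A Orb \<xi>"
proof -
  define d where "d = infdist \<xi> (- Orb)"
  have d: "0 \<le> d" "d \<le> norm \<xi>"
    using infdist_nonneg[of \<xi> "- Orb"] infdist_le[of 0 "- Orb" \<xi>] assms by (auto simp: d_def)
  have p: "0 < 1 + norm \<xi>" by (simp add: add_pos_nonneg)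
  have "0 \<le> (norm \<xi>)\<^sup>2 - d\<^sup>2" using power_mono[OF d(2,1), of 2] by simp
  then have s: "0 \<le> sqrt ((norm \<xi>)\<^sup>2 - d\<^sup>2)" by simp
  then have s1: "0 < 1 + sqrt ((norm \<xi>)\<^sup>2 - d\<^sup>2)" by linarith
  have "sqrt ((norm \<xi>)\<^sup>2 - d\<^sup>2) \<le> norm \<xi>" by (rule real_le_lsqrt) (auto simp: \<open>0 \<le> (norm \<xi>)\<^sup>2 - d\<^sup>2\<close>)
  then have "min 1 d / (1 + norm \<xi>) \<le> d / (1 + sqrt ((norm \<xi>)\<^sup>2 - d\<^sup>2))"
    using d(1) s1 \<open>sqrt ((norm \<xi>)\<^sup>2 - d\<^sup>2) \<le> norm \<xi>\<close> by (intro frac_le[OF _ _ s1]) auto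
  moreover have "min 1 d / (1 + norm \<xi>) \<le> 1 / (1 + norm \<xi>)" using p by (intro divide_right_mono) auto
  ultimately show ?thesis unfolding aux_A_def d_def by simp
qed

text \<open>Of the \<open>t - length is\<close> factors \<open>min 1 (infdist x (- Orb)) / (1 + norm x)\<close> provided by
  \<open>partials_decay\<close>, all of them at most 1, keep \<open>l\<close>.\<close>

theorem partials_le_aux_A:
  fixes u :: "real ^ 'n::finite \<Rightarrow> complex"
  assumes u: "partials_continuous t u"
    and Orb: "open Orb" "0 \<notin> Orb"
    and zero: "\<And>is z. length is < t \<Longrightarrow> z \<notin> Orb \<Longrightarrow> partials is u z = 0"
    and N: "\<And>is x. length is \<le> t \<Longrightarrow> (1 + norm x) ^ t * norm (partials is u x) \<le> N"
    and len: "length is + l < t"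
  shows "norm (partials is u x) \<le> (3 ^ t * real CARD('n)) ^ t * N * aux_A Orb x ^ l * indicator Orb x"
proof (cases "x \<in> Orb")
  case False
  then show ?thesis using zero[of "is" x] len by simp
next
  case True
  let ?c = "3 ^ t * real CARD('n)" and ?d = "infdist x (- Orb)"
  let ?j = "t - length is"
  have c1: "1 \<le> ?c"
  proof -
    have "(1::real) * 1 \<le> 3 ^ t * real CARD('n)" by (intro mult_mono) (auto simp: Suc_leI)
    then show ?thesis by simp
  qed
  have "0 \<le> (1 + norm (0 :: real ^ 'n)) ^ t * norm (partials [] u 0)" by simp
  also have "\<dots> \<le> N" by (rule N) simp
  finally have N0: "0 \<le> N" .
  have px: "0 < 1 + norm x" by (simp add: add_pos_nonneg)
  have Z: "closed (- Orb)" "- Orb \<noteq> {}" using Orb by (auto simp: closed_def)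
  have "(1 + norm x) ^ t * norm (partials is u x) \<le> ?c ^ ?j * N * min 1 ?d ^ ?j"
    by (rule partials_decay[OF u Z _ N]) (use zero len in auto)
  also have "\<dots> \<le> ?c ^ t * N * min 1 ?d ^ ?j"
    using c1 N0 infdist_nonneg[of x "- Orb"] by (intro mult_right_mono power_increasing) auto
  finally have "norm (partials is u x) \<le> ?c ^ t * N * (min 1 ?d ^ ?j / (1 + norm x) ^ t)"
    using px by (simp add: pos_le_divide_eq mult.commute)
  also have "\<dots> \<le> ?c ^ t * N * aux_A Orb x ^ l"
  proof (rule mult_left_mono)
    let ?b = "min 1 ?d / (1 + norm x)"
    have b: "0 \<le> ?b" "?b \<le> 1" using px infdist_nonneg[of x "- Orb"] by (auto simp: divide_le_eq min_le_iff_disj)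
    have "min 1 ?d ^ ?j / (1 + norm x) ^ t \<le> min 1 ?d ^ ?j / (1 + norm x) ^ ?j"
      using px infdist_nonneg[of x "- Orb"] by (intro divide_left_mono power_increasing) auto
    also have "\<dots> = ?b ^ ?j" by (simp add: power_divide)
    also have "\<dots> \<le> ?b ^ l" using b len by (intro power_decreasing) auto
    also have "\<dots> \<le> aux_A Orb x ^ l" using b aux_A_lower_bound[OF Orb(2), of x] by (intro power_mono) auto
    finally show "min 1 ?d ^ ?j / (1 + norm x) ^ t \<le> aux_A Orb x ^ l" .
  qed (use c1 N0 in auto)
  finally show ?thesis using True by simp
qed

section \<open>Fourier transforms with vanishing moments\<close>

lemma continuous_on_fourier:
  fixes f :: "real ^ 'n::finite \<Rightarrow> complex"
  assumes f: "integrable lborel f"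
  shows "continuous_on UNIV (fourier f)"
proof -
  have [measurable]: "f \<in> borel_measurable borel" using f by (simp add: integrable_iff_bounded)
  show ?thesis
  proof (rule continuous_on_sequentiallyI)
    fix X :: "nat \<Rightarrow> real ^ 'n" and a assume X: "X \<longlonglongrightarrow> a"
    show "(\<lambda>n. fourier f (X n)) \<longlonglongrightarrow> fourier f a"
      unfolding fourier_eq
    proof (rule integral_dominated_convergence[where w="\<lambda>x. norm (f x)"])
      show "AE x in lborel. (\<lambda>n. f x * fourier_char (- (x \<bullet> X n))) \<longlonglongrightarrow> f x * fourier_char (- (x \<bullet> a))"
      proof (rule AE_I2)
        fix x
        have "(\<lambda>n. - (x \<bullet> X n)) \<longlonglongrightarrow> - (x \<bullet> a)" by (intro tendsto_intros X)
        moreover have "isCont fourier_char (- (x \<bullet> a))"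
          using continuous_on_fourier_char[OF continuous_on_id, of UNIV] by (simp add: continuous_on_eq_continuous_at)
        ultimately have "(\<lambda>n. fourier_char (- (x \<bullet> X n))) \<longlonglongrightarrow> fourier_char (- (x \<bullet> a))"
          by (metis isCont_tendsto_compose)
        then show "(\<lambda>n. f x * fourier_char (- (x \<bullet> X n))) \<longlonglongrightarrow> f x * fourier_char (- (x \<bullet> a))"
          by (rule tendsto_mult_left)
      qed
    qed (use f in \<open>auto simp: norm_mult\<close>)
  qed
qed

lemma vanishing_moments_partials:
  fixes f :: "real ^ 'n::finite \<Rightarrow> complex"
  assumes f: "integrable lborel f" and vm: "vanishing_moments Z t f"
  shows "partials_continuous t (fourier f)"
    and "length is < t \<Longrightarrow> z \<in> Z \<Longrightarrow> partials is (fourier f) z = 0"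
    and "length is \<le> t \<Longrightarrow> ennreal ((1 + norm x) ^ t * norm (partials is (fourier f) x)) \<le> schwartz_norm t t (fourier f)"
proof -
  let ?u = "fourier f"
  have "\<forall>\<alpha>. \<exists>g. multi_order \<alpha> \<le> t \<longrightarrow> continuous_on UNIV g \<and> distributional_deriv \<alpha> ?u g \<and> (multi_order \<alpha> < t \<longrightarrow> (\<forall>\<xi>\<in>Z. g \<xi> = 0))"
    using vm unfolding vanishing_moments_def by blast
  then obtain g where g: "\<And>\<alpha>. multi_order \<alpha> \<le> t \<Longrightarrow> continuous_on UNIV (g \<alpha>) \<and> distributional_deriv \<alpha> ?u (g \<alpha>)"
    and gZ: "\<And>\<alpha> \<xi>. multi_order \<alpha> < t \<Longrightarrow> \<xi> \<in> Z \<Longrightarrow> g \<alpha> \<xi> = 0" by (metis less_imp_le)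
  note cl = distributional_imp_classical[OF continuous_on_fourier[OF f], of t g, OF g]
  show "partials_continuous t ?u"
    unfolding partials_continuous_def
  proof (intro conjI allI impI)
    fix "is" :: "'n list" assume len: "length is \<le> t"
    then show "continuous_on UNIV (partials is ?u)"
      using g[of "count_list is"] by (simp add: cl(1) multi_order_count_list)
  qed (rule cl(2))
  show "length is < t \<Longrightarrow> z \<in> Z \<Longrightarrow> partials is ?u z = 0"
    using gZ[of "count_list is" z] by (simp add: cl(1) multi_order_count_list)
  show "ennreal ((1 + norm x) ^ t * norm (partials is ?u x)) \<le> schwartz_norm t t ?u" if len: "length is \<le> t"
  proof -
    let ?\<alpha> = "count_list is" and ?js = "SOME js. \<forall>i. count_list js i = count_list is i"
    have "\<forall>i. count_list ?js i = count_list is i" by (rule someI_ex) blast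
    then have eq: "count_list ?js = count_list is" by auto
    then have "length ?js = length is" by (metis multi_order_count_list)
    then have "multi_deriv ?\<alpha> ?u = partials is ?u"
      unfolding multi_deriv_def using len eq by (simp add: cl(1))
    moreover have "0 < 1 + norm x" by (simp add: add_pos_nonneg)
    ultimately have "ennreal ((1 + norm x) ^ t * norm (partials is ?u x)) = ennreal ((1 + norm x) powr real t * norm (multi_deriv ?\<alpha> ?u x))"
      by (simp add: powr_realpow)
    also have "\<dots> \<le> schwartz_norm t t ?u"
      unfolding schwartz_norm_def using len
      by (intro SUP_upper2[of x] SUP_upper2[of ?\<alpha>]) (auto simp: multi_order_count_list)
    finally show ?thesis .
  qed
qed

section \<open>Pointwise and norm estimates of the wavelet transform\<close>

lemma product_derivative_chain:
  fixes U V :: "nat \<Rightarrow> 'a::real_normed_vector \<Rightarrow> complex"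
  assumes U: "derivative_chain e r U" and V: "derivative_chain e r V"
  shows "derivative_chain e r (\<lambda>n. product_derivative U V n 0 0)"
proof -
  have cont: "continuous_on UNIV (product_derivative U V n a b)" if "n + a + b \<le> r" for n a b
    using that
  proof (induction n arbitrary: a b)
    case 0
    then show ?case using U V unfolding derivative_chain_def by (simp add: continuous_on_mult)
  qed (simp add: continuous_on_add)
  have der: "((\<lambda>s. product_derivative U V n a b (\<xi> + s *\<^sub>R e)) has_vector_derivative product_derivative U V (Suc n) a b \<xi>) (at 0)"
    if "n + a + b < r" for n a b \<xi>
    using that
  proof (induction n arbitrary: a b)
    case 0
    then have "((\<lambda>s. U a (\<xi> + s *\<^sub>R e)) has_vector_derivative U (Suc a) \<xi>) (at 0)"
      "((\<lambda>s. V b (\<xi> + s *\<^sub>R e)) has_vector_derivative V (Suc b) \<xi>) (at 0)"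
      using U V unfolding derivative_chain_def by auto
    from has_vector_derivative_mult[OF this] show ?case by (simp add: add.commute)
  next
    case (Suc n)
    have "((\<lambda>s. product_derivative U V n (Suc a) b (\<xi> + s *\<^sub>R e)) has_vector_derivative product_derivative U V (Suc n) (Suc a) b \<xi>) (at 0)"
      "((\<lambda>s. product_derivative U V n a (Suc b) (\<xi> + s *\<^sub>R e)) has_vector_derivative product_derivative U V (Suc n) a (Suc b) \<xi>) (at 0)"
      using Suc.prems by (simp_all only: Suc.IH add_Suc add_Suc_right)
    from has_vector_derivative_add[OF this] show ?case unfolding product_derivative.simps .
  qed
  show ?thesis unfolding derivative_chain_def
  proof (intro conjI allI impI)
    show "continuous_on UNIV (product_derivative U V k 0 0)" if "k \<le> r" for k
      using that by (intro cont) simp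
    show "((\<lambda>s. product_derivative U V k 0 0 (\<xi> + s *\<^sub>R e)) has_vector_derivative product_derivative U V (Suc k) 0 0 \<xi>) (at 0)" if "k < r" for k \<xi>
      using that by (intro der) simp
  qed
qed

lemma norm_product_derivative_le:
  fixes U V :: "nat \<Rightarrow> 'a \<Rightarrow> complex"
  assumes "\<And>a' b'. a' + b' = n + a + b \<Longrightarrow> norm (U a' x) * norm (V b' x) \<le> K"
  shows "norm (product_derivative U V n a b x) \<le> 2 ^ n * K"
  using assms
proof (induction n arbitrary: a b)
  case 0
  then show ?case by (simp add: norm_mult)
next
  case (Suc n)
  have "norm (product_derivative U V n (Suc a) b x) \<le> 2 ^ n * K" "norm (product_derivative U V n a (Suc b) x) \<le> 2 ^ n * K"
    using Suc.prems by (intro Suc.IH; simp)+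
  then show ?case
    using norm_triangle_ineq[of "product_derivative U V n (Suc a) b x" "product_derivative U V n a (Suc b) x"] by simp
qed

lemma matrix_vector_mult_line: "A *v (x + s *\<^sub>R y) = A *v x + s *\<^sub>R (A *v y)" for A :: "real ^ 'n ^ 'm"
  by (simp add: matrix_vector_right_distrib matrix_vector_mult_scaleR)

text \<open>The \<open>k\<close>-th derivative, along the \<open>i\<close>-th axis, of the function
  \<open>\<xi> \<mapsto> u1 \<xi> * cnj (u2 (transpose h *v \<xi>))\<close>; the second factor is differentiated in the
  direction to which \<open>transpose h\<close> maps the axis.\<close>

definition fourier_product :: "real ^ 'n::finite ^ 'n \<Rightarrow> 'n \<Rightarrow> (real ^ 'n \<Rightarrow> complex) \<Rightarrow> (real ^ 'n \<Rightarrow> complex) \<Rightarrow> nat \<Rightarrow> real ^ 'n \<Rightarrow> complex" where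
  "fourier_product h i u1 u2 k = product_derivative (\<lambda>a. partials (replicate a i) u1)
     (\<lambda>b \<xi>. cnj (directional (transpose h *v axis i 1) b [] u2 (transpose h *v \<xi>))) k 0 0"

lemma fourier_product_0: "fourier_product h i u1 u2 0 \<xi> = u1 \<xi> * cnj (u2 (transpose h *v \<xi>))"
  by (simp add: fourier_product_def partials_def)

lemma fourier_product_chain:
  assumes u1: "partials_continuous r u1" and u2: "partials_continuous r u2"
  shows "derivative_chain (axis i 1) r (fourier_product h i u1 u2)"
  unfolding fourier_product_def[abs_def]
proof (rule product_derivative_chain)
  show "derivative_chain (axis i 1) r (\<lambda>a. partials (replicate a i) u1)"
    unfolding derivative_chain_def
  proof (intro conjI allI impI)
    fix k assume "k \<le> r"
    then show "continuous_on UNIV (partials (replicate k i) u1)" using u1 unfolding partials_continuous_def by simp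
  next
    fix k \<xi> assume "k < r"
    then have "((\<lambda>s. partials (replicate k i) u1 (\<xi> + s *\<^sub>R axis i 1)) has_vector_derivative partials (i # replicate k i) u1 \<xi>) (at 0)"
      using u1 unfolding partials_continuous_def by (metis length_replicate)
    then show "((\<lambda>s. partials (replicate k i) u1 (\<xi> + s *\<^sub>R axis i 1)) has_vector_derivative partials (replicate (Suc k) i) u1 \<xi>) (at 0)" by simp
  qed
  let ?v = "transpose h *v axis i 1"
  show "derivative_chain (axis i 1) r (\<lambda>b \<xi>. cnj (directional ?v b [] u2 (transpose h *v \<xi>)))"
    unfolding derivative_chain_def
  proof (intro conjI allI impI)
    fix k assume "k \<le> r"
    then have "continuous_on UNIV (directional ?v k [] u2)" by (intro continuous_on_directional[OF u2]) simp
    then show "continuous_on UNIV (\<lambda>\<xi>. cnj (directional ?v k [] u2 (transpose h *v \<xi>)))"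
      by (intro continuous_on_cnj continuous_on_compose2[of UNIV "directional ?v k [] u2" UNIV "\<lambda>\<xi>. transpose h *v \<xi>"])
        (simp_all add: linear_continuous_on matrix_vector_mul_bounded_linear)
  next
    fix k \<xi> assume "k < r"
    then have "((\<lambda>s. directional ?v k [] u2 (transpose h *v \<xi> + s *\<^sub>R ?v)) has_vector_derivative directional ?v (Suc k) [] u2 (transpose h *v \<xi>)) (at 0)"
      by (intro directional_derivative[OF u2]) simp
    from has_vector_derivative_cnj[OF this]
    show "((\<lambda>s. cnj (directional ?v k [] u2 (transpose h *v (\<xi> + s *\<^sub>R axis i 1)))) has_vector_derivative cnj (directional ?v (Suc k) [] u2 (transpose h *v \<xi>))) (at 0)"
      by (simp only: matrix_vector_mult_line)
  qed
qed

context open_orbit begin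

definition cross_integral :: "nat \<Rightarrow> real ^ 'n ^ 'n \<Rightarrow> ennreal" where
  "cross_integral l h = (\<integral>\<^sup>+\<xi>. ennreal (aux_A Orb \<xi> ^ l * aux_A Orb (transpose h *v \<xi>) ^ l) * indicator Orb \<xi> \<partial>lborel)"

lemma measurable_cross_integral[measurable]: "cross_integral l \<in> borel_measurable \<mu>"
  unfolding cross_integral_def[abs_def] by measurable

text \<open>Each of the \<open>2\<^sup>k\<close> terms of the product rule is a product of derivatives of orders
  \<open>a + b = k\<close>. Both are bounded by powers of \<open>aux_A\<close>, and the second one picks up \<open>b\<close>
  factors from the length of the direction \<open>transpose h *v axis i 1\<close>.\<close>

lemma nn_integral_fourier_product_le:
  assumes h: "h \<in> H" and r: "r + l < t" and k: "k \<le> r"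
    and u1: "partials_continuous t u1" and u2: "partials_continuous t u2"
    and z1: "\<And>is z. length is < t \<Longrightarrow> z \<notin> Orb \<Longrightarrow> partials is u1 z = 0"
    and z2: "\<And>is z. length is < t \<Longrightarrow> z \<notin> Orb \<Longrightarrow> partials is u2 z = 0"
    and N1: "\<And>is x. length is \<le> t \<Longrightarrow> (1 + norm x) ^ t * norm (partials is u1 x) \<le> N1" "0 \<le> N1"
    and N2: "\<And>is x. length is \<le> t \<Longrightarrow> (1 + norm x) ^ t * norm (partials is u2 x) \<le> N2" "0 \<le> N2"
  shows "(\<integral>\<^sup>+\<xi>. ennreal (norm (fourier_product h i u1 u2 k \<xi>)) \<partial>lborel)
    \<le> ennreal (2 ^ r * ((3 ^ t * real CARD('n)) ^ t)\<^sup>2 * (real CARD('n) * (1 + norm h)) ^ r * N1 * N2) * cross_integral l h"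
proof -
  let ?c = "(3 ^ t * real CARD('n)) ^ t" and ?n = "real CARD('n)"
  let ?v = "transpose h *v axis i 1"
  have A0: "0 \<le> aux_A Orb \<xi>" for \<xi> by (rule aux_A_bounds(1)[OF zero_notin_Orb])
  have n1: "1 \<le> ?n" by (simp add: Suc_leI)
  have base1: "1 \<le> ?n * (1 + norm h)"
  proof -
    have "1 * 1 \<le> ?n * (1 + norm h)" using n1 by (intro mult_mono) auto
    then show ?thesis by simp
  qed
  have v: "(\<Sum>j\<in>UNIV. \<bar>?v $ j\<bar>) \<le> ?n * (1 + norm h)"
  proof -
    have "norm ?v \<le> norm (transpose h) * norm (axis i (1::real))" by (rule norm_matrix_vector_mult_le)
    then have "norm ?v \<le> 1 + norm h" by (simp add: norm_transpose norm_axis_1)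
    then have "?n * norm ?v \<le> ?n * (1 + norm h)" by (intro mult_left_mono) auto
    with sum_abs_component_le[of ?v] show ?thesis by (rule order_trans)
  qed
  let ?A = "\<lambda>\<xi>. aux_A Orb \<xi> ^ l * aux_A Orb (transpose h *v \<xi>) ^ l * indicator Orb \<xi> :: real"
  let ?K = "?c\<^sup>2 * (?n * (1 + norm h)) ^ r * N1 * N2"
  have pt: "norm (fourier_product h i u1 u2 k \<xi>) \<le> 2 ^ r * (?K * ?A \<xi>)" for \<xi>
  proof -
    have KA: "0 \<le> ?K * ?A \<xi>" using N1(2) N2(2) A0 by (intro mult_nonneg_nonneg) (auto simp: indicator_def)
    have "norm (fourier_product h i u1 u2 k \<xi>) \<le> 2 ^ k * (?K * ?A \<xi>)"
      unfolding fourier_product_def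
    proof (rule norm_product_derivative_le)
      fix a b assume ab: "a + b = k + 0 + 0"
      have Orbh: "indicator Orb (transpose h *v \<xi>) = (indicator Orb \<xi> :: real)"
        by (simp add: indicator_def Orb_invariant[OF h])
      have 1: "norm (partials (replicate a i) u1 \<xi>) \<le> ?c * N1 * aux_A Orb \<xi> ^ l * indicator Orb \<xi>"
        by (rule partials_le_aux_A[OF u1 open_Orb zero_notin_Orb z1 N1(1)]) (use ab k r in auto)
      have "norm (directional ?v b [] u2 (transpose h *v \<xi>)) \<le> (\<Sum>j\<in>UNIV. \<bar>?v $ j\<bar>) ^ b * (?c * N2 * aux_A Orb (transpose h *v \<xi>) ^ l * indicator Orb (transpose h *v \<xi>))"
      proof (rule norm_directional_le)
        fix js :: "'n list" assume "length js = length ([] :: 'n list) + b"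
        then show "norm (partials js u2 (transpose h *v \<xi>)) \<le> ?c * N2 * aux_A Orb (transpose h *v \<xi>) ^ l * indicator Orb (transpose h *v \<xi>)"
          using ab k r by (intro partials_le_aux_A[OF u2 open_Orb zero_notin_Orb z2 N2(1)]) auto
      qed
      also have "\<dots> \<le> (?n * (1 + norm h)) ^ r * (?c * N2 * aux_A Orb (transpose h *v \<xi>) ^ l * indicator Orb (transpose h *v \<xi>))"
      proof (rule mult_right_mono)
        have "(\<Sum>j\<in>UNIV. \<bar>?v $ j\<bar>) ^ b \<le> (?n * (1 + norm h)) ^ b" using v by (intro power_mono) (auto intro: sum_nonneg)
        also have "\<dots> \<le> (?n * (1 + norm h)) ^ r" using base1 ab k by (intro power_increasing) auto
        finally show "(\<Sum>j\<in>UNIV. \<bar>?v $ j\<bar>) ^ b \<le> (?n * (1 + norm h)) ^ r" .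
        show "0 \<le> ?c * N2 * aux_A Orb (transpose h *v \<xi>) ^ l * indicator Orb (transpose h *v \<xi>)"
          using N2(2) A0 by (intro mult_nonneg_nonneg) auto
      qed
      finally have 2: "norm (cnj (directional ?v b [] u2 (transpose h *v \<xi>))) \<le> (?n * (1 + norm h)) ^ r * (?c * N2 * aux_A Orb (transpose h *v \<xi>) ^ l * indicator Orb \<xi>)"
        by (simp only: Orbh complex_mod_cnj)
      have "norm (partials (replicate a i) u1 \<xi>) * norm (cnj (directional ?v b [] u2 (transpose h *v \<xi>)))
         \<le> (?c * N1 * aux_A Orb \<xi> ^ l * indicator Orb \<xi>) * ((?n * (1 + norm h)) ^ r * (?c * N2 * aux_A Orb (transpose h *v \<xi>) ^ l * indicator Orb \<xi>))"
        using N1(2) A0 by (intro mult_mono 1 2 mult_nonneg_nonneg) auto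
      also have "\<dots> = ?K * ?A \<xi>" by (simp add: power2_eq_square indicator_def)
      finally show "norm (partials (replicate a i) u1 \<xi>) * norm (cnj (directional ?v b [] u2 (transpose h *v \<xi>))) \<le> ?K * ?A \<xi>" .
    qed
    also have "\<dots> \<le> 2 ^ r * (?K * ?A \<xi>)" using KA k by (intro mult_right_mono power_increasing) auto
    finally show ?thesis .
  qed
  have hm[measurable]: "h \<in> space \<mu>" using h by simp
  have K0: "0 \<le> ?K" using N1(2) N2(2) by (intro mult_nonneg_nonneg) auto
  have "(\<integral>\<^sup>+\<xi>. ennreal (norm (fourier_product h i u1 u2 k \<xi>)) \<partial>lborel)
     \<le> (\<integral>\<^sup>+\<xi>. ennreal (2 ^ r * ?K) * (ennreal (aux_A Orb \<xi> ^ l * aux_A Orb (transpose h *v \<xi>) ^ l) * indicator Orb \<xi>) \<partial>lborel)"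
  proof (rule nn_integral_mono)
    fix \<xi>
    have "ennreal (norm (fourier_product h i u1 u2 k \<xi>)) \<le> ennreal (2 ^ r * (?K * ?A \<xi>))" by (rule ennreal_leI[OF pt])
    also have "\<dots> = ennreal (2 ^ r * ?K) * (ennreal (aux_A Orb \<xi> ^ l * aux_A Orb (transpose h *v \<xi>) ^ l) * indicator Orb \<xi>)"
    proof (cases "\<xi> \<in> Orb")
      case True
      let ?aa = "aux_A Orb \<xi> ^ l * aux_A Orb (transpose h *v \<xi>) ^ l"
      have "0 \<le> 2 ^ r * ?K" using K0 by simp
      moreover have "0 \<le> ?aa" using A0 by simp
      ultimately have "ennreal (2 ^ r * ?K) * ennreal ?aa = ennreal ((2 ^ r * ?K) * ?aa)"
        by (rule ennreal_mult[symmetric])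
      moreover have "2 ^ r * (?K * ?A \<xi>) = (2 ^ r * ?K) * ?aa" using True by simp
      moreover have "indicator Orb \<xi> = (1 :: ennreal)" using True by simp
      ultimately show ?thesis by (simp only: mult_1_right)
    qed simp
    finally show "ennreal (norm (fourier_product h i u1 u2 k \<xi>)) \<le> ennreal (2 ^ r * ?K) * (ennreal (aux_A Orb \<xi> ^ l * aux_A Orb (transpose h *v \<xi>) ^ l) * indicator Orb \<xi>)" .
  qed
  also have "\<dots> = ennreal (2 ^ r * ?K) * cross_integral l h"
    unfolding cross_integral_def by (rule nn_integral_cmult) measurable
  finally show ?thesis by (simp add: mult.assoc)
qed

end

lemma norm_power_le_component:
  fixes x :: "real ^ 'n::finite"
  shows "\<exists>i. norm x ^ r \<le> real CARD('n) ^ r * \<bar>x $ i\<bar> ^ r"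
proof -
  have "Max (range (\<lambda>j. \<bar>x $ j\<bar>)) \<in> range (\<lambda>j. \<bar>x $ j\<bar>)" by (intro Max_in) auto
  then obtain i where "Max (range (\<lambda>j. \<bar>x $ j\<bar>)) = \<bar>x $ i\<bar>" by blast
  then have i: "\<bar>x $ j\<bar> \<le> \<bar>x $ i\<bar>" for j using Max_ge[of "range (\<lambda>j. \<bar>x $ j\<bar>)" "\<bar>x $ j\<bar>"] by simp
  have "norm x \<le> (\<Sum>j\<in>UNIV. \<bar>x $ j\<bar>)" by (rule norm_le_l1_cart)
  also have "\<dots> \<le> (\<Sum>j\<in>(UNIV :: 'n set). \<bar>x $ i\<bar>)" by (intro sum_mono i)
  finally have "norm x \<le> real CARD('n) * \<bar>x $ i\<bar>" by simp
  then have "norm x ^ r \<le> (real CARD('n) * \<bar>x $ i\<bar>) ^ r" by (intro power_mono) auto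
  then show ?thesis by (auto simp: power_mult_distrib)
qed

lemma decay_of_coordinate_decay:
  fixes x :: "real ^ 'n::finite"
  assumes V0: "a \<le> \<sigma>" "0 \<le> a" and Vi: "\<And>i. (2 * pi * \<bar>x $ i\<bar>) ^ r * a \<le> \<sigma>"
  shows "(1 + norm x) ^ r * a \<le> 2 ^ r * (1 + real CARD('n) ^ r) * \<sigma>"
proof -
  obtain i where i: "norm x ^ r \<le> real CARD('n) ^ r * \<bar>x $ i\<bar> ^ r" using norm_power_le_component by blast
  have "\<bar>x $ i\<bar> ^ r \<le> (2 * pi * \<bar>x $ i\<bar>) ^ r"
  proof (rule power_mono)
    have "1 * \<bar>x $ i\<bar> \<le> 2 * pi * \<bar>x $ i\<bar>" using pi_gt3 by (intro mult_right_mono) auto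
    then show "\<bar>x $ i\<bar> \<le> 2 * pi * \<bar>x $ i\<bar>" by simp
  qed simp
  then have "\<bar>x $ i\<bar> ^ r * a \<le> (2 * pi * \<bar>x $ i\<bar>) ^ r * a" using V0(2) by (rule mult_right_mono)
  then have "\<bar>x $ i\<bar> ^ r * a \<le> \<sigma>" using Vi[of i] by (rule order_trans)
  then have "real CARD('n) ^ r * (\<bar>x $ i\<bar> ^ r * a) \<le> real CARD('n) ^ r * \<sigma>" by (intro mult_left_mono) auto
  moreover have "norm x ^ r * a \<le> real CARD('n) ^ r * (\<bar>x $ i\<bar> ^ r * a)"
    using mult_right_mono[OF i V0(2)] by (simp only: mult.assoc)
  ultimately have xa: "norm x ^ r * a \<le> real CARD('n) ^ r * \<sigma>" by linarith
  have "(1 + norm x) ^ r \<le> (2 * max 1 (norm x)) ^ r" by (intro power_mono) auto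
  also have "\<dots> \<le> 2 ^ r * (1 + norm x ^ r)"
    by (auto simp: power_mult_distrib max_def)
  finally have "(1 + norm x) ^ r * a \<le> 2 ^ r * (1 + norm x ^ r) * a" using V0(2) by (rule mult_right_mono)
  also have "\<dots> = 2 ^ r * (a + norm x ^ r * a)" by (simp add: algebra_simps)
  also have "\<dots> \<le> 2 ^ r * (\<sigma> + real CARD('n) ^ r * \<sigma>)" using V0(1) xa by (intro mult_left_mono) auto
  finally show ?thesis by (simp add: algebra_simps)
qed

lemma weight_Lp_norm_finite:
  fixes p :: ennreal and r :: nat
  assumes p: "1 \<le> p" and inf: "p = \<infinity> \<Longrightarrow> s \<le> real r" and fin: "p \<noteq> \<infinity> \<Longrightarrow> s + real CARD('n::finite) / enn2real p < real r"
  shows "Lp_norm lborel p (\<lambda>x :: real ^ 'n. ennreal ((1 + norm x) powr (s - real r))) < \<infinity>"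
proof (cases "p = \<infinity>")
  case True
  have le: "(1 + norm x) powr (s - real r) \<le> 1" for x :: "real ^ 'n"
  proof -
    have "(1 + norm x) powr (s - real r) \<le> (1 + norm x) powr 0" using inf[OF True] by (intro powr_mono) auto
    moreover have "1 + norm x \<noteq> 0" using norm_ge_zero[of x] by linarith
    ultimately show ?thesis by simp
  qed
  have "esssup lborel (\<lambda>x :: real ^ 'n. ennreal ((1 + norm x) powr (s - real r))) \<le> 1"
    by (rule esssup_I) (use le in \<open>auto simp: ennreal_le_1\<close>)
  then have "esssup lborel (\<lambda>x :: real ^ 'n. ennreal ((1 + norm x) powr (s - real r))) < \<infinity>"
    by (rule le_less_trans) simp
  then show ?thesis using True by (simp add: Lp_norm_def)
next
  case False
  define a where "a = enn2real p"
  have a: "1 \<le> a" using p False unfolding a_def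
    by (metis enn2real_mono enn2real_1 infinity_ennreal_def less_top)
  have c: "real CARD('n) < (real r - s) * a"
    using fin[OF False] a unfolding a_def[symmetric] by (simp add: field_simps)
  have "(\<integral>\<^sup>+x. ennreal_powr (ennreal ((1 + norm x) powr (s - real r))) a \<partial>(lborel :: (real ^ 'n) measure))
     = (\<integral>\<^sup>+x. ennreal ((1 + norm x) powr (- ((real r - s) * a))) \<partial>(lborel :: (real ^ 'n) measure))"
    by (intro nn_integral_cong) (simp add: ennreal_powr_ennreal powr_powr algebra_simps)
  also have "\<dots> < \<infinity>" by (rule nn_integral_weight_finite[OF c])
  finally show ?thesis using False by (simp add: Lp_norm_def a_def)
qed

context open_orbit begin

text \<open>Fourier inversion represents the wavelet transform as the Fourier integral of \<open>u\<close>.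
  Derivatives of order \<open>r\<close> along each coordinate axis give decay in each coordinate, which
  together with the undifferentiated bound is decay in \<open>norm x\<close>.\<close>

lemma wavelet_transform_pointwise:
  assumes h: "h \<in> H" and r: "r + l < t"
    and f: "integrable lborel f" and \<psi>: "integrable lborel \<psi>"
    and vf: "vanishing_moments (- Orb) t f" and v\<psi>: "vanishing_moments (- Orb) t \<psi>"
    and Nf: "schwartz_norm t t (fourier f) \<le> ennreal N1" "0 \<le> N1"
    and N\<psi>: "schwartz_norm t t (fourier \<psi>) \<le> ennreal N2" "0 \<le> N2"
    and S: "ennreal (2 ^ r * ((3 ^ t * real CARD('n)) ^ t)\<^sup>2 * (real CARD('n) * (1 + norm h)) ^ r * N1 * N2) * cross_integral l h \<le> ennreal \<sigma>" "0 \<le> \<sigma>"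
  shows "AE x in lborel. norm (wavelet_transform \<psi> f (x, h))
    \<le> \<bar>det h\<bar> powr (1 / 2) * (2 ^ r * (1 + real CARD('n) ^ r)) * \<sigma> / (1 + norm x) ^ r"
proof -
  let ?u1 = "fourier f" and ?u2 = "fourier \<psi>" and ?n = "real CARD('n)"
  let ?W = "\<lambda>x. wavelet_transform \<psi> f (x, h)"
  let ?X = "\<lambda>i. fourier_product h i ?u1 ?u2"
  have inv: "invertible h" by (rule invertible_H[OF h])
  have u1: "partials_continuous t ?u1" and u2: "partials_continuous t ?u2"
    by (rule vanishing_moments_partials(1)[OF f vf], rule vanishing_moments_partials(1)[OF \<psi> v\<psi>])
  have ur: "partials_continuous r u" if "partials_continuous t u" for u :: "real ^ 'n \<Rightarrow> complex"
    using that r unfolding partials_continuous_def by auto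
  have N1: "(1 + norm x) ^ t * norm (partials is ?u1 x) \<le> N1" if "length is \<le> t" for "is" x
    using order_trans[OF vanishing_moments_partials(3)[OF f vf that] Nf(1)] Nf(2) by (simp add: ennreal_le_iff)
  have N2: "(1 + norm x) ^ t * norm (partials is ?u2 x) \<le> N2" if "length is \<le> t" for "is" x
    using order_trans[OF vanishing_moments_partials(3)[OF \<psi> v\<psi> that] N\<psi>(1)] N\<psi>(2) by (simp add: ennreal_le_iff)
  have z1: "partials is ?u1 z = 0" if "length is < t" "z \<notin> Orb" for "is" z
    using vanishing_moments_partials(2)[OF f vf that(1)] that(2) by simp
  have z2: "partials is ?u2 z = 0" if "length is < t" "z \<notin> Orb" for "is" z
    using vanishing_moments_partials(2)[OF \<psi> v\<psi> that(1)] that(2) by simp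
  have bound: "(\<integral>\<^sup>+\<xi>. ennreal (norm (?X i k \<xi>)) \<partial>lborel) \<le> ennreal \<sigma>" if "k \<le> r" for i k
    using nn_integral_fourier_product_le[OF h r that u1 u2 z1 z2 N1 Nf(2) N2 N\<psi>(2)] S(1) by (rule order_trans)
  have chain: "derivative_chain (axis i 1) r (?X i)" for i
    by (rule fourier_product_chain[OF ur[OF u1] ur[OF u2]])
  define u where "u \<xi> = ?u1 \<xi> * cnj (?u2 (transpose h *v \<xi>))" for \<xi>
  have X0: "?X i 0 = u" for i by (rule ext) (simp add: fourier_product_0 u_def)
  have u_int: "integrable lborel u"
  proof (rule integrableI_bounded)
    have "continuous_on UNIV (?X undefined 0)" using chain[of undefined] unfolding derivative_chain_def by simp
    then show "u \<in> borel_measurable lborel" unfolding X0 by (simp add: borel_measurable_continuous_onI)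
    show "(\<integral>\<^sup>+\<xi>. ennreal (norm (u \<xi>)) \<partial>lborel) < \<infinity>"
      by (rule le_less_trans[OF bound[of 0 undefined, unfolded X0]]) simp_all
  qed
  define V where "V x = (LINT \<xi>|lborel. u \<xi> * fourier_char (x \<bullet> \<xi>))" for x
  have W: "integrable lborel ?W" by (rule wavelet_transform_integrable[OF f \<psi> inv])
  have FW: "fourier ?W = (\<lambda>\<xi>. complex_of_real (\<bar>det h\<bar> powr (1 / 2)) * u \<xi>)"
    by (rule ext) (simp add: fourier_wavelet_transform[OF f \<psi> inv] u_def)
  have "integrable lborel (fourier ?W)" unfolding FW using u_int by (intro integrable_mult_right) simp
  from fourier_inversion_AE[OF W this]
  have AE: "AE x in lborel. ?W x = complex_of_real (\<bar>det h\<bar> powr (1 / 2)) * V x"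
    unfolding FW V_def by (simp add: mult.assoc)
  have decay: "(1 + norm x) ^ r * norm (V x) \<le> 2 ^ r * (1 + ?n ^ r) * \<sigma>" for x
  proof (rule decay_of_coordinate_decay)
    have "ennreal (norm (V x)) \<le> (\<integral>\<^sup>+\<xi>. ennreal (norm (u \<xi> * fourier_char (x \<bullet> \<xi>))) \<partial>lborel)"
      unfolding V_def
    proof (rule integral_norm_bound_ennreal)
      show "integrable lborel (\<lambda>\<xi>. u \<xi> * fourier_char (x \<bullet> \<xi>))"
        by (rule Bochner_Integration.integrable_bound[OF u_int]) (use u_int in \<open>auto simp: norm_mult integrable_iff_bounded\<close>)
    qed
    also have "\<dots> = (\<integral>\<^sup>+\<xi>. ennreal (norm (?X undefined 0 \<xi>)) \<partial>lborel)" by (simp add: norm_mult X0)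
    also have "\<dots> \<le> ennreal \<sigma>" by (rule bound) simp
    finally show "norm (V x) \<le> \<sigma>" using S(2) by (simp add: ennreal_le_iff)
    fix i
    have "ennreal ((2 * pi * \<bar>x \<bullet> axis i 1\<bar>) ^ r * norm (LINT \<xi>|lborel. ?X i 0 \<xi> * fourier_char (x \<bullet> \<xi>))) \<le> (\<integral>\<^sup>+\<xi>. ennreal (norm (?X i r \<xi>)) \<partial>lborel)"
      by (rule fourier_integral_decay[OF chain]) (simp add: X0 u_int)
    also have "\<dots> \<le> ennreal \<sigma>" by (rule bound) simp
    finally show "(2 * pi * \<bar>x $ i\<bar>) ^ r * norm (V x) \<le> \<sigma>"
      using S(2) by (simp add: ennreal_le_iff X0 V_def inner_axis)
  qed simp
  show ?thesis
    using AE
  proof eventually_elim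
    case (elim x)
    have px: "0 < (1 + norm x) ^ r" by (simp add: add_pos_nonneg)
    have "norm (?W x) = \<bar>det h\<bar> powr (1 / 2) * norm (V x)" using elim by (simp add: norm_mult)
    also have "\<dots> \<le> \<bar>det h\<bar> powr (1 / 2) * (2 ^ r * (1 + ?n ^ r) * \<sigma> / (1 + norm x) ^ r)"
      using decay[of x] px by (intro mult_left_mono) (auto simp: pos_le_divide_eq mult.commute)
    finally show ?case by (simp add: mult.assoc)
  qed
qed

text \<open>The pointwise bound is integrated against the weight \<open>v\<close>, which costs
  \<open>(1 + norm x) powr s * w h\<close>. The constant does not depend on \<open>h\<close>, \<open>f\<close> and \<open>\<psi>\<close>.\<close>

theorem wavelet_transform_Lp_le:
  fixes p :: ennreal
  assumes p: "1 \<le> p" and inf: "p = \<infinity> \<Longrightarrow> s \<le> real r" and fin: "p \<noteq> \<infinity> \<Longrightarrow> s + real CARD('n) / enn2real p < real r"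
    and r: "r + l < t" and e: "real r \<le> e"
    and v: "weight_on (semidirect_carrier H) semidirect_mult v"
    and w: "weight_on H (**) w"
    and vw: "\<And>x h. h \<in> H \<Longrightarrow> v (x, h) \<le> (1 + norm x) powr s * w h"
  shows "\<exists>C>0. \<forall>h\<in>H. \<forall>f \<psi> N1 N2. integrable lborel f \<longrightarrow> integrable lborel \<psi> \<longrightarrow>
    vanishing_moments (- Orb) t f \<longrightarrow> vanishing_moments (- Orb) t \<psi> \<longrightarrow>
    schwartz_norm t t (fourier f) \<le> ennreal N1 \<longrightarrow> 0 \<le> N1 \<longrightarrow>
    schwartz_norm t t (fourier \<psi>) \<le> ennreal N2 \<longrightarrow> 0 \<le> N2 \<longrightarrow>
    Lp_norm lborel p (\<lambda>x. ennreal (norm (wavelet_transform \<psi> f (x, h)) * v (x, h)))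
      \<le> ennreal (C * N1 * N2) * (ennreal (\<bar>det h\<bar> powr (1 / 2) * (1 + norm h) powr e * w h) * cross_integral l h)"
proof -
  let ?n = "real CARD('n)"
  let ?R = "\<lambda>x :: real ^ 'n. ennreal ((1 + norm x) powr (s - real r))"
  \<comment> \<open>Adding 1 keeps the constant positive.\<close>
  define P where "P = enn2real (Lp_norm lborel p ?R) + 1"
  have P: "0 < P" "Lp_norm lborel p ?R \<le> ennreal P"
  proof -
    have "Lp_norm lborel p ?R < \<infinity>" by (rule weight_Lp_norm_finite[OF p inf fin])
    then have "Lp_norm lborel p ?R = ennreal (enn2real (Lp_norm lborel p ?R))" by (simp add: less_top)
    also have "\<dots> \<le> ennreal P" unfolding P_def by (intro ennreal_leI) simp
    finally show "Lp_norm lborel p ?R \<le> ennreal P" .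
    show "0 < P" unfolding P_def by (simp add: add_nonneg_pos)
  qed
  define \<kappa> where "\<kappa> = 2 ^ r * ((3 ^ t * ?n) ^ t)\<^sup>2 * ?n ^ r"
  define \<Theta> where "\<Theta> = 2 ^ r * (1 + ?n ^ r)"
  have \<kappa>: "0 < \<kappa>" unfolding \<kappa>_def by simp
  have \<Theta>: "0 < \<Theta>" unfolding \<Theta>_def by (simp add: add_pos_nonneg)
  define C where "C = \<Theta> * \<kappa> * P"
  have C: "0 < C" unfolding C_def using \<kappa> \<Theta> P by simp
  have main: "Lp_norm lborel p (\<lambda>x. ennreal (norm (wavelet_transform \<psi> f (x, h)) * v (x, h)))
      \<le> ennreal (C * N1 * N2) * (ennreal (\<bar>det h\<bar> powr (1 / 2) * (1 + norm h) powr e * w h) * cross_integral l h)"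
    if h: "h \<in> H" and f: "integrable lborel f" and \<psi>: "integrable lborel \<psi>"
      and vf: "vanishing_moments (- Orb) t f" and v\<psi>: "vanishing_moments (- Orb) t \<psi>"
      and Nf: "schwartz_norm t t (fourier f) \<le> ennreal N1" "0 \<le> N1"
      and N\<psi>: "schwartz_norm t t (fourier \<psi>) \<le> ennreal N2" "0 \<le> N2" for h f \<psi> N1 N2
  proof -
    have wh: "0 < w h" using w h unfolding weight_on_def by blast
    have dh: "0 < \<bar>det h\<bar>" using invertible_H[OF h] by (simp add: invertible_det_nz)
    have hp: "0 < 1 + norm h" by (simp add: add_pos_nonneg)
    let ?k = "2 ^ r * ((3 ^ t * ?n) ^ t)\<^sup>2 * (?n * (1 + norm h)) ^ r * N1 * N2"
    have k_eq: "?k = \<kappa> * (1 + norm h) ^ r * N1 * N2" by (simp add: \<kappa>_def power_mult_distrib)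
    have k0: "0 \<le> ?k" unfolding k_eq using \<kappa> hp Nf(2) N\<psi>(2) by simp
    show ?thesis
    proof (cases "ennreal ?k * cross_integral l h")
      case (real \<sigma>)
      let ?a = "\<bar>det h\<bar> powr (1 / 2) * w h"
      let ?W = "\<lambda>x. wavelet_transform \<psi> f (x, h)"
      have AE: "AE x in lborel. norm (?W x) \<le> \<bar>det h\<bar> powr (1 / 2) * \<Theta> * \<sigma> / (1 + norm x) ^ r"
        using wavelet_transform_pointwise[OF h r f \<psi> vf v\<psi> Nf N\<psi>, of \<sigma>] real unfolding \<Theta>_def by simp
      have vpos: "0 < v (x, h)" for x using v h unfolding weight_on_def semidirect_carrier_def by auto
      have "Lp_norm lborel p (\<lambda>x. ennreal (norm (?W x) * v (x, h))) \<le> ennreal (?a * \<Theta> * \<sigma>) * Lp_norm lborel p ?R"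
      proof (rule Lp_norm_scale_le[OF p])
        show "0 \<le> ?a * \<Theta> * \<sigma>" using wh \<Theta> real by simp
        have "continuous_on (UNIV \<times> H) v" using v unfolding weight_on_def semidirect_carrier_def by blast
        then have "continuous_on UNIV (\<lambda>x. v (x, h))"
          by (rule continuous_on_compose2) (use h in \<open>auto intro!: continuous_intros\<close>)
        then have [measurable]: "(\<lambda>x. v (x, h)) \<in> borel_measurable borel" by (rule borel_measurable_continuous_onI)
        have [measurable]: "?W \<in> borel_measurable borel"
          using wavelet_transform_integrable[OF f \<psi> invertible_H[OF h]] by (simp add: integrable_iff_bounded)
        show "(\<lambda>x. ennreal (norm (?W x) * v (x, h))) \<in> borel_measurable lborel" by measurable
        show "AE x in lborel. ennreal (norm (?W x) * v (x, h)) \<le> ennreal (?a * \<Theta> * \<sigma>) * ?R x"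
          using AE
        proof eventually_elim
          case (elim x)
          have px: "0 < 1 + norm x" by (simp add: add_pos_nonneg)
          have "norm (?W x) * v (x, h) \<le> (\<bar>det h\<bar> powr (1 / 2) * \<Theta> * \<sigma> / (1 + norm x) ^ r) * ((1 + norm x) powr s * w h)"
            using elim vw[OF h, of x] vpos[of x] \<Theta> real px by (intro mult_mono) auto
          also have "\<dots> = ?a * \<Theta> * \<sigma> * ((1 + norm x) powr s / (1 + norm x) powr real r)"
            using px by (simp add: powr_realpow)
          also have "\<dots> = ?a * \<Theta> * \<sigma> * (1 + norm x) powr (s - real r)" by (simp add: powr_diff)
          finally show ?case using wh \<Theta> real by (simp add: ennreal_mult[symmetric] ennreal_leI)
        qed
      qed simp
      also have "\<dots> \<le> ennreal (?a * \<Theta> * \<sigma>) * ennreal P" by (intro mult_left_mono P(2)) simp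
      also have "\<dots> = ennreal (?a * \<Theta> * P) * ennreal \<sigma>"
        using wh \<Theta> P real by (simp add: ennreal_mult[symmetric] ac_simps)
      also have "\<dots> = ennreal (?a * \<Theta> * P) * (ennreal ?k * cross_integral l h)" by (simp only: real)
      also have "\<dots> = ennreal (?a * \<Theta> * P * ?k) * cross_integral l h"
        using wh \<Theta> P k0 by (subst ennreal_mult) (auto simp: mult.assoc)
      also have "\<dots> \<le> ennreal (C * N1 * N2 * (\<bar>det h\<bar> powr (1 / 2) * (1 + norm h) powr e * w h)) * cross_integral l h"
      proof (intro mult_right_mono ennreal_leI)
        have "(1 + norm h) ^ r \<le> (1 + norm h) powr e"
          using e hp by (simp add: powr_realpow[symmetric] powr_mono)
        then have "(?a * \<Theta> * P * \<kappa> * N1 * N2) * (1 + norm h) ^ r \<le> (?a * \<Theta> * P * \<kappa> * N1 * N2) * (1 + norm h) powr e"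
          using wh \<Theta> \<kappa> P Nf(2) N\<psi>(2) by (intro mult_left_mono) auto
        then show "?a * \<Theta> * P * ?k \<le> C * N1 * N2 * (\<bar>det h\<bar> powr (1 / 2) * (1 + norm h) powr e * w h)"
          unfolding k_eq C_def by (simp add: ac_simps)
      qed simp
      also have "\<dots> = ennreal (C * N1 * N2) * (ennreal (\<bar>det h\<bar> powr (1 / 2) * (1 + norm h) powr e * w h) * cross_integral l h)"
        using C Nf(2) N\<psi>(2) wh by (subst ennreal_mult) (auto simp: mult.assoc)
      finally show ?thesis .
    next
      \<comment> \<open>An infinite cross integral makes the right hand side infinite, unless
        \<open>N1 * N2 = 0\<close>, and then \<open>?k = 0\<close>.\<close>
      case top
      then have ci: "cross_integral l h = \<infinity>"
        by (metis ennreal_mult_eq_top_iff ennreal_neq_top infinity_ennreal_def)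
      have "?k \<noteq> 0"
      proof
        assume "?k = 0"
        then have "ennreal ?k * cross_integral l h = 0" by (simp only: ennreal_0 mult_zero_left)
        then show False using top by simp
      qed
      then have "N1 \<noteq> 0" "N2 \<noteq> 0" by auto
      then have "0 < N1" "0 < N2" using Nf(2) N\<psi>(2) by linarith+
      then have "ennreal (C * N1 * N2) * (ennreal (\<bar>det h\<bar> powr (1 / 2) * (1 + norm h) powr e * w h) * cross_integral l h) = \<infinity>"
        unfolding ci using C wh dh hp by (simp add: ennreal_mult_top)
      then show ?thesis by simp
    qed
  qed
  show ?thesis
  proof (intro exI[of _ C] conjI ballI allI impI)
    show "0 < C" by (rule C)
  qed (rule main)
qed

text \<open>When one Fourier transform vanishes, so does that of the wavelet transform. This
  settles the case in which one Schwartz norm is 0 and the other infinite, where the product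
  on the right hand side of the final estimate is 0.\<close>

lemma wavelet_transform_Lp_zero:
  assumes p: "1 \<le> p" and h: "h \<in> H"
    and f: "integrable lborel f" and \<psi>: "integrable lborel \<psi>"
    and z: "fourier f = (\<lambda>_. 0) \<or> fourier \<psi> = (\<lambda>_. 0)"
    and v: "weight_on (semidirect_carrier H) semidirect_mult v"
  shows "Lp_norm lborel p (\<lambda>x. ennreal (norm (wavelet_transform \<psi> f (x, h)) * v (x, h))) = 0"
proof -
  let ?W = "\<lambda>x. wavelet_transform \<psi> f (x, h)"
  have inv: "invertible h" by (rule invertible_H[OF h])
  have W: "integrable lborel ?W" by (rule wavelet_transform_integrable[OF f \<psi> inv])
  have FW: "fourier ?W = (\<lambda>_. 0)"
    by (rule ext) (use z in \<open>auto simp: fourier_wavelet_transform[OF f \<psi> inv]\<close>)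
  have "integrable lborel (fourier ?W)" by (simp add: FW)
  from fourier_inversion_AE[OF W this] have AE: "AE x in lborel. ?W x = 0" by (simp add: FW)
  have "Lp_norm lborel p (\<lambda>x. ennreal (norm (?W x) * v (x, h))) \<le> ennreal 0 * Lp_norm lborel p (\<lambda>_ :: real ^ 'n. 0)"
  proof (rule Lp_norm_scale_le[OF p])
    have "continuous_on (UNIV \<times> H) v" using v unfolding weight_on_def semidirect_carrier_def by blast
    then have "continuous_on UNIV (\<lambda>x. v (x, h))"
      by (rule continuous_on_compose2) (use h in \<open>auto intro!: continuous_intros\<close>)
    then have [measurable]: "(\<lambda>x. v (x, h)) \<in> borel_measurable borel" by (rule borel_measurable_continuous_onI)
    have [measurable]: "?W \<in> borel_measurable borel" using W by (simp add: integrable_iff_bounded)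
    show "(\<lambda>x. ennreal (norm (?W x) * v (x, h))) \<in> borel_measurable lborel" by measurable
    show "AE x in lborel. ennreal (norm (?W x) * v (x, h)) \<le> ennreal 0 * 0" using AE by eventually_elim simp
  qed auto
  then show ?thesis by simp
qed

text \<open>The Haar density \<open>1 / |det h|\<close> of the mixed norm is absorbed as a factor
  \<open>|det h| powr (- 1 / q)\<close> under the \<open>q\<close>-th power.\<close>

lemma temperate_mixed_norm_finite:
  assumes q: "1 \<le> q" and w: "weight_on H (**) w"
    and fin: "(\<integral>\<^sup>+h. ennreal_powr (ennreal (\<bar>det h\<bar> powr (1 / 2 - 1 / q) * (1 + norm h) powr e * w h) * cross_integral l h) q \<partial>\<mu>) < \<infinity>"
  shows "Lp_norm (density \<mu> (\<lambda>h. ennreal (1 / \<bar>det h\<bar>))) (ennreal q)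
    (\<lambda>h. ennreal (\<bar>det h\<bar> powr (1 / 2) * (1 + norm h) powr e * w h) * cross_integral l h) < \<infinity>"
proof -
  have [measurable]: "w \<in> borel_measurable \<mu>"
    using w unfolding weight_on_def by (intro borel_measurable_mu) auto
  let ?R = "\<lambda>h. ennreal (\<bar>det h\<bar> powr (1 / 2) * (1 + norm h) powr e * w h) * cross_integral l h"
  have "(\<integral>\<^sup>+h. ennreal_powr (?R h) q \<partial>density \<mu> (\<lambda>h. ennreal (1 / \<bar>det h\<bar>))) = (\<integral>\<^sup>+h. ennreal (1 / \<bar>det h\<bar>) * ennreal_powr (?R h) q \<partial>\<mu>)"
    by (rule nn_integral_density) measurable
  also have "\<dots> = (\<integral>\<^sup>+h. ennreal_powr (ennreal (\<bar>det h\<bar> powr (1 / 2 - 1 / q) * (1 + norm h) powr e * w h) * cross_integral l h) q \<partial>\<mu>)"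
  proof (rule nn_integral_cong)
    fix h assume "h \<in> space \<mu>"
    then have h: "h \<in> H" by simp
    have wh: "0 < w h" using w h unfolding weight_on_def by blast
    have dh: "0 < \<bar>det h\<bar>" using invertible_H[OF h] by (simp add: invertible_det_nz)
    let ?c = "\<bar>det h\<bar> powr (- 1 / q)"
    have "?c powr q = \<bar>det h\<bar> powr (- 1 / q * q)" by (rule powr_powr)
    also have "- 1 / q * q = - 1" using q by simp
    also have "\<bar>det h\<bar> powr (- 1) = 1 / \<bar>det h\<bar>" using dh powr_minus_divide[of "\<bar>det h\<bar>" 1] by simp
    finally have c: "?c powr q = 1 / \<bar>det h\<bar>" .
    then have "ennreal (1 / \<bar>det h\<bar>) * ennreal_powr (?R h) q = ennreal_powr (ennreal ?c * ?R h) q"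
      using dh by (subst ennreal_powr_cmult) auto
    also have "ennreal ?c * ?R h = ennreal (?c * (\<bar>det h\<bar> powr (1 / 2) * (1 + norm h) powr e * w h)) * cross_integral l h"
      using wh by (subst ennreal_mult) (auto simp: mult.assoc)
    also have "?c * (\<bar>det h\<bar> powr (1 / 2) * (1 + norm h) powr e * w h) = \<bar>det h\<bar> powr (1 / 2 - 1 / q) * (1 + norm h) powr e * w h"
    proof -
      have "?c * \<bar>det h\<bar> powr (1 / 2) = \<bar>det h\<bar> powr (- 1 / q + 1 / 2)" by (rule powr_add[symmetric])
      also have "- 1 / q + 1 / 2 = 1 / 2 - 1 / q" by simp
      finally show ?thesis by (simp add: mult.assoc[symmetric])
    qed
    finally show "ennreal (1 / \<bar>det h\<bar>) * ennreal_powr (?R h) q = ennreal_powr (ennreal (\<bar>det h\<bar> powr (1 / 2 - 1 / q) * (1 + norm h) powr e * w h) * cross_integral l h) q" .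
  qed
  finally show ?thesis using fin q by (simp add: Lp_norm_def)
qed

end

text \<open>The term of order 0 in the supremum is a positive multiple of \<open>norm (u x)\<close>.\<close>

lemma schwartz_norm_eq_0_imp:
  fixes u :: "real ^ 'n::finite \<Rightarrow> complex"
  assumes "schwartz_norm (real t) (real t) u = 0"
  shows "u = (\<lambda>_. 0)"
proof
  fix x
  have js: "(SOME js :: 'n list. \<forall>i. count_list js i = 0) = []"
  proof -
    have "\<forall>i. count_list ([] :: 'n list) i = 0" by simp
    then have *: "\<forall>i. count_list (SOME js :: 'n list. \<forall>i. count_list js i = 0) i = 0" by (rule someI)
    show ?thesis
    proof (cases "SOME js :: 'n list. \<forall>i. count_list js i = 0")
      case (Cons j js)
      then show ?thesis using *[rule_format, of j] by simp
    qed
  qed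
  have "ennreal ((1 + norm x) powr real t * norm (multi_deriv (\<lambda>_. 0) u x)) \<le> schwartz_norm (real t) (real t) u"
    unfolding schwartz_norm_def by (rule SUP_upper2[of x], simp, rule SUP_upper2[of "\<lambda>_. 0"]) (simp_all add: multi_order_def)
  then have "ennreal ((1 + norm x) powr real t * norm (multi_deriv (\<lambda>_. 0) u x)) = 0"
    using assms by simp
  then have "(1 + norm x) powr real t * norm (multi_deriv (\<lambda>_. 0) u x) \<le> 0"
    by (simp only: ennreal_eq_0_iff)
  moreover have "0 < 1 + norm x" by (simp add: add_pos_nonneg)
  ultimately show "u x = 0" by (simp add: mult_le_0_iff multi_deriv_def js partials_def)
qed

section \<open>The weighted mixed norm estimate\<close>

theorem theorem3p7:
  fixes H :: "(real ^ 'n::finite ^ 'n) set"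
    and \<mu> :: "(real ^ 'n ^ 'n) measure"
    and Orb :: "(real ^ 'n) set"
    and v :: "(real ^ 'n) \<times> (real ^ 'n ^ 'n) \<Rightarrow> real"
    and w :: "(real ^ 'n ^ 'n) \<Rightarrow> real"
    and p :: ennreal and q s :: real and l t :: nat
  assumes "CARD('n) > 1"
    and "admissible_dilation_group H \<mu>"
    and "open_dual_orbit H Orb"
    and "1 \<le> p" and "1 \<le> q" and "0 \<le> s"
    and "weight_on (semidirect_carrier H) semidirect_mult v"
    and "weight_on H (**) w"
    and "\<And>x h. h \<in> H \<Longrightarrow> v (x, h) \<le> (1 + norm x) powr s * w h"
    and "temperately_embedded H \<mu> Orb s q w l"
    and "ennreal (real l + s + 1) + of_nat CARD('n) / p < of_nat t"
  shows "\<exists>C::real. C > 0 \<and>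
    (\<forall>f \<psi>. integrable lborel f \<and> integrable lborel \<psi> \<and>
       vanishing_moments (- Orb) t f \<and> vanishing_moments (- Orb) t \<psi> \<longrightarrow>
       mixed_norm \<mu> p (ennreal q) v (wavelet_transform \<psi> f)
         \<le> ennreal C * schwartz_norm t t (fourier f) * schwartz_norm t t (fourier \<psi>))"
proof -
  note p = assms(4) and q = assms(5) and s = assms(6) and v = assms(7) and w = assms(8) and vw = assms(9)
  let ?d = "real CARD('n)"
  let ?e = "s + ?d + 1"
  obtain \<xi>0 where \<xi>0: "\<xi>0 \<in> Orb"
    and T1: "(\<lambda>h. \<bar>det h\<bar> powr (1 / 2 - 1 / q) * (1 + norm h) powr ?e * w h * aux_A Orb (transpose h *v \<xi>0) ^ l) \<in> Lp_space \<mu> (ennreal q)"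
    and T2: "(\<lambda>h. \<bar>det h\<bar> powr (- 1 / 2 - 1 / q) * (1 + norm h) powr ?e * w h * aux_A Orb (transpose (matrix_inv h) *v \<xi>0) ^ l) \<in> Lp_space \<mu> 1"
    using assms(10) unfolding temperately_embedded_def by blast
  interpret G: haar_matrix_group H \<mu>
    using assms(2) unfolding admissible_dilation_group_def by unfold_locales auto
  interpret G: open_orbit H \<mu> Orb \<xi>0
  proof unfold_locales
    show "open Orb" using assms(3) unfolding open_dual_orbit_def by blast
    \<comment> \<open>The point \<open>\<xi>0\<close> of the temperate embedding need not be the base point that presents
      \<open>Orb\<close> as an orbit; any point of an orbit is a base point.\<close>
    obtain \<xi>1 where \<xi>1: "Orb = dual_orbit H \<xi>1" using assms(3) unfolding open_dual_orbit_def by blast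
    then obtain a where a: "a \<in> H" "\<xi>0 = transpose a *v \<xi>1" using \<xi>0 unfolding dual_orbit_def by auto
    have a_h: "transpose h *v \<xi>0 = transpose (a ** h) *v \<xi>1" for h :: "real ^ 'n ^ 'n" by (simp only: a(2) transpose_mult_vector)
    have a_inv: "a ** (matrix_inv a ** h) = h" for h :: "real ^ 'n ^ 'n"
      using matrix_inv_mult(1)[OF G.invertible_H[OF a(1)]] by (simp add: matrix_mul_assoc)
    show "Orb = dual_orbit H \<xi>0" unfolding \<xi>1
    proof (rule set_eqI, rule iffI)
      fix z assume "z \<in> dual_orbit H \<xi>1"
      then obtain h where h: "h \<in> H" "z = transpose h *v \<xi>1" unfolding dual_orbit_def by auto
      have "z = transpose (matrix_inv a ** h) *v \<xi>0" by (simp only: a_h a_inv h(2))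
      moreover have "matrix_inv a ** h \<in> H" by (intro G.mult_H G.inv_H a(1) h(1))
      ultimately show "z \<in> dual_orbit H \<xi>0" unfolding dual_orbit_def by blast
    next
      fix z assume "z \<in> dual_orbit H \<xi>0"
      then obtain h where h: "h \<in> H" "z = transpose h *v \<xi>0" unfolding dual_orbit_def by auto
      moreover have "a ** h \<in> H" by (intro G.mult_H a(1) h(1))
      ultimately show "z \<in> dual_orbit H \<xi>1" unfolding dual_orbit_def a_h by blast
    qed
  qed
  define dp where "dp = (if p = \<infinity> then 0 else ?d / enn2real p)"
  have a1: "1 \<le> enn2real p" if "p \<noteq> \<infinity>"
    using p that by (metis enn2real_mono enn2real_1 infinity_ennreal_def less_top)
  have dp: "0 \<le> dp" "dp \<le> ?d"
    unfolding dp_def using a1 by (auto simp: divide_le_eq mult_le_cancel_left1)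
  have "of_nat CARD('n) / p = ennreal dp"
  proof (cases p)
    case (real a)
    then have "1 \<le> a" using a1 by simp
    then show ?thesis using real by (simp add: dp_def divide_ennreal ennreal_of_nat_eq_real_of_nat)
  next
    case top
    then show ?thesis by (simp add: dp_def ennreal_divide_top)
  qed
  then have t: "real l + s + 1 + dp < real t"
    using assms(11) s dp by (simp add: ennreal_of_nat_eq_real_of_nat ennreal_plus[symmetric] ennreal_less_iff del: ennreal_plus)
  \<comment> \<open>The least integer above \<open>s + d/p\<close>: it lies within \<open>t - l\<close> by the hypothesis on \<open>t\<close>, and
    within \<open>s + d + 1\<close> because \<open>p \<ge> 1\<close>.\<close>
  define r where "r = nat \<lfloor>s + dp\<rfloor> + 1"
  have "real (nat \<lfloor>s + dp\<rfloor>) = of_int \<lfloor>s + dp\<rfloor>" using s dp by simp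
  then have r: "s + dp < real r" "real r \<le> s + dp + 1" unfolding r_def by linarith+
  have rl: "r + l < t" using r t by linarith
  have re: "real r \<le> ?e" using r dp by linarith
  have inf: "s \<le> real r" if "p = \<infinity>" using r(1) that unfolding dp_def by simp
  have fin: "s + ?d / enn2real p < real r" if "p \<noteq> \<infinity>" using r(1) that unfolding dp_def by simp
  obtain C where C: "0 < C" and main: "\<forall>h\<in>H. \<forall>f \<psi> N1 N2. integrable lborel f \<longrightarrow> integrable lborel \<psi> \<longrightarrow>
    vanishing_moments (- Orb) t f \<longrightarrow> vanishing_moments (- Orb) t \<psi> \<longrightarrow>
    schwartz_norm t t (fourier f) \<le> ennreal N1 \<longrightarrow> 0 \<le> N1 \<longrightarrow>
    schwartz_norm t t (fourier \<psi>) \<le> ennreal N2 \<longrightarrow> 0 \<le> N2 \<longrightarrow>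
    Lp_norm lborel p (\<lambda>x. ennreal (norm (wavelet_transform \<psi> f (x, h)) * v (x, h)))
      \<le> ennreal (C * N1 * N2) * (ennreal (\<bar>det h\<bar> powr (1 / 2) * (1 + norm h) powr ?e * w h) * G.cross_integral l h)"
    by (rule exE[OF G.wavelet_transform_Lp_le[OF p inf fin rl re v w vw]];
      (assumption | (elim conjE, rule that; assumption)))
  let ?R = "\<lambda>h. ennreal (\<bar>det h\<bar> powr (1 / 2) * (1 + norm h) powr ?e * w h) * G.cross_integral l h"
  let ?\<nu> = "density \<mu> (\<lambda>h. ennreal (1 / \<bar>det h\<bar>))"
  have e0: "0 \<le> ?e" using s by simp
  have Rfin: "Lp_norm ?\<nu> (ennreal q) ?R < \<infinity>"
    using G.temperate_cross_integral_finite[OF q e0 w T1 T2]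
    by (intro G.temperate_mixed_norm_finite[OF q w]) (simp add: G.cross_integral_def)
  have [measurable]: "w \<in> borel_measurable \<mu>"
    using w unfolding weight_on_def by (intro G.borel_measurable_mu) auto
  have Rm: "?R \<in> borel_measurable ?\<nu>" by measurable
  define D where "D = enn2real (Lp_norm ?\<nu> (ennreal q) ?R) + 1"
  have D: "0 < D" "Lp_norm ?\<nu> (ennreal q) ?R \<le> ennreal D"
  proof -
    have "Lp_norm ?\<nu> (ennreal q) ?R = ennreal (enn2real (Lp_norm ?\<nu> (ennreal q) ?R))" using Rfin by (simp add: less_top)
    also have "\<dots> \<le> ennreal D" unfolding D_def by (intro ennreal_leI) simp
    finally show "Lp_norm ?\<nu> (ennreal q) ?R \<le> ennreal D" .
    show "0 < D" unfolding D_def by (simp add: add_nonneg_pos)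
  qed
  have q1: "1 \<le> ennreal q" using q by simp
  have "mixed_norm \<mu> p (ennreal q) v (wavelet_transform \<psi> f) \<le> ennreal (C * D) * schwartz_norm t t (fourier f) * schwartz_norm t t (fourier \<psi>)"
    if f: "integrable lborel f" and \<psi>: "integrable lborel \<psi>"
      and vf: "vanishing_moments (- Orb) t f" and v\<psi>: "vanishing_moments (- Orb) t \<psi>" for f \<psi>
  proof -
    let ?N1 = "schwartz_norm t t (fourier f)" and ?N2 = "schwartz_norm t t (fourier \<psi>)"
    let ?L = "\<lambda>h. Lp_norm lborel p (\<lambda>x. ennreal (norm (wavelet_transform \<psi> f (x, h)) * v (x, h)))"
    have scale: "mixed_norm \<mu> p (ennreal q) v (wavelet_transform \<psi> f) \<le> ennreal K * ennreal D"
      if "0 \<le> K" "\<And>h. h \<in> H \<Longrightarrow> ?L h \<le> ennreal K * ?R h" for K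
    proof -
      have "mixed_norm \<mu> p (ennreal q) v (wavelet_transform \<psi> f) \<le> ennreal K * Lp_norm ?\<nu> (ennreal q) ?R"
        unfolding mixed_norm_def using that
        by (intro Lp_norm_scale_le[OF q1 _ Rm]) (auto intro!: AE_I2)
      also have "\<dots> \<le> ennreal K * ennreal D" by (intro mult_left_mono D(2)) simp
      finally show ?thesis .
    qed
    \<comment> \<open>A product of extended nonnegative reals is 0 as soon as one factor is, so the
      vanishing norms come first.\<close>
    consider "?N1 = 0 \<or> ?N2 = 0" | "?N1 \<noteq> 0" "?N2 \<noteq> 0" "?N1 = \<infinity> \<or> ?N2 = \<infinity>" | N1 N2 where "?N1 = ennreal N1" "0 \<le> N1" "?N2 = ennreal N2" "0 \<le> N2"
      by (cases ?N1; cases ?N2) auto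
    then show ?thesis
    proof cases
      case 1
      then have "fourier f = (\<lambda>_. 0) \<or> fourier \<psi> = (\<lambda>_. 0)" using schwartz_norm_eq_0_imp by blast
      then have "?L h = 0" if "h \<in> H" for h by (rule G.wavelet_transform_Lp_zero[OF p that f \<psi> _ v])
      then show ?thesis using scale[of 0] by simp
    next
      case 2
      then have "ennreal (C * D) * ?N1 * ?N2 = \<infinity>" using C D by (auto simp: ennreal_mult_eq_top_iff)
      then show ?thesis by simp
    next
      case 3
      have "mixed_norm \<mu> p (ennreal q) v (wavelet_transform \<psi> f) \<le> ennreal (C * N1 * N2) * ennreal D"
      proof (rule scale)
        show "0 \<le> C * N1 * N2" using C 3 by simp
        show "?L h \<le> ennreal (C * N1 * N2) * ?R h" if "h \<in> H" for h
          using 3 by (intro main[rule_format] that f \<psi> vf v\<psi>) simp_all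
      qed
      also have "\<dots> = ennreal (C * D) * ?N1 * ?N2" using 3 C D by (simp add: ennreal_mult[symmetric] ac_simps)
      finally show ?thesis .
    qed
  qed
  moreover have "0 < C * D" using C D by simp
  ultimately show ?thesis by blast
qed

end
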